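(* The double Cayley Grassmannian $DG$ parametrizes the eight-dimensional isotropic subalgebras of the complexified bioctonions.
   Context: Let $\mathbb{O}_{\mathbb{R}}$ be the real octonion algebra and $\mathbb{O}=\mathbb{O}_{\mathbb{R}}\otimes_{\mathbb{R}}\mathbb{C}$ the complex octonion algebra, with its norm (a nondegenerate quadratic form $q$), its seven-dimensional imaginary part $Im\,\mathbb{O}$, and its automorphism group $G_2$. The bioctonions are the algebra $\mathbb{C}\otimes_{\mathbb{R}}\mathbb{O}_{\mathbb{R}}$; the complexified bioctonions are $\mathbb{C}\otimes_{\mathbb{R}}\mathbb{C}\otimes_{\mathbb{R}}\mathbb{O}_{\mathbb{R}}\simeq\mathbb{O}\oplus\mathbb{O}$. Isotropic means totally isotropic with respect to the difference of the octonionic norms on the two copies of $\mathbb{O}$, that is, the quadratic form $(x,y)\mapsto q(x)-q(y)$. The double Cayley Grassmannian $DG$ is the unique smooth projective equivariant completion with Picard number one of $G_2$, considered as the symmetric space $(G_2\times G_2)/G_2$. The point $g$ of the open orbit $G_2\subset DG$ corresponds to the subalgebra given by the graph $\Gamma_g=\{(x,g(x)) : x\in\mathbb{O}\}\subset\mathbb{O}\oplus\mathbb{O}$. This graph is generated by the unit element and the seven-dimensional isotropic space $L_g=\Gamma_g\cap(Im\,\mathbb{O}\oplus Im\,\mathbb{O})$. The map $g\mapsto L_g$ embeds $G_2$ in the spinor variety of $Spin_{14}$, which is one of the two families of maximal isotropic subspaces of the fourteen-dimensional space $Im\,\mathbb{O}\oplus Im\,\mathbb{O}$, and $DG$ is the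 closure of the image.
   Formalization: Only isotropic subalgebras (containing the unit) whose imaginary part lies in the spinor variety, the family of maximal isotropic subspaces containing the L_g, are counted; eight-dimensional isotropic subalgebras in the other family exist and are not points of DG. *)

theory Defs
  imports "HOL-Analysis.Analysis"
begin

section \<open>Octonions\<close>

text \<open>
  An octonion is a pair (scalar part, imaginary part); the imaginary units are indexed by the
  integers modulo 7 (the type \<^typ>\<open>7\<close>, whose arithmetic is modular) and multiply according to
  \<open>e\<^sub>i e\<^sub>i\<^sub>+\<^sub>1 = e\<^sub>i\<^sub>+\<^sub>3\<close>.  The structure constants are integers, so
  \<^typ>\<open>complex\<close>-coordinates give exactly the complexification of the real octonion algebra, which
  is the case of \<^typ>\<open>real\<close>-coordinates.
\<close>

type_synonym 'a octonion = "'a \<times> ('a ^ 7)"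

definition dot7 :: "'a::comm_ring_1 ^ 7 \<Rightarrow> 'a ^ 7 \<Rightarrow> 'a" where
  "dot7 u v = (\<Sum>i\<in>UNIV. u $ i * v $ i)"

definition cross7 :: "'a::comm_ring_1 ^ 7 \<Rightarrow> 'a ^ 7 \<Rightarrow> 'a ^ 7" where
  "cross7 u v = (\<chi> i.
      u $ (i + 1) * v $ (i + 3) - u $ (i + 3) * v $ (i + 1)
    + u $ (i + 2) * v $ (i + 6) - u $ (i + 6) * v $ (i + 2)
    + u $ (i + 4) * v $ (i + 5) - u $ (i + 5) * v $ (i + 4))"

definition oct_mult :: "'a::comm_ring_1 octonion \<Rightarrow> 'a octonion \<Rightarrow> 'a octonion" where
  "oct_mult x y =
     (fst x * fst y - dot7 (snd x) (snd y),
      fst x *s snd y + fst y *s snd x + cross7 (snd x) (snd y))"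

definition oct_one :: "'a::comm_ring_1 octonion" where
  "oct_one = (1, 0)"

definition oct_norm :: "'a::comm_ring_1 octonion \<Rightarrow> 'a" where
  "oct_norm x = fst x * fst x + dot7 (snd x) (snd x)"


section \<open>The complex octonion algebra and the complexified bioctonions\<close>

definition oct_scale :: "complex \<Rightarrow> complex octonion \<Rightarrow> complex octonion" where
  "oct_scale c x = (c * fst x, c *s snd x)"

definition G2 :: "(complex octonion \<Rightarrow> complex octonion) set" where
  "G2 = {g. Vector_Spaces.linear oct_scale oct_scale g \<and> bij g \<and>
            (\<forall>x y. g (oct_mult x y) = oct_mult (g x) (g y))}"

text \<open>
  The complexified bioctonions are taken in the form of the direct sum of two copies of the complex
  octonions; this is the decomposition that the quadratic form below refers to.
\<close>

type_synonym bioctonion = "complex octonion \<times> complex octonion"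

definition bioct_scale :: "complex \<Rightarrow> bioctonion \<Rightarrow> bioctonion" where
  "bioct_scale c z = (oct_scale c (fst z), oct_scale c (snd z))"

definition bioct_mult :: "bioctonion \<Rightarrow> bioctonion \<Rightarrow> bioctonion" where
  "bioct_mult z w = (oct_mult (fst z) (fst w), oct_mult (snd z) (snd w))"

definition bioct_one :: bioctonion where
  "bioct_one = (oct_one, oct_one)"

definition bioct_form :: "bioctonion \<Rightarrow> complex" where
  "bioct_form z = oct_norm (fst z) - oct_norm (snd z)"

definition Im_Im :: "bioctonion set" where
  "Im_Im = {z. fst (fst z) = 0 \<and> fst (snd z) = 0}"

definition oct_basis :: "complex octonion set" where
  "oct_basis = {1} \<times> {0} \<union> {0} \<times> cart_basis"

definition bioct_basis :: "bioctonion set" where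
  "bioct_basis = oct_basis \<times> {0} \<union> {0} \<times> oct_basis"

global_interpretation oct: finite_dimensional_vector_space oct_scale oct_basis
proof -
  interpret P: finite_dimensional_vector_space_prod
      "(*) :: complex \<Rightarrow> complex \<Rightarrow> complex" "(*s) :: complex \<Rightarrow> complex ^ 7 \<Rightarrow> complex ^ 7" "{1}" cart_basis
    ..
  have "P.scale = oct_scale"
    by (simp add: fun_eq_iff P.scale_def oct_scale_def)
  moreover have "P.Basis_pair = oct_basis"
    by (simp add: P.Basis_pair_def oct_basis_def)
  ultimately show "finite_dimensional_vector_space oct_scale oct_basis"
    using P.p.finite_dimensional_vector_space_axioms by simp
qed

global_interpretation bioct: finite_dimensional_vector_space bioct_scale bioct_basis
proof -
  interpret P: finite_dimensional_vector_space_prod oct_scale oct_scale oct_basis oct_basis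
    ..
  have "P.scale = bioct_scale"
    by (simp add: fun_eq_iff P.scale_def bioct_scale_def)
  moreover have "P.Basis_pair = bioct_basis"
    by (simp add: P.Basis_pair_def bioct_basis_def)
  ultimately show "finite_dimensional_vector_space bioct_scale bioct_basis"
    using P.p.finite_dimensional_vector_space_axioms by simp
qed

definition isotropic :: "bioctonion set \<Rightarrow> bool" where
  "isotropic A \<longleftrightarrow> bioct.subspace A \<and> (\<forall>z\<in>A. bioct_form z = 0)"

definition subalgebra :: "bioctonion set \<Rightarrow> bool" where
  "subalgebra A \<longleftrightarrow> bioct.subspace A \<and> bioct_one \<in> A \<and> (\<forall>z\<in>A. \<forall>w\<in>A. bioct_mult z w \<in> A)"


section \<open>The spinor variety and the double Cayley Grassmannian\<close>

definition oct_graph :: "(complex octonion \<Rightarrow> complex octonion) \<Rightarrow> bioctonion set" where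
  "oct_graph g = {(x, g x) | x. True}"

definition im_graph :: "(complex octonion \<Rightarrow> complex octonion) \<Rightarrow> bioctonion set" where
  "im_graph g = oct_graph g \<inter> Im_Im"

definition Gr7 :: "bioctonion set set" where
  "Gr7 = {L. bioct.subspace L \<and> L \<subseteq> Im_Im \<and> bioct.dim L = 7}"

text \<open>
  Maximal isotropic subspaces of a quadratic space of dimension \<open>2n\<close> form two families; two of
  them belong to the same family iff their intersection has even codimension in each of them.
  Here \<open>n = 7\<close>, and the relevant family is the one containing the subspace attached to the
  identity of \<^const>\<open>G2\<close>.  The choice of family matters: there are also eight-dimensional isotropic
  unital subalgebras of the bioctonions whose imaginary part lies in the other family, and these are
  not limits of graphs of automorphisms.
\<close>

definition same_family :: "bioctonion set \<Rightarrow> bioctonion set \<Rightarrow> bool" where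
  "same_family L M \<longleftrightarrow> even (bioct.dim L - bioct.dim (L \<inter> M))"

definition spinor_variety :: "bioctonion set set" where
  "spinor_variety = {L \<in> Gr7. isotropic L \<and> same_family L (im_graph id)}"

text \<open>
  Zariski topology of the Grassmannian.  The Grassmannian is the quotient of the variety of
  linearly independent 7-tuples (an open subset of the affine space \<open>(Im \<oplus> Im)\<^sup>7\<close>) by
  \<open>GL\<^sub>7\<close>, so a set of subspaces is closed iff the set of all bases of its members is cut out by
  polynomial functions among all linearly independent 7-tuples.
\<close>

inductive poly_fun :: "((7 \<Rightarrow> bioctonion) \<Rightarrow> complex) \<Rightarrow> bool" where
  poly_fun_const: "poly_fun (\<lambda>v. c)"
| poly_fun_coord: "Vector_Spaces.linear bioct_scale (*) \<phi> \<Longrightarrow> poly_fun (\<lambda>v. \<phi> (v i))"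
| poly_fun_add: "poly_fun p \<Longrightarrow> poly_fun q \<Longrightarrow> poly_fun (\<lambda>v. p v + q v)"
| poly_fun_mult: "poly_fun p \<Longrightarrow> poly_fun q \<Longrightarrow> poly_fun (\<lambda>v. p v * q v)"

definition frames :: "(7 \<Rightarrow> bioctonion) set" where
  "frames = {v. inj v \<and> bioct.independent (range v) \<and> range v \<subseteq> Im_Im}"

definition zariski_closed :: "bioctonion set set \<Rightarrow> bool" where
  "zariski_closed Z \<longleftrightarrow> Z \<subseteq> Gr7 \<and>
     (\<exists>P. (\<forall>p\<in>P. poly_fun p) \<and>
          (\<forall>v\<in>frames. bioct.span (range v) \<in> Z \<longleftrightarrow> (\<forall>p\<in>P. p v = 0)))"

definition zariski_closure :: "bioctonion set set \<Rightarrow> bioctonion set set" where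
  "zariski_closure S = \<Inter>{Z. zariski_closed Z \<and> S \<subseteq> Z}"

definition double_Cayley_Grassmannian :: "bioctonion set set" where
  "double_Cayley_Grassmannian = zariski_closure (im_graph ` G2)"

end

theory Submission
  imports Defs
begin

text \<open>
  The members of an isotropic unital subalgebra \<open>A\<close> are orthogonal to the unit, so their two scalar
  parts agree, and \<open>A\<close> is spanned by the unit and \<open>L = A \<inter> Im_Im\<close>.  An isotropic \<open>L\<close> spans a
  subalgebra together with the unit iff it is closed under the componentwise cross product.  The
  theorem therefore says that the closure of the graphs of automorphisms consists of the
  cross-closed members of the spinor variety (\<open>double_Cayley_Grassmannian_eq\<close>).

  The heart of the matter is a classification of cross-closed isotropic seven-dimensional \<open>L\<close>
  (\<open>classification\<close>).  View \<open>L\<close> as a relation on the seven-dimensional space of imaginary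
  octonions.  Its left kernel \<open>K\<close> is totally isotropic, and the domain of the relation is the
  orthogonal of \<open>K\<close>, so closure under products makes \<open>K\<close> stable under multiplication by its own
  orthogonal.  Such a \<open>K\<close> is zero, or conjugate to one particular plane with zero product, or
  conjugate to one particular three-space (\<open>null_ideal_cases\<close>); the right kernel has the same
  dimension.  With zero kernels \<open>L\<close> is the graph of an automorphism; with planes it has exactly
  one normal form up to the action of \<open>G2 \<times> G2\<close>; with three-spaces it has two, which differ by a
  sign on the one-dimensional quotient of the orthogonal of \<open>K\<close> by \<open>K\<close>.  Conjugation is possible
  because any three mutually orthogonal null vectors with a suitably normalised triple product
  generate a Zorn basis, so that \<open>G2\<close> acts transitively on such triples (\<open>zorn_map_automorphism\<close>).

  All normal forms except the one with the wrong sign are limits at \<open>t = 0\<close> of graphs of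
  automorphisms that are diagonal in a Zorn basis with entries powers of \<open>t\<close>
  (\<open>degeneration_in_closure\<close>).  For the remaining one, some automorphism graph meets it only in
  zero.  Any two automorphism graphs, however, lie in the same family (\<open>graph7_same_family\<close>) and
  hence meet in odd dimension.  So the wrong sign is excluded from the spinor variety by the parity
  of the intersection (\<open>lagrangian_parity\<close>), and from the closure by the polynomial condition that
  \<open>L\<close> meets every automorphism graph in a nonzero vector; this condition, isotropy, and the
  vanishing of the difference of the two triple products cut out a closed set that contains the
  graphs (\<open>zariski_closed_graph_limits\<close>).
\<close>

section \<open>Lagrangian subspaces and their two families\<close>

locale nondegenerate_form = finite_dimensional_vector_space scale Basis
  for scale :: "'a::field_char_0 \<Rightarrow> 'b::ab_group_add \<Rightarrow> 'b" (infixr "*s" 75)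
    and Basis :: "'b set" +
  fixes B :: "'b \<Rightarrow> 'b \<Rightarrow> 'a"
  assumes form_add: "B (x + y) z = B x z + B y z"
    and form_scale: "B (c *s x) z = c * B x z"
    and form_sym: "B x y = B y x"
    and form_nondegenerate: "(\<And>y. B x y = 0) \<Longrightarrow> x = 0"
begin

definition perp :: "'b set \<Rightarrow> 'b set" where
  "perp S = {x. \<forall>y\<in>S. B x y = 0}"

definition lagrangian :: "'b set \<Rightarrow> bool" where
  "lagrangian L \<longleftrightarrow> subspace L \<and> perp L = L"

lemma form_add_right: "B z (x + y) = B z x + B z y"
  by (metis form_add form_sym)

lemma form_scale_right: "B z (c *s x) = c * B z x"
  by (metis form_scale form_sym)

lemma form_zero [simp]: "B 0 z = 0" "B z 0 = 0"
  using form_scale[of 0 0 z] by (simp_all add: form_sym[of z])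

lemma subspace_perp: "subspace (perp S)"
  by (auto simp: subspace_def perp_def form_add form_scale)

lemma perp_span: "perp (span S) = perp S"
proof -
  have "B x y = 0" if "\<forall>y\<in>S. B x y = 0" "y \<in> span S" for x y
    using that(2,1) by (induction rule: span_induct_alt) (auto simp: form_add_right form_scale_right)
  then show ?thesis
    by (auto simp: perp_def span_base)
qed

lemma perp_mono: "S \<subseteq> T \<Longrightarrow> perp T \<subseteq> perp S"
  by (auto simp: perp_def)

lemma perp_Un: "perp (S \<union> T) = perp S \<inter> perp T"
  by (auto simp: perp_def)

lemma subset_perp_perp: "S \<subseteq> perp (perp S)"
  by (auto simp: perp_def form_sym)

lemma dim_hyperplane_section:
  assumes U: "subspace U"
  shows "dim U \<le> dim (U \<inter> perp {m}) + 1"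
proof (cases "\<exists>u\<in>U. B u m \<noteq> 0")
  case True
  then obtain u where u: "u \<in> U" "B u m \<noteq> 0" by blast
  have "U \<subseteq> span (insert u (U \<inter> perp {m}))"
  proof
    fix x assume x: "x \<in> U"
    let ?y = "x - (B x m / B u m) *s u"
    have "B ?y m = 0"
      using u form_add[of ?y "(B x m / B u m) *s u" m] by (simp add: form_scale)
    moreover have "?y \<in> U"
      using U u x by (intro subspace_diff subspace_scale)
    ultimately have "?y \<in> span (insert u (U \<inter> perp {m}))"
      by (intro span_base) (auto simp: perp_def)
    then have "?y + (B x m / B u m) *s u \<in> span (insert u (U \<inter> perp {m}))"
      by (intro span_add span_scale) (auto intro: span_base)
    then show "x \<in> span (insert u (U \<inter> perp {m}))" by simp
  qed
  then have "dim U \<le> dim (insert u (U \<inter> perp {m}))"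
    by (rule dim_mono)
  then show ?thesis by (auto simp: dim_insert split: if_splits)
next
  case False
  then have "U \<inter> perp {m} = U" by (auto simp: perp_def)
  then show ?thesis by simp
qed

lemma dim_section_ge:
  assumes "finite C" "subspace U"
  shows "dim U \<le> dim (U \<inter> perp C) + card C"
  using assms
proof (induction C)
  case empty
  then show ?case by (simp add: perp_def)
next
  case (insert m C)
  have "subspace (U \<inter> perp C)"
    using insert.prems subspace_perp by (rule subspace_inter)
  from dim_hyperplane_section[OF this, of m]
  have "dim (U \<inter> perp C) \<le> dim (U \<inter> perp (insert m C)) + 1"
    using perp_Un[of "{m}" C] by (simp add: Int_ac)
  with insert show ?case by simp
qed

text \<open>
  Both inequalities come from counting equations.  The orthogonal of \<open>W\<close> is cut out by the
  members of a basis of \<open>W\<close>; conversely the members of \<open>W\<close> that are orthogonal to a complement of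
  the orthogonal of \<open>W\<close> are orthogonal to everything, hence zero.
\<close>

lemma dim_perp:
  assumes W: "subspace W"
  shows "dim (perp W) + dim W = dimension"
proof (rule antisym)
  obtain S where S: "S \<subseteq> perp W" "independent S" "perp W \<subseteq> span S" "card S = dim (perp W)"
    using basis_exists by metis
  obtain T where T: "S \<subseteq> T" "independent T" "UNIV \<subseteq> span T"
    using S(2) maximal_independent_subset_extend[of S UNIV] by auto
  have fin: "finite T" "finite S"
    using T S(2) finiteI_independent by auto
  have cT: "card T = dimension"
    using T basis_card_eq_dim[of T UNIV] by (auto simp: dimension_def)
  have "W \<inter> perp (T - S) \<subseteq> {0}"
  proof
    fix w assume w: "w \<in> W \<inter> perp (T - S)"
    have "w \<in> perp S"
      using w S(1) by (auto simp: perp_def form_sym)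
    with w have "w \<in> perp T"
      using perp_Un[of S "T - S"] T(1) by (simp add: Un_absorb1)
    then have "w \<in> perp UNIV"
      using perp_span[of T] T(3) by (simp add: top.extremum_unique)
    then show "w \<in> {0}"
      using form_nondegenerate by (auto simp: perp_def)
  qed
  then have "dim (W \<inter> perp (T - S)) = 0" by simp
  then have "dim W \<le> card (T - S)"
    using dim_section_ge[OF _ W, of "T - S"] fin by (simp del: dim_eq_0)
  then show "dim (perp W) + dim W \<le> dimension"
    using S(4) T(1) fin cT card_Diff_subset[of S T] card_mono[of T S] by simp
next
  obtain C where C: "C \<subseteq> W" "independent C" "W \<subseteq> span C" "card C = dim W"
    using basis_exists by metis
  then have "span C = W"
    using W span_minimal by blast
  then show "dimension \<le> dim (perp W) + dim W"
    using dim_section_ge[of C UNIV] C finiteI_independent perp_span[of C] by (auto simp: dimension_def)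
qed

lemma perp_perp:
  assumes "subspace W"
  shows "perp (perp W) = W"
  using subset_perp_perp[of W] dim_perp[OF assms] dim_perp[OF subspace_perp, of W]
    subspace_dim_equal[OF assms subspace_perp, of "perp W"]
  by simp

text \<open>
  Missing members of a partial null triple are found in this way: they have to be orthogonal to
  some given vectors but not to another one.
\<close>

lemma separating_vector:
  assumes "v \<notin> span S"
  obtains m where "\<And>x. x \<in> S \<Longrightarrow> B m x = 0" "B m v \<noteq> 0"
proof -
  have "v \<notin> perp (perp S)"
    using assms perp_perp[OF subspace_span, of S] by (simp add: perp_span)
  then obtain m where "m \<in> perp S" "B v m \<noteq> 0"
    by (auto simp: perp_def)
  then show thesis
    using that[of m] form_sym by (auto simp: perp_def)
qed

lemma dim_lagrangian: "lagrangian L \<Longrightarrow> 2 * dim L = dimension"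
  using dim_perp[of L] by (simp add: lagrangian_def)

lemma lagrangian_if_half_dimension:
  assumes "subspace L" "\<And>x y. x \<in> L \<Longrightarrow> y \<in> L \<Longrightarrow> B x y = 0" "2 * dim L = dimension"
  shows "lagrangian L"
proof -
  have "L \<subseteq> perp L"
    using assms(2) by (auto simp: perp_def)
  moreover have "dim (perp L) = dim L"
    using dim_perp[OF assms(1)] assms(3) by simp
  ultimately have "L = perp L"
    using subspace_dim_equal[OF assms(1) subspace_perp] by auto
  then show ?thesis
    using assms(1) by (simp add: lagrangian_def)
qed

text \<open>
  The orthogonal of \<open>L + X\<close> is \<open>L \<inter> perp X\<close>, so this is the dimension formula for a sum of two
  subspaces.
\<close>

lemma dim_lagrangian_Int:
  assumes L: "lagrangian L" and X: "subspace X"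
  shows "2 * dim (L \<inter> X) + dimension = 2 * dim X + 2 * dim (L \<inter> perp X)"
proof -
  let ?S = "{x + y |x y. x \<in> L \<and> y \<in> X}"
  have sL: "subspace L" using L by (simp add: lagrangian_def)
  have S: "?S = span (L \<union> X)"
    using sL X by (auto simp: span_Un span_eq_iff[THEN iffD2])
  have "perp ?S = L \<inter> perp X"
    using L by (simp add: S perp_span perp_Un lagrangian_def)
  then have "dim (L \<inter> perp X) + dim ?S = dimension"
    using dim_perp[of ?S] S by simp
  then show ?thesis
    using dim_sums_Int[OF sL X] dim_lagrangian[OF L] by simp
qed

text \<open>
  If two Lagrangian subspaces meet in a hyperplane \<open>W\<close>, they give the only two isotropic lines of
  the hyperbolic plane \<open>perp W / W\<close>.  A third Lagrangian subspace induces an isotropic line of that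
  plane, hence contains one more dimension of exactly one of the two.
\<close>

lemma adjacent_lagrangians_parity:
  assumes L: "lagrangian L" and L': "lagrangian L'" and N: "lagrangian N"
    and adj: "dim (L \<inter> L') + 1 = dim L"
  shows "odd (dim (L \<inter> N) + dim (L' \<inter> N))"
proof -
  let ?W = "L \<inter> L'"
  note subs = L[unfolded lagrangian_def, THEN conjunct1] L'[unfolded lagrangian_def, THEN conjunct1]
    N[unfolded lagrangian_def, THEN conjunct1]
  have perps: "perp L = L" "perp L' = L'" "perp N = N"
    using L L' N by (simp_all add: lagrangian_def)
  have W: "subspace ?W" using subs by (simp add: subspace_inter)
  let ?S = "{x + y |x y. x \<in> L \<and> y \<in> L'}"
  have S: "?S = span (L \<union> L')"
    using subs by (auto simp: span_Un span_eq_iff[THEN iffD2])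
  have perpW: "perp ?W = ?S"
  proof -
    have "perp ?S = ?W"
      using perps by (simp add: S perp_span perp_Un)
    then show ?thesis
      using perp_perp[of ?S] S by simp
  qed
  have dims: "dim (N \<inter> perp ?W) = dim (N \<inter> ?W) + 1"
    using dim_lagrangian_Int[OF N W] adj dim_lagrangian[OF L] by simp
  \<comment> \<open>the vectors of \<open>perp W\<close> on which the form vanishes lie in one of the two subspaces\<close>
  have cover: "x \<in> L \<or> x \<in> L'" if x: "x \<in> N \<inter> perp ?W" for x
  proof (rule ccontr)
    assume not: "\<not> (x \<in> L \<or> x \<in> L')"
    obtain l l' where l: "x = l + l'" "l \<in> L" "l' \<in> L'"
      using x perpW by auto
    have "l' \<notin> L" using not l subs by (auto simp: subspace_add)
    have "L \<subseteq> span (insert l ?W)"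
    proof -
      have nl: "l \<notin> ?W" using not l subs by (auto simp: subspace_add)
      then have "l \<notin> span ?W"
        using W by (simp add: span_eq_iff[THEN iffD2])
      then have d: "dim (span (insert l ?W)) = dim L"
        using adj by (simp add: dim_insert)
      moreover have "span (insert l ?W) \<subseteq> L"
        using l subs by (intro span_minimal) auto
      ultimately have "span (insert l ?W) = L"
        using subspace_dim_equal[OF subspace_span subs(1)] by auto
      then show ?thesis by simp
    qed
    moreover have "B l' w = 0" if "w \<in> ?W" for w
      using that l perps(2) by (auto simp: perp_def)
    moreover have "l' \<notin> perp L" using \<open>l' \<notin> L\<close> perps by simp
    ultimately have "B l' l \<noteq> 0"
      using perp_span[of "insert l ?W"] perp_mono[of L "span (insert l ?W)"]
      by (auto simp: perp_def)
    moreover have "B x x = 0" "B l l = 0" "B l' l' = 0"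
      using x l perps by (auto simp: perp_def)
    then have "2 * B l' l = 0"
      using form_sym[of l l'] by (simp add: l(1) form_add form_add_right)
    ultimately show False by simp
  qed
  have sub: "subspace (N \<inter> perp ?W)"
    using subs subspace_perp by (simp add: subspace_inter)
  have "N \<inter> perp ?W \<subseteq> L \<or> N \<inter> perp ?W \<subseteq> L'"
  proof (rule ccontr)
    assume "\<not> ?thesis"
    then obtain a b where a: "a \<in> N \<inter> perp ?W" "a \<notin> L" and b: "b \<in> N \<inter> perp ?W" "b \<notin> L'"
      by blast
    then have ab: "a \<in> L'" "b \<in> L" using cover by auto
    have "a + b \<in> L \<or> a + b \<in> L'"
      using cover[of "a + b"] subspace_add[OF sub a(1) b(1)] by blast
    then show False
      using a b ab subspace_diff[OF subs(1), of "a + b" b] subspace_diff[OF subs(2), of "a + b" a]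
      by auto
  qed
  moreover have NL: "N \<inter> L \<subseteq> perp ?W" "N \<inter> L' \<subseteq> perp ?W"
    using perps perp_mono[of ?W L] perp_mono[of ?W L'] by auto
  moreover have "dim (L \<inter> N) + dim (L' \<inter> N) = 2 * dim (N \<inter> ?W) + 1"
    if "N \<inter> perp ?W \<subseteq> L"
  proof -
    have "L \<inter> N = N \<inter> perp ?W" "L' \<inter> N = N \<inter> ?W"
      using that NL by auto
    then show ?thesis using dims by simp
  qed
  moreover have "dim (L \<inter> N) + dim (L' \<inter> N) = 2 * dim (N \<inter> ?W) + 1"
    if "N \<inter> perp ?W \<subseteq> L'"
  proof -
    have "L' \<inter> N = N \<inter> perp ?W" "L \<inter> N = N \<inter> ?W"
      using that NL by auto
    then show ?thesis using dims by simp
  qed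
  ultimately have "dim (L \<inter> N) + dim (L' \<inter> N) = 2 * dim (N \<inter> ?W) + 1"
    by blast
  then show ?thesis by simp
qed

text \<open>
  Exchanging a line of \<open>L\<close> for a line of \<open>M\<close> changes the parity of every intersection dimension,
  so moving step by step from \<open>L\<close> to \<open>M\<close> compares their intersections with \<open>N\<close>.
\<close>

theorem lagrangian_parity:
  assumes "lagrangian L" "lagrangian M" "lagrangian N"
  shows "even (dim (L \<inter> M) + dim (L \<inter> N) + dim (M \<inter> N) + dim L)"
  using assms(1)
proof (induction "dim M - dim (L \<inter> M)" arbitrary: L rule: less_induct)
  case less
  note L = less.prems
  have sub: "subspace L" "subspace M" "perp L = L" "perp M = M"
    using L assms by (simp_all add: lagrangian_def)
  have dd: "dim L = dim M" using dim_lagrangian[OF L] dim_lagrangian[OF assms(2)] by linarith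
  show ?case
  proof (cases "M \<subseteq> L")
    case True
    then have "M = L"
      using dd sub subspace_dim_equal[of M L] by simp
    then have "dim (L \<inter> M) + dim (L \<inter> N) + dim (M \<inter> N) + dim L = 2 * (dim L + dim (L \<inter> N))"
      by simp
    then show ?thesis by (metis dvd_triv_left)
  next
    case False
    then obtain m where m: "m \<in> M" "m \<notin> L" by blast
    let ?W = "L \<inter> perp {m}" and ?L' = "span (insert m (L \<inter> perp {m}))"
    have W: "subspace ?W" using sub subspace_perp by (simp add: subspace_inter)
    have mm: "B m m = 0" using m sub(4) by (auto simp: perp_def)
    have "m \<notin> ?W" using m by simp
    then have dL': "dim ?L' = dim ?W + 1"
      using W by (simp add: dim_insert span_eq_iff[THEN iffD2])
    have "?W \<noteq> L"
    proof
      assume "?W = L"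
      then have "m \<in> perp L" by (auto simp: perp_def form_sym)
      then show False using m sub by simp
    qed
    then have "dim ?W \<noteq> dim L"
      using subspace_dim_equal[OF W sub(1)] by auto
    moreover have "dim ?W \<le> dim L" by (rule dim_subset) auto
    ultimately have dW: "dim L = dim ?W + 1"
      using dim_hyperplane_section[OF sub(1), of m] by simp
    have iso: "?L' \<subseteq> perp ?L'"
    proof -
      have "x \<in> perp (insert m ?W)" if "x \<in> insert m ?W" for x
      proof -
        have "B w v = 0" "B w m = 0" "B m w = 0" if "w \<in> ?W" "v \<in> ?W" for w v
          using that sub(3) form_sym[of m w] by (auto simp: perp_def)
        then have "B x y = 0" if "y \<in> insert m ?W" for y
          using that \<open>x \<in> insert m ?W\<close> mm by blast
        then show ?thesis by (simp add: perp_def)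
      qed
      then show ?thesis
        using span_minimal[OF _ subspace_perp, of "insert m ?W" "insert m ?W"]
        by (auto simp: perp_span)
    qed
    have L': "lagrangian ?L'"
      by (rule lagrangian_if_half_dimension)
        (use iso dL' dW dim_lagrangian[OF L] in \<open>auto simp: perp_def\<close>)
    have LL': "L \<inter> ?L' = ?W"
    proof
      show "?W \<subseteq> L \<inter> ?L'" by (auto intro: span_base)
      show "L \<inter> ?L' \<subseteq> ?W"
        using iso by (auto simp: perp_def intro: span_base)
    qed
    have odd1: "odd (dim (L \<inter> N) + dim (?L' \<inter> N))"
      by (rule adjacent_lagrangians_parity[OF L L' assms(3)]) (use LL' dW in simp)
    have odd2: "odd (dim (L \<inter> M) + dim (?L' \<inter> M))"
      by (rule adjacent_lagrangians_parity[OF L L' assms(2)]) (use LL' dW in simp)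
    have "insert m (L \<inter> M) \<subseteq> ?L' \<inter> M"
      using m sub(4) by (auto simp: perp_def intro: span_base)
    moreover have "m \<notin> span (L \<inter> M)"
      using m sub by (simp add: span_eq_iff[THEN iffD2] subspace_inter)
    ultimately have "dim (L \<inter> M) + 1 \<le> dim (?L' \<inter> M)"
      using dim_subset[of "insert m (L \<inter> M)" "?L' \<inter> M"] by (simp add: dim_insert)
    moreover have "dim (?L' \<inter> M) \<le> dim M" by (rule dim_subset) auto
    ultimately have "dim M - dim (?L' \<inter> M) < dim M - dim (L \<inter> M)" by simp
    from less.hyps[OF this L'] odd1 odd2 show ?thesis
      unfolding dL' dW even_add by blast
  qed
qed

end

section \<open>The cross product on imaginary octonions\<close>

text \<open>
  The index type of the octonion coordinates is arithmetic modulo seven, that of the members of a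
  triple is arithmetic modulo three, so that cyclic symmetry is the substitution \<open>k + 1\<close>.
\<close>

lemma exhaust_7: "x = 0 \<or> x = 1 \<or> x = 2 \<or> x = 3 \<or> x = 4 \<or> x = 5 \<or> x = 6" for x :: 7
proof (induct x)
  case (of_int z)
  then have "z \<in> {0, 1, 2, 3, 4, 5, 6}" by auto
  then show ?case by auto
qed

lemma UNIV_7: "(UNIV :: 7 set) = {0, 1, 2, 3, 4, 5, 6}"
  using exhaust_7 by blast

lemma sum_7: "sum f (UNIV :: 7 set) = f 0 + f 1 + f 2 + f 3 + f 4 + f 5 + f 6"
  unfolding UNIV_7 by (simp add: add.assoc)

lemma forall_7: "(\<forall>i :: 7. P i) \<longleftrightarrow> P 0 \<and> P 1 \<and> P 2 \<and> P 3 \<and> P 4 \<and> P 5 \<and> P 6"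
  by (metis exhaust_7)

lemma arith_7:
  "(1 :: 7) + 1 = 2" "(1 :: 7) + 2 = 3" "(1 :: 7) + 3 = 4" "(1 :: 7) + 4 = 5" "(1 :: 7) + 5 = 6" "(1 :: 7) + 6 = 0"
  "(2 :: 7) + 1 = 3" "(2 :: 7) + 2 = 4" "(2 :: 7) + 3 = 5" "(2 :: 7) + 4 = 6" "(2 :: 7) + 5 = 0" "(2 :: 7) + 6 = 1"
  "(3 :: 7) + 1 = 4" "(3 :: 7) + 2 = 5" "(3 :: 7) + 3 = 6" "(3 :: 7) + 4 = 0" "(3 :: 7) + 5 = 1" "(3 :: 7) + 6 = 2"
  "(4 :: 7) + 1 = 5" "(4 :: 7) + 2 = 6" "(4 :: 7) + 3 = 0" "(4 :: 7) + 4 = 1" "(4 :: 7) + 5 = 2" "(4 :: 7) + 6 = 3"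
  "(5 :: 7) + 1 = 6" "(5 :: 7) + 2 = 0" "(5 :: 7) + 3 = 1" "(5 :: 7) + 4 = 2" "(5 :: 7) + 5 = 3" "(5 :: 7) + 6 = 4"
  "(6 :: 7) + 1 = 0" "(6 :: 7) + 2 = 1" "(6 :: 7) + 3 = 2" "(6 :: 7) + 4 = 3" "(6 :: 7) + 5 = 4" "(6 :: 7) + 6 = 5"
  by simp_all

lemma exhaust_3': "k = 0 \<or> k = 1 \<or> k = 2" for k :: 3
proof (induct k)
  case (of_int z)
  then have "z \<in> {0, 1, 2}" by auto
  then show ?case by auto
qed

lemma forall_3': "(\<forall>k :: 3. P k) \<longleftrightarrow> P 0 \<and> P 1 \<and> P 2"
  by (metis exhaust_3')

lemma UNIV_3': "(UNIV :: 3 set) = {0, 1, 2}"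
  using exhaust_3' by blast

lemma sum_3': "sum f (UNIV :: 3 set) = f 0 + f 1 + f 2"
  unfolding UNIV_3' by (simp add: add.assoc)

lemma numerals_3: "(3 :: 3) = 0" "(4 :: 3) = 1"
  by simp_all

type_synonym imo = "complex ^ 7"

lemma dot7_commute: "dot7 u v = dot7 v (u :: imo)"
  by (simp add: dot7_def mult.commute)

lemma dot7_add: "dot7 (u + v) w = dot7 u w + dot7 v (w :: imo)"
  "dot7 w (u + v) = dot7 w u + dot7 w (v :: imo)"
  by (simp_all add: dot7_def sum.distrib algebra_simps)

lemma dot7_scale: "dot7 (c *s u) w = c * dot7 u (w :: imo)"
  "dot7 w (c *s u) = c * dot7 w (u :: imo)"
  by (simp_all add: dot7_def sum_distrib_left algebra_simps)

lemma dot7_minus: "dot7 (- u) w = - dot7 u (w :: imo)" "dot7 w (- u) = - dot7 w (u :: imo)"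
  by (simp_all add: dot7_def sum_negf)

lemma dot7_diff: "dot7 (u - v) w = dot7 u w - dot7 v (w :: imo)"
  "dot7 w (u - v) = dot7 w u - dot7 w (v :: imo)"
  by (simp_all add: dot7_def sum_subtractf algebra_simps)

lemma dot7_zero: "dot7 0 w = (0 :: complex)" "dot7 w 0 = (0 :: complex)"
  by (simp_all add: dot7_def)

lemmas dot7_linear = dot7_add dot7_scale dot7_minus dot7_diff dot7_zero

lemma cross7_add: "cross7 (u + v) w = cross7 u w + cross7 v (w :: imo)"
  "cross7 w (u + v) = cross7 w u + cross7 w (v :: imo)"
  by (simp_all add: cross7_def vec_eq_iff algebra_simps)

lemma cross7_scale: "cross7 (c *s u) w = c *s cross7 u (w :: imo)"
  "cross7 w (c *s u) = c *s cross7 w (u :: imo)"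
  by (simp_all add: cross7_def vec_eq_iff algebra_simps)

lemma cross7_minus: "cross7 (- u) w = - cross7 u (w :: imo)" "cross7 w (- u) = - cross7 w (u :: imo)"
  by (simp_all add: cross7_def vec_eq_iff algebra_simps)

lemma cross7_diff: "cross7 (u - v) w = cross7 u w - cross7 v (w :: imo)"
  "cross7 w (u - v) = cross7 w u - cross7 w (v :: imo)"
  by (simp_all add: cross7_def vec_eq_iff algebra_simps)

lemma cross7_zero: "cross7 0 w = (0 :: imo)" "cross7 w 0 = (0 :: imo)"
  by (simp_all add: cross7_def vec_eq_iff)

lemmas cross7_linear = cross7_add cross7_scale cross7_minus cross7_diff cross7_zero

lemma cross7_self [simp]: "cross7 u u = (0 :: imo)"
  by (simp add: cross7_def vec_eq_iff algebra_simps)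

lemma cross7_skew: "cross7 u v = - cross7 v (u :: imo)"
  by (simp add: cross7_def vec_eq_iff algebra_simps)

lemma dot7_cross7_cyclic: "dot7 (cross7 u v) w = dot7 u (cross7 v (w :: imo))"
  unfolding dot7_def cross7_def sum_7 vec_lambda_beta
  by (simp only: add_0 arith_7) algebra

lemma cross7_cross7_same: "cross7 u (cross7 u v) = dot7 u v *s u - dot7 u u *s (v :: imo)"
  unfolding vec_eq_iff forall_7 vector_minus_component vector_smult_component dot7_def cross7_def sum_7 vec_lambda_beta
  by (simp only: add_0 arith_7) (intro conjI; algebra)

text \<open>The polarisation of the preceding identity; it carries all multiplication tables below.\<close>

lemma cross7_cross7_polar:
  "cross7 u (cross7 w v) = dot7 u v *s w + dot7 w v *s u - (2 * dot7 u w) *s v - cross7 w (cross7 u (v :: imo))"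
proof -
  have "cross7 (u + w) (cross7 (u + w) v) = dot7 (u + w) v *s (u + w) - dot7 (u + w) (u + w) *s v"
    by (rule cross7_cross7_same)
  then show ?thesis
    by (simp add: cross7_linear dot7_linear cross7_cross7_same dot7_commute[of w u] vec_eq_iff algebra_simps)
qed

lemma dot7_cross7_left [simp]: "dot7 u (cross7 u v) = 0" "dot7 v (cross7 u v) = (0 :: complex)"
  "dot7 (cross7 u v) u = 0" "dot7 (cross7 u v) v = (0 :: complex)"
proof -
  show 1: "dot7 u (cross7 u v) = 0" for u v :: imo
    using dot7_cross7_cyclic[of u u v] by (simp add: dot7_zero)
  show 2: "dot7 v (cross7 u v) = 0" 
    using 1[of v u] by (simp add: cross7_skew[of u] dot7_linear)
  show "dot7 (cross7 u v) u = 0" "dot7 (cross7 u v) v = 0"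
    using 1 2 by (simp_all add: dot7_commute)
qed

global_interpretation imo: nondegenerate_form "(*s) :: complex \<Rightarrow> imo \<Rightarrow> imo" cart_basis dot7
proof (unfold_locales, goal_cases)
  case (4 x)
  have "x $ i = 0" for i
    using 4[of "axis i 1"] by (simp add: dot7_def axis_def if_distrib cong: if_cong)
  then show ?case by (simp add: vec_eq_iff)
qed (auto simp: dot7_linear dot7_commute)

section \<open>Null triples and automorphisms\<close>

text \<open>
  Three vectors that span a totally isotropic space on which the triple product does not vanish.
  The value \<open>4\<close> is the one for the triple \<open>e\<^sub>1 - \<i> e\<^sub>3\<close>, \<open>e\<^sub>2 - \<i> e\<^sub>6\<close>, \<open>e\<^sub>4 - \<i> e\<^sub>5\<close> below, whose
  members pair with their complex conjugates to \<open>2\<close>.  Together with the dual triple and the axis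
  such a triple forms the basis of Zorn's vector matrices.
\<close>

definition null_triple :: "(3 \<Rightarrow> imo) \<Rightarrow> bool" where
  "null_triple e \<longleftrightarrow> (\<forall>i j. dot7 (e i) (e j) = 0) \<and> dot7 (cross7 (e 0) (e 1)) (e 2) = 4"

definition dual_triple :: "(3 \<Rightarrow> imo) \<Rightarrow> 3 \<Rightarrow> imo" where
  "dual_triple e k = (1/2) *s cross7 (e (k + 1)) (e (k + 2))"

definition triple_axis :: "(3 \<Rightarrow> imo) \<Rightarrow> imo" where
  "triple_axis e = (- \<i> / 2) *s cross7 (e 0) (dual_triple e 0)"

context
  fixes e f :: "3 \<Rightarrow> imo" and u :: imo
  assumes e: "null_triple e"
  defines "f \<equiv> dual_triple e" and "u \<equiv> triple_axis e"
begin

lemma triple_ee: "dot7 (e i) (e j) = 0"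
  using e by (simp add: null_triple_def)

text \<open>
  The following table of products and inner products depends on \<open>e\<close> only through
  \<open>null_triple e\<close>.  Everything in it comes from rewriting a product of the form \<open>x \<times> (y \<times> z)\<close> by
  the polarised identity, where orthogonality removes most terms.
\<close>

lemma triple_volume: "dot7 (e k) (cross7 (e (k + 1)) (e (k + 2))) = 4"
proof -
  have "dot7 (e 0) (cross7 (e 1) (e 2)) = 4"
    using e by (simp add: null_triple_def dot7_cross7_cyclic)
  moreover have "dot7 (e 1) (cross7 (e 2) (e 0)) = 4"
    using calculation dot7_cross7_cyclic[of "e 1" "e 2" "e 0"] by (simp add: dot7_commute)
  moreover have "dot7 (e 2) (cross7 (e 0) (e 1)) = 4"
    using calculation dot7_cross7_cyclic[of "e 2" "e 0" "e 1"] by (simp add: dot7_commute)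
  ultimately show ?thesis
    using exhaust_3'[of k] by (auto simp: numerals_3)
qed

lemma triple_cross_ee: "cross7 (e k) (e (k + 1)) = 2 *s f (k + 2)"
  by (simp add: f_def dual_triple_def add.assoc numerals_3)

lemma triple_cross_ef_off: 
  shows "cross7 (e k) (f (k + 1)) = 0" "cross7 (e k) (f (k + 2)) = 0"
  by (auto simp: f_def dual_triple_def add.assoc numerals_3 cross7_linear cross7_skew[of "e (k + 2)" "e k"]
      cross7_cross7_same triple_ee)

lemma triple_ef: "dot7 (e i) (f j) = (if i = j then 2 else 0)"
proof -
  have "j = i \<or> j = i + 1 \<or> j = i + 2"
    using exhaust_3'[of i] exhaust_3'[of j] by auto
  then show ?thesis
    by (auto simp: f_def dual_triple_def dot7_linear triple_volume add.assoc numerals_3)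
qed

lemma triple_cross_ef: "cross7 (e k) (f k) = (2 * \<i>) *s u"
proof -
  have step: "cross7 (e (k + 1)) (f (k + 1)) = cross7 (e k) (f k)" for k
    using cross7_cross7_polar[of "e k" "e (k + 1)" "e (k + 2)"]
    by (simp add: f_def dual_triple_def cross7_linear triple_ee add.assoc numerals_3
        cross7_skew[of "e (k + 2)" "e k"])
  have "cross7 (e k) (f k) = cross7 (e 0) (f 0)"
    using step[of 0] step[of 1] exhaust_3'[of k] by (auto simp: numerals_3)
  then show ?thesis
    by (simp add: u_def triple_axis_def f_def vec_eq_iff)
qed

lemma triple_ff: "dot7 (f i) (f j) = 0"
proof -
  have j: "j = i \<or> j = i + 1 \<or> j = i + 2"
    using exhaust_3'[of i] exhaust_3'[of j] by auto
  have "dot7 (f i) w = (1/2) * dot7 (e (i + 1)) (cross7 (e (i + 2)) w)"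
       "dot7 (f i) w = - (1/2) * dot7 (e (i + 2)) (cross7 (e (i + 1)) w)" for w
    using dot7_cross7_cyclic[of "e (i + 1)" "e (i + 2)" w]
      dot7_cross7_cyclic[of "e (i + 2)" "e (i + 1)" w]
    by (simp_all add: f_def dual_triple_def dot7_linear cross7_skew[of "e (i + 1)" "e (i + 2)"])
  note * = this
  have off: "cross7 (e (i + 2)) (f i) = 0" "cross7 (e (i + 2)) (f (i + 1)) = 0" "cross7 (e (i + 1)) (f (i + 2)) = 0"
    using triple_cross_ef_off[of "i + 2"] triple_cross_ef_off[of "i + 1"] by (simp_all add: add.assoc numerals_3)
  from j show ?thesis
    using *(1)[of "f j"] *(2)[of "f j"] off by (auto simp: dot7_zero)
qed

lemma triple_cross_ff: "cross7 (f k) (f (k + 1)) = 2 *s e (k + 2)"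
proof -
  have "cross7 (f (k + 1)) (cross7 (e (k + 1)) (e (k + 2))) = - 4 *s e (k + 2)"
    using cross7_cross7_polar[of "f (k + 1)" "e (k + 1)" "e (k + 2)"] triple_cross_ef_off(2)[of "k + 2"]
      triple_ef[of "k + 1" "k + 1"] triple_ef[of "k + 2" "k + 1"] triple_ee
    by (simp add: dot7_commute[of "f _"] cross7_skew[of "f _" "e (k + 2)"] add.assoc numerals_3 cross7_zero)
  then have "cross7 (f (k + 1)) (f k) = - 2 *s e (k + 2)"
    by (simp add: f_def dual_triple_def[of e k] cross7_linear vec_eq_iff)
  then show ?thesis
    by (simp add: cross7_skew[of "f k"])
qed

lemma triple_axis_via: "u = (- \<i> / 2) *s cross7 (e k) (f k)"
  by (simp add: triple_cross_ef vec_eq_iff)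

lemma triple_cross_ue: "cross7 u (e k) = \<i> *s e k"
proof -
  have "cross7 (e k) (cross7 (e (k + 1)) (f (k + 1))) = 2 *s e k"
    using cross7_cross7_polar[of "e k" "e (k + 1)" "f (k + 1)"] triple_cross_ef_off(1)[of k]
      triple_ef[of k "k + 1"] triple_ef[of "k + 1" "k + 1"] triple_ee
    by (simp add: cross7_zero)
  then show ?thesis
    by (simp add: triple_axis_via[of "k + 1"] cross7_linear cross7_skew[of _ "e k"] vec_eq_iff)
qed

lemma triple_cross_uf: "cross7 u (f k) = - \<i> *s f k"
proof -
  have "cross7 (f k) (cross7 (e (k + 1)) (f (k + 1))) = - 2 *s f k"
    using cross7_cross7_polar[of "f k" "e (k + 1)" "f (k + 1)"] triple_cross_ff[of k]
      triple_cross_ee[of "k + 1"] triple_ef[of "k + 1" k] triple_ef[of "k + 1" "k + 1"] triple_ff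
    by (simp add: dot7_commute[of "f _" "e _"] cross7_linear add.assoc numerals_3 vec_eq_iff)
  then show ?thesis
    by (simp add: triple_axis_via[of "k + 1"] cross7_linear cross7_skew[of _ "f k"] vec_eq_iff)
qed

lemma triple_eu: "dot7 (e k) u = 0" and triple_fu: "dot7 (f k) u = 0"
  by (simp_all add: triple_axis_via[of k] dot7_linear)

lemma triple_uu: "dot7 u u = 1"
proof -
  have "cross7 u (e 0) = \<i> *s e 0" by (rule triple_cross_ue)
  then have "cross7 u (cross7 u (e 0)) = \<i> *s (\<i> *s e 0)"
    by (simp add: cross7_linear)
  also have "\<dots> = - e 0"
    by (simp add: vec_eq_iff)
  finally have "dot7 u u *s e 0 = e 0"
    using cross7_cross7_same[of u "e 0"] triple_eu[of 0] by (simp add: dot7_commute[of u "e 0"])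
  then have "dot7 u u * dot7 (e 0) (f 0) = dot7 (e 0) (f 0)"
    by (metis dot7_scale(1))
  then show ?thesis by (simp add: triple_ef)
qed

end

definition zorn_comb :: "(3 \<Rightarrow> imo) \<Rightarrow> (3 \<Rightarrow> complex) \<Rightarrow> (3 \<Rightarrow> complex) \<Rightarrow> complex \<Rightarrow> imo" where
  "zorn_comb e a b c = (\<Sum>k\<in>UNIV. a k *s e k) + (\<Sum>k\<in>UNIV. b k *s dual_triple e k) + c *s triple_axis e"

lemma dot7_sum: "dot7 (sum f I) w = (\<Sum>i\<in>I. dot7 (f i) (w :: imo))" "dot7 w (sum f I) = (\<Sum>i\<in>I. dot7 w (f i :: imo))"
  by (induction I rule: infinite_finite_induct) (auto simp: dot7_linear)

context
  fixes e :: "3 \<Rightarrow> imo"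
  assumes e: "null_triple e"
begin

lemma dot7_zorn_comb_basis:
  "dot7 (zorn_comb e a b c) (e k) = 2 * b k"
  "dot7 (zorn_comb e a b c) (dual_triple e k) = 2 * a k"
  "dot7 (zorn_comb e a b c) (triple_axis e) = c"
  by (simp_all add: zorn_comb_def dot7_linear dot7_sum triple_ee[OF e] triple_ff[OF e] triple_uu[OF e]
      triple_ef[OF e] triple_eu[OF e] triple_fu[OF e] dot7_commute[of "dual_triple e _" "e _"]
      dot7_commute[of "triple_axis e" "e _"] dot7_commute[of "triple_axis e" "dual_triple e _"]
      if_distrib cong: if_cong)

lemma dot7_zorn_comb:
  "dot7 (zorn_comb e a b c) (zorn_comb e a' b' c') = 2 * (\<Sum>k\<in>UNIV. a k * b' k + b k * a' k) + c * c'"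
proof -
  have "dot7 (zorn_comb e a b c) (zorn_comb e a' b' c') =
    (\<Sum>k\<in>UNIV. a' k * (2 * b k)) + (\<Sum>k\<in>UNIV. b' k * (2 * a k)) + c' * c"
    by (subst (2) zorn_comb_def) (simp add: dot7_linear dot7_sum dot7_zorn_comb_basis)
  then show ?thesis
    by (simp add: sum.distrib sum_distrib_left algebra_simps)
qed

lemma zorn_comb_eq_iff: "zorn_comb e a b c = zorn_comb e a' b' c' \<longleftrightarrow> a = a' \<and> b = b' \<and> c = c'"
proof
  assume eq: "zorn_comb e a b c = zorn_comb e a' b' c'"
  have "a k = a' k" "b k = b' k" "c = c'" for k
    using dot7_zorn_comb_basis(1,2)[of a b c k] dot7_zorn_comb_basis(1,2)[of a' b' c' k]
      dot7_zorn_comb_basis(3)[of a b c] dot7_zorn_comb_basis(3)[of a' b' c'] unfolding eq by simp_all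
  then show "a = a' \<and> b = b' \<and> c = c'" by blast
qed simp

lemma zorn_basis_as_comb:
  "e k = zorn_comb e (\<lambda>j. if j = k then 1 else 0) (\<lambda>_. 0) 0"
  "dual_triple e k = zorn_comb e (\<lambda>_. 0) (\<lambda>j. if j = k then 1 else 0) 0"
  "triple_axis e = zorn_comb e (\<lambda>_. 0) (\<lambda>_. 0) 1"
  by (simp_all add: zorn_comb_def if_distrib[of "\<lambda>c. c *s _"] cong: if_cong)

lemma cross7_zorn_comb:
  "cross7 (zorn_comb e a b c) (zorn_comb e a' b' c') =
   zorn_comb e
     (\<lambda>k. 2 * (b (k + 1) * b' (k + 2) - b (k + 2) * b' (k + 1)) + \<i> * (c * a' k - a k * c'))
     (\<lambda>k. 2 * (a (k + 1) * a' (k + 2) - a (k + 2) * a' (k + 1)) - \<i> * (c * b' k - b k * c'))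
     (2 * \<i> * (\<Sum>k\<in>UNIV. a k * b' k - b k * a' k))"
proof -
  let ?f = "dual_triple e" and ?u = "triple_axis e"
  have sk: "cross7 (e 1) (e 0) = - cross7 (e 0) (e 1)" "cross7 (e 2) (e 1) = - cross7 (e 1) (e 2)"
    "cross7 (e 0) (e 2) = - cross7 (e 2) (e 0)"
    "cross7 (?f 1) (?f 0) = - cross7 (?f 0) (?f 1)" "cross7 (?f 2) (?f 1) = - cross7 (?f 1) (?f 2)"
    "cross7 (?f 0) (?f 2) = - cross7 (?f 2) (?f 0)"
    "\<And>i j. cross7 (?f i) (e j) = - cross7 (e j) (?f i)"
    "\<And>i. cross7 (e i) ?u = - cross7 ?u (e i)"
    "\<And>i. cross7 (?f i) ?u = - cross7 ?u (?f i)"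
    by (rule cross7_skew)+
  have ee: "cross7 (e 0) (e 1) = 2 *s ?f 2" "cross7 (e 1) (e 2) = 2 *s ?f 0" "cross7 (e 2) (e 0) = 2 *s ?f 1"
    using triple_cross_ee[OF e, of 0] triple_cross_ee[OF e, of 1] triple_cross_ee[OF e, of 2]
    by (simp_all add: numerals_3)
  have ff: "cross7 (?f 0) (?f 1) = 2 *s e 2" "cross7 (?f 1) (?f 2) = 2 *s e 0" "cross7 (?f 2) (?f 0) = 2 *s e 1"
    using triple_cross_ff[OF e, of 0] triple_cross_ff[OF e, of 1] triple_cross_ff[OF e, of 2]
    by (simp_all add: numerals_3)
  have ef: "cross7 (e 0) (?f 1) = 0" "cross7 (e 0) (?f 2) = 0" "cross7 (e 1) (?f 2) = 0"
    "cross7 (e 1) (?f 0) = 0" "cross7 (e 2) (?f 0) = 0" "cross7 (e 2) (?f 1) = 0"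
    using triple_cross_ef_off[OF e, of 0] triple_cross_ef_off[OF e, of 1] triple_cross_ef_off[OF e, of 2]
    by (simp_all add: numerals_3)
  show ?thesis
    unfolding zorn_comb_def sum_3'
    by (simp add: cross7_linear sk ee ff ef triple_cross_ef[OF e] triple_cross_ue[OF e] triple_cross_uf[OF e]
        numerals_3)
      (simp add: vec_eq_iff algebra_simps)
qed

end

text \<open>
  Eigenvectors of multiplication by the unit \<open>e\<^sub>0\<close>, which is the axis of this triple.
\<close>

definition zE :: "3 \<Rightarrow> imo" where
  "zE k = (if k = 0 then axis 1 1 - \<i> *s axis 3 1 else if k = 1 then axis 2 1 - \<i> *s axis 6 1
           else axis 4 1 - \<i> *s axis 5 1)"

lemma null_triple_zE: "null_triple zE"
  unfolding null_triple_def forall_3'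
  by (simp add: zE_def dot7_def cross7_def sum_7 axis_def) (simp add: complex_eq_iff)

lemma zE_nth: "zE 0 = (\<chi> i. if i = 1 then 1 else if i = 3 then - \<i> else 0)"
  "zE 1 = (\<chi> i. if i = 2 then 1 else if i = 6 then - \<i> else 0)"
  "zE 2 = (\<chi> i. if i = 4 then 1 else if i = 5 then - \<i> else 0)"
  by (simp_all add: zE_def vec_eq_iff axis_def)

lemma dual_zE:
  "dual_triple zE 0 = (\<chi> i. if i = 1 then 1 else if i = 3 then \<i> else 0)"
  "dual_triple zE 1 = (\<chi> i. if i = 2 then 1 else if i = 6 then \<i> else 0)"
  "dual_triple zE 2 = (\<chi> i. if i = 4 then 1 else if i = 5 then \<i> else 0)"
  unfolding vec_eq_iff forall_7
  by (simp_all add: dual_triple_def zE_nth numerals_3 cross7_def)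

lemma axis_zE: "triple_axis zE = (\<chi> i. if i = 0 then 1 else 0)"
  unfolding vec_eq_iff forall_7
  by (simp add: triple_axis_def dual_zE zE_nth cross7_def)

definition zA :: "imo \<Rightarrow> 3 \<Rightarrow> complex" where "zA x k = dot7 x (dual_triple zE k) / 2"
definition zB :: "imo \<Rightarrow> 3 \<Rightarrow> complex" where "zB x k = dot7 x (zE k) / 2"
definition zC :: "imo \<Rightarrow> complex" where "zC x = dot7 x (triple_axis zE)"

lemma zorn_expansion: "zorn_comb zE (zA x) (zB x) (zC x) = x"
  unfolding vec_eq_iff forall_7
  by (simp add: zorn_comb_def zA_def zB_def zC_def sum_3' dot7_def sum_7 dual_zE axis_zE zE_nth field_simps)

lemma zorn_coords [simp]: "zA (zorn_comb zE a b c) = a" "zB (zorn_comb zE a b c) = b" "zC (zorn_comb zE a b c) = c"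
  by (simp_all add: zA_def zB_def zC_def fun_eq_iff dot7_zorn_comb_basis null_triple_zE)

lemma zorn_cases: obtains a b c where "x = zorn_comb zE a b c"
  using zorn_expansion by metis

lemma linear_zorn_coords:
  "zA (x + y) = (\<lambda>k. zA x k + zA y k)" "zB (x + y) = (\<lambda>k. zB x k + zB y k)" "zC (x + y) = zC x + zC y"
  "zA (t *s x) = (\<lambda>k. t * zA x k)" "zB (t *s x) = (\<lambda>k. t * zB x k)" "zC (t *s x) = t * zC x"
  by (simp_all add: zA_def zB_def zC_def dot7_linear fun_eq_iff add_divide_distrib)

lemma zorn_comb_linear:
  "zorn_comb e (\<lambda>k. a k + a' k) (\<lambda>k. b k + b' k) (c + c') = zorn_comb e a b c + zorn_comb e a' b' c'"
  "zorn_comb e (\<lambda>k. t * a k) (\<lambda>k. t * b k) (t * c) = t *s zorn_comb e a b c"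
  by (simp_all add: zorn_comb_def sum_3' vec_eq_iff algebra_simps)

text \<open>
  The action of \<open>G2\<close> on the imaginary octonions; \<open>G2_restricts\<close> and \<open>Aut7_extends\<close> pass between
  the two groups.
\<close>

definition Aut7 :: "(imo \<Rightarrow> imo) set" where
  "Aut7 = {h. Vector_Spaces.linear (*s) (*s) h \<and> bij h \<and>
    (\<forall>x y. h (cross7 x y) = cross7 (h x) (h y)) \<and> (\<forall>x y. dot7 (h x) (h y) = dot7 x y)}"

lemma Aut7_linear: "h \<in> Aut7 \<Longrightarrow> Vector_Spaces.linear (*s) (*s) h"
  and Aut7_bij: "h \<in> Aut7 \<Longrightarrow> bij h"
  and Aut7_cross: "h \<in> Aut7 \<Longrightarrow> h (cross7 x y) = cross7 (h x) (h y)"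
  and Aut7_dot: "h \<in> Aut7 \<Longrightarrow> dot7 (h x) (h y) = dot7 x y"
  by (simp_all add: Aut7_def)

lemma Aut7_add: "h \<in> Aut7 \<Longrightarrow> h (x + y) = h x + h y"
  and Aut7_scale: "h \<in> Aut7 \<Longrightarrow> h (c *s x) = c *s h x"
  and Aut7_zero: "h \<in> Aut7 \<Longrightarrow> h 0 = 0"
  and Aut7_sum: "h \<in> Aut7 \<Longrightarrow> h (sum g I) = (\<Sum>i\<in>I. h (g i))"
  using vec.linear_add vec.linear_scale vec.linear_0 vec.linear_sum Aut7_linear by metis+

lemma Aut7_id: "id \<in> Aut7"
  by (simp add: Aut7_def vec.linear_id)

lemma Aut7_comp:
  assumes "h \<in> Aut7" "k \<in> Aut7"
  shows "h \<circ> k \<in> Aut7"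
proof -
  have "Vector_Spaces.linear (*s) (*s) (h \<circ> k)"
    by unfold_locales (simp_all add: Aut7_add[OF assms(1)] Aut7_add[OF assms(2)]
        Aut7_scale[OF assms(1)] Aut7_scale[OF assms(2)])
  moreover have "bij (h \<circ> k)"
    using assms by (intro bij_comp Aut7_bij)
  ultimately show ?thesis
    using assms by (simp add: Aut7_def)
qed

lemma Aut7_inv_apply: "h \<in> Aut7 \<Longrightarrow> h (inv h x) = x" "h \<in> Aut7 \<Longrightarrow> inv h (h x) = x"
  using Aut7_bij[of h] by (auto simp: bij_is_surj surj_f_inv_f bij_is_inj)

lemma Aut7_eq_iff: "h \<in> Aut7 \<Longrightarrow> h x = h y \<longleftrightarrow> x = y"
  using Aut7_bij bij_is_inj inj_eq by metis

lemma Aut7_inv: 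
  assumes h: "h \<in> Aut7" shows "inv h \<in> Aut7"
proof -
  note i = Aut7_inv_apply[OF h]
  have eqI: "inv h x = y" if "x = h y" for x y using that i by simp
  have "Vector_Spaces.linear (*s) (*s) (inv h)"
    by unfold_locales (auto intro!: eqI simp: i Aut7_add[OF h] Aut7_scale[OF h])
  moreover have "bij (inv h)" using h Aut7_bij bij_imp_bij_inv by blast
  moreover have "inv h (cross7 x y) = cross7 (inv h x) (inv h y)" for x y
    by (rule eqI) (simp add: i Aut7_cross[OF h])
  moreover have "dot7 (inv h x) (inv h y) = dot7 x y" for x y
    using Aut7_dot[OF h, of "inv h x" "inv h y"] by (simp add: i)
  ultimately show ?thesis by (simp add: Aut7_def)
qed

definition zorn_map :: "(3 \<Rightarrow> imo) \<Rightarrow> imo \<Rightarrow> imo" where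
  "zorn_map e x = zorn_comb e (zA x) (zB x) (zC x)"

lemma zorn_map_comb [simp]: "zorn_map e (zorn_comb zE a b c) = zorn_comb e a b c"
  by (simp add: zorn_map_def)

text \<open>
  Products and inner products of combinations of a Zorn basis are given by formulas that do not
  mention the basis, so carrying the standard basis over to another one respects both.
\<close>

theorem zorn_map_automorphism:
  assumes e: "null_triple e"
  shows "zorn_map e \<in> Aut7"
proof -
  let ?h = "zorn_map e"
  have lin: "Vector_Spaces.linear (*s) (*s) ?h"
    by unfold_locales (simp_all add: zorn_map_def linear_zorn_coords zorn_comb_linear)
  have dot: "dot7 (?h x) (?h y) = dot7 x y" for x y
    by (cases x rule: zorn_cases; cases y rule: zorn_cases) (simp add: dot7_zorn_comb e null_triple_zE)
  have cross: "?h (cross7 x y) = cross7 (?h x) (?h y)" for x y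
    by (cases x rule: zorn_cases; cases y rule: zorn_cases) (simp add: cross7_zorn_comb e null_triple_zE)
  have "inj ?h"
  proof (rule injI)
    fix x y assume "?h x = ?h y"
    then show "x = y"
      by (cases x rule: zorn_cases; cases y rule: zorn_cases) (simp add: zorn_comb_eq_iff[OF e])
  qed
  then have "bij ?h"
    using vec.linear_injective_imp_surjective[OF lin] by (simp add: bij_def)
  with lin dot cross show ?thesis by (simp add: Aut7_def)
qed

lemma zorn_map_zE: "zorn_map e (zE k) = e k"
proof -
  have "zorn_map e (zE k) = zorn_comb e (\<lambda>j. if j = k then 1 else 0) (\<lambda>_. 0) 0"
    by (subst zorn_basis_as_comb(1)[OF null_triple_zE]) (rule zorn_map_comb)
  also have "\<dots> = e k"
    by (simp add: zorn_comb_def if_distrib[of "\<lambda>c. c *s _"] cong: if_cong)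
  finally show ?thesis .
qed

lemma Aut7_from_null_triple:
  assumes "null_triple e"
  obtains h where "h \<in> Aut7" "\<And>k. h (zE k) = e k" "\<And>a b c. h (zorn_comb zE a b c) = zorn_comb e a b c"
  using that[OF zorn_map_automorphism[OF assms]] by (simp add: zorn_map_zE)

lemma Aut7_from_null_vectors:
  fixes x y z :: imo
  assumes "dot7 x x = 0" "dot7 y y = 0" "dot7 z z = 0" "dot7 x y = 0" "dot7 x z = 0" "dot7 y z = 0"
    and "dot7 (cross7 x y) z = 4"
  obtains h where "h \<in> Aut7" "h (zE 0) = x" "h (zE 1) = y" "h (zE 2) = z"
proof -
  define e :: "3 \<Rightarrow> imo" where "e k = (if k = 0 then x else if k = 1 then y else z)" for k
  have "null_triple e"
    unfolding null_triple_def forall_3'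
    using assms by (simp add: e_def dot7_commute[of y x] dot7_commute[of z x] dot7_commute[of z y])
  then obtain h where "h \<in> Aut7" "\<And>k. h (zE k) = e k"
    using Aut7_from_null_triple by metis
  then show thesis
    using that[of h] by (simp add: e_def)
qed

text \<open>
  The third vector is found by moving any vector that pairs with \<open>x \<times> y\<close> but not with \<open>x\<close>, \<open>y\<close> along
  the null direction \<open>x \<times> y\<close> until it becomes null.
\<close>

lemma null_triple_completion:
  fixes x y :: imo
  assumes x: "dot7 x x = 0" and y: "dot7 y y = 0" and xy: "dot7 x y = 0" and n: "cross7 x y \<noteq> 0"
  obtains z where "dot7 z z = 0" "dot7 x z = 0" "dot7 y z = 0" "dot7 (cross7 x y) z = 4"
proof -
  let ?w = "cross7 x y"
  have xw: "cross7 x ?w = 0" "cross7 y ?w = 0"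
    using x y xy cross7_cross7_same[of x y] cross7_cross7_same[of y x]
    by (simp_all add: cross7_skew[of x y] cross7_linear dot7_commute[of y x])
  have ww: "dot7 ?w ?w = 0"
    using dot7_cross7_cyclic[of x y ?w] xw by (simp add: dot7_linear)
  have "?w \<notin> vec.span {x, y}"
  proof
    assume "?w \<in> vec.span {x, y}"
    then obtain a b where ab: "?w = a *s x + b *s y"
      by (auto simp: vec.span_insert vec.span_singleton algebra_simps)
    have "b *s ?w = cross7 x (a *s x + b *s y)" "a *s ?w = - cross7 y (a *s x + b *s y)"
      by (simp_all add: cross7_linear cross7_skew[of x y])
    then have "b *s ?w = 0" "a *s ?w = 0"
      using xw ab by simp_all
    then have "a = 0" "b = 0" using n by (simp_all add: vector_mul_eq_0)
    then show False using ab n by simp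
  qed
  then obtain m where m: "dot7 m x = 0" "dot7 m y = 0" "dot7 m ?w \<noteq> 0"
    using imo.separating_vector[of ?w "{x, y}"] by (metis insertCI)
  define m' where "m' = (4 / dot7 m ?w) *s m"
  have m': "dot7 m' x = 0" "dot7 m' y = 0" "dot7 m' ?w = 4"
    using m by (simp_all add: m'_def dot7_linear)
  define z where "z = m' - (dot7 m' m' / 8) *s ?w"
  have "dot7 z z = 0"
    using m' ww by (simp add: z_def dot7_linear dot7_commute[of ?w m'])
  moreover have "dot7 x z = 0" "dot7 y z = 0" "dot7 ?w z = 4"
    using m' ww by (simp_all add: z_def dot7_linear dot7_commute[of x m'] dot7_commute[of y m'] dot7_commute[of ?w m'])
  ultimately show thesis by (rule that)
qed

text \<open>
  It suffices to find a null vector orthogonal to \<open>x\<close> whose product with \<open>x\<close> is nonzero, since the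
  two then extend to a null triple.  Take a null \<open>y\<close> that is not orthogonal to \<open>x\<close> and a \<open>v\<close>
  orthogonal to \<open>x\<close>, \<open>y\<close> and \<open>x \<times> y\<close>.  Then \<open>y \<times> v\<close> is null and orthogonal to \<open>x\<close>, and its product
  with \<open>x\<close> is a nonzero multiple of \<open>v\<close> as soon as \<open>x \<times> v = 0\<close>; replacing \<open>v\<close> by \<open>x \<times> v\<close> if
  necessary ensures the latter.
\<close>

lemma Aut7_transitive_on_null_vectors:
  fixes x :: imo
  assumes x: "dot7 x x = 0" and nz: "x \<noteq> 0"
  obtains h where "h \<in> Aut7" "h (zE 0) = x"
proof -
  obtain y0 where y0: "dot7 x y0 \<noteq> 0"
    using nz imo.form_nondegenerate by blast
  define y where "y = y0 - (dot7 y0 y0 / (2 * dot7 x y0)) *s x"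
  have yy: "dot7 y y = 0" 
    using x y0 by (simp add: y_def dot7_linear dot7_commute[of y0 x])
  have xy: "dot7 x y \<noteq> 0"
    using x y0 by (simp add: y_def dot7_linear)
  let ?c = "cross7 x y"
  have "\<exists>v. v \<noteq> 0 \<and> dot7 v x = 0 \<and> dot7 v y = 0 \<and> dot7 v ?c = 0"
  proof -
    have "vec.dim (UNIV :: imo set) \<le> vec.dim (UNIV \<inter> imo.perp {x, y, ?c}) + card {x, y, ?c}"
      by (rule imo.dim_section_ge) auto
    moreover have "card {x, y, ?c} \<le> 3"
      by (simp add: card_insert_if)
    moreover have "vec.dim (UNIV :: imo set) = 7"
      by (simp add: card_cart_basis)
    ultimately have "vec.dim (imo.perp {x, y, ?c}) \<noteq> 0"
      by (simp del: vec.dim_eq_0 vec.dim_UNIV)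
    then have "\<not> imo.perp {x, y, ?c} \<subseteq> {0}"
      by simp
    then show ?thesis by (auto simp: imo.perp_def)
  qed
  then obtain v0 where v0: "v0 \<noteq> 0" "dot7 v0 x = 0" "dot7 v0 y = 0" "dot7 v0 ?c = 0" by blast
  have "\<exists>v. v \<noteq> 0 \<and> dot7 v x = 0 \<and> dot7 v y = 0 \<and> dot7 v ?c = 0 \<and> cross7 x v = 0"
  proof (cases "cross7 x v0 = 0")
    case False
    have "cross7 x (cross7 x v0) = 0"
      using x v0 by (simp add: cross7_cross7_same dot7_commute[of x v0])
    moreover have "dot7 (cross7 x v0) y = 0"
      using v0 dot7_cross7_cyclic[of v0 x y] by (simp add: cross7_skew[of x v0] dot7_linear)
    moreover have "dot7 (cross7 x v0) ?c = 0"
      using dot7_cross7_cyclic[of "cross7 x v0" x y] calculation(1)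
      by (simp add: cross7_skew[of _ x] dot7_linear)
    ultimately show ?thesis using False by (intro exI[of _ "cross7 x v0"]) simp
  qed (use v0 in blast)
  then obtain v where v: "v \<noteq> 0" "dot7 v x = 0" "dot7 v y = 0" "dot7 v ?c = 0" "cross7 x v = 0"
    by blast
  let ?w = "cross7 y v"
  have "dot7 ?w ?w = 0"
    using dot7_cross7_cyclic[of v y ?w] cross7_cross7_same[of y v] yy v
    by (simp add: dot7_linear cross7_skew[of v y] dot7_commute[of y v])
  moreover have "dot7 x ?w = 0"
    using v dot7_cross7_cyclic[of x y v] by (simp add: dot7_commute[of ?c])
  moreover have "cross7 x ?w = - (2 * dot7 x y) *s v"
    using cross7_cross7_polar[of x y v] v
    by (simp add: dot7_commute[of x v] dot7_commute[of y v] cross7_zero)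
  then have "cross7 x ?w \<noteq> 0"
    using v xy by simp
  ultimately obtain z where "dot7 z z = 0" "dot7 x z = 0" "dot7 ?w z = 0" "dot7 (cross7 x ?w) z = 4"
    using null_triple_completion[OF x, of ?w] by blast
  with Aut7_from_null_vectors[of x ?w z] x that \<open>dot7 ?w ?w = 0\<close> \<open>dot7 x ?w = 0\<close> show thesis
    by metis
qed

section \<open>Null ideals\<close>

text \<open>
  For a Lagrangian relation that is closed under products, the set of all \<open>x\<close> related to zero is of
  this kind: its orthogonal is the domain of the relation, and the product of a related pair with
  \<open>(x, 0)\<close> is again of the form \<open>(x', 0)\<close>.
\<close>

definition null_ideal :: "imo set \<Rightarrow> bool" where
  "null_ideal K \<longleftrightarrow> vec.subspace K \<and> (\<forall>x\<in>K. \<forall>y\<in>K. dot7 x y = 0) \<and>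
    (\<forall>a\<in>imo.perp K. \<forall>x\<in>K. cross7 a x \<in> K)"

definition null_plane :: "imo set" where
  "null_plane = {zorn_comb zE a b 0 | a b. a 1 = 0 \<and> a 2 = 0 \<and> b 0 = 0 \<and> b 2 = 0}"

definition null_threespace :: "imo set" where
  "null_threespace = {zorn_comb zE a b 0 | a b. a 2 = 0 \<and> b 0 = 0 \<and> b 1 = 0}"

lemma null_ideal_vimage:
  assumes K: "null_ideal K" and h: "h \<in> Aut7"
  shows "null_ideal (h -` K)"
  unfolding null_ideal_def
proof (intro conjI ballI)
  have sub: "vec.subspace K" using K by (simp add: null_ideal_def)
  then show "vec.subspace (h -` K)"
    by (simp add: vec.subspace_def Aut7_add[OF h] Aut7_scale[OF h] Aut7_zero[OF h])
  show "dot7 x y = 0" if "x \<in> h -` K" "y \<in> h -` K" for x y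
    using K that Aut7_dot[OF h, of x y] by (auto simp: null_ideal_def)
  show "cross7 a x \<in> h -` K" if a: "a \<in> imo.perp (h -` K)" and x: "x \<in> h -` K" for a x
  proof -
    have "h a \<in> imo.perp K"
      unfolding imo.perp_def
    proof safe
      fix y assume "y \<in> K"
      then have "inv h y \<in> h -` K" by (simp add: Aut7_inv_apply[OF h])
      then show "dot7 (h a) y = 0"
        using a Aut7_dot[OF h, of a "inv h y"] by (simp add: imo.perp_def Aut7_inv_apply[OF h])
    qed
    then show ?thesis
      using K x by (simp add: null_ideal_def Aut7_cross[OF h])
  qed
qed


lemmas zorn_tables = dot7_zorn_comb_basis[OF null_triple_zE] dot7_zorn_comb[OF null_triple_zE]
  zorn_comb_eq_iff[OF null_triple_zE] cross7_zorn_comb[OF null_triple_zE]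

lemma zorn_comb_0: "zorn_comb zE (\<lambda>_. 0) (\<lambda>_. 0) 0 = 0"
  by (simp add: zorn_comb_def)

lemma zorn_comb_eq_0_iff: "zorn_comb zE a b c = 0 \<longleftrightarrow> (\<forall>k. a k = 0) \<and> (\<forall>k. b k = 0) \<and> c = 0"
  using zorn_tables(5)[of a b c "\<lambda>_. 0" "\<lambda>_. 0" 0] by (simp add: zorn_comb_0 fun_eq_iff)

lemma cross7_zE0_comb_eq_0_iff:
  "cross7 (zE 0) (zorn_comb zE a b c) = 0 \<longleftrightarrow> a 1 = 0 \<and> a 2 = 0 \<and> b 0 = 0 \<and> c = 0"
  by (subst zorn_basis_as_comb(1)[OF null_triple_zE])
    (auto simp: zorn_tables zorn_comb_eq_0_iff forall_3' sum_3' numerals_3)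

lemma cross7_dual1_comb_eq_0_iff:
  "cross7 (dual_triple zE 1) (zorn_comb zE a b c) = 0 \<longleftrightarrow> b 0 = 0 \<and> b 2 = 0 \<and> a 1 = 0 \<and> c = 0"
  by (subst zorn_basis_as_comb(2)[OF null_triple_zE])
    (auto simp: zorn_tables zorn_comb_eq_0_iff forall_3' sum_3' numerals_3)

lemma null_ideal_cross:
  assumes K: "null_ideal K" and "x \<in> K" "y \<in> K" shows "cross7 x y \<in> K"
proof -
  have "x \<in> imo.perp K" using assms by (simp add: imo.perp_def null_ideal_def)
  then show ?thesis using assms by (simp add: null_ideal_def)
qed

lemma image_vimage_Aut7: "h \<in> Aut7 \<Longrightarrow> h ` (h -` K) = K"
  using Aut7_bij[of h] by (simp add: bij_is_surj surj_image_vimage_eq)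

text \<open>
  The product of the two given vectors is a third member; a vector orthogonal to all three lies in
  their span up to a multiple of the axis, which is not null.
\<close>

lemma null_ideal_eq_null_threespace:
  assumes K: "null_ideal K" and x: "zE 0 \<in> K" and y: "zE 1 \<in> K"
  shows "K = null_threespace"
proof -
  have sub: "vec.subspace K" and iso: "\<And>x y. x \<in> K \<Longrightarrow> y \<in> K \<Longrightarrow> dot7 x y = 0"
    using K by (auto simp: null_ideal_def)
  have "(1/2) *s cross7 (zE 0) (zE 1) \<in> K"
    using null_ideal_cross[OF K x y] sub by (intro vec.subspace_scale)
  then have z: "dual_triple zE 2 \<in> K"
    by (simp add: dual_triple_def numerals_3)
  show ?thesis
  proof
    show "K \<subseteq> null_threespace"
    proof
      fix k assume k: "k \<in> K"
      obtain a b c where c: "k = zorn_comb zE a b c" by (rule zorn_cases)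
      have "b 0 = 0" "b 1 = 0" "a 2 = 0"
        using iso[OF k x] iso[OF k y] iso[OF k z] by (simp_all add: c zorn_tables)
      moreover from this have "c = 0"
        using iso[OF k k] by (simp add: c zorn_tables sum_3')
      ultimately show "k \<in> null_threespace" by (auto simp: null_threespace_def c)
    qed
    show "null_threespace \<subseteq> K"
    proof
      fix k assume "k \<in> null_threespace"
      then obtain a b :: "3 \<Rightarrow> complex" where "k = a 0 *s zE 0 + a 1 *s zE 1 + b 2 *s dual_triple zE 2"
        by (auto simp: null_threespace_def zorn_comb_def sum_3')
      then show "k \<in> K"
        using sub x y z by (simp add: vec.subspace_add vec.subspace_scale)
    qed
  qed
qed

lemma null_ideal_eq_null_plane:
  assumes K: "null_ideal K" and x: "zE 0 \<in> K" and y: "dual_triple zE 1 \<in> K"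
    and triv: "\<And>x y. x \<in> K \<Longrightarrow> y \<in> K \<Longrightarrow> cross7 x y = 0"
  shows "K = null_plane"
proof
  have sub: "vec.subspace K" using K by (auto simp: null_ideal_def)
  show "K \<subseteq> null_plane"
  proof
    fix k assume k: "k \<in> K"
    obtain a b c where c: "k = zorn_comb zE a b c" by (rule zorn_cases)
    show "k \<in> null_plane"
      using triv[OF x k] triv[OF y k]
      by (auto simp: c cross7_zE0_comb_eq_0_iff cross7_dual1_comb_eq_0_iff null_plane_def)
  qed
  show "null_plane \<subseteq> K"
  proof
    fix k assume "k \<in> null_plane"
    then obtain a b :: "3 \<Rightarrow> complex" where "k = a 0 *s zE 0 + b 1 *s dual_triple zE 1"
      by (auto simp: null_plane_def zorn_comb_def sum_3')
    then show "k \<in> K"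
      using sub x y by (simp add: vec.subspace_add vec.subspace_scale)
  qed
qed

text \<open>
  A nonzero member can be moved to \<open>zE 0\<close>.  The ideal then lies in the annihilator of \<open>zE 0\<close>, which
  is spanned by \<open>zE 0\<close> and the duals of \<open>zE 1\<close> and \<open>zE 2\<close>.  It is larger than a line, and it is not
  the whole annihilator, since the two duals have nonzero product; so it contains exactly one
  combination of the duals up to scaling, and an automorphism that fixes \<open>zE 0\<close> moves this
  combination to the dual of \<open>zE 1\<close>.
\<close>

lemma null_ideal_trivial_products:
  assumes K: "null_ideal K" and x: "x \<in> K" "x \<noteq> 0"
    and triv: "\<And>x y. x \<in> K \<Longrightarrow> y \<in> K \<Longrightarrow> cross7 x y = 0"
  obtains h where "h \<in> Aut7" "K = h ` null_plane"
proof -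
  have "dot7 x x = 0" using K x by (auto simp: null_ideal_def)
  then obtain h where h: "h \<in> Aut7" "h (zE 0) = x"
    using Aut7_transitive_on_null_vectors x(2) by metis
  let ?K = "h -` K"
  have K': "null_ideal ?K" by (rule null_ideal_vimage[OF K h(1)])
  have x': "zE 0 \<in> ?K" using h x by simp
  have triv': "cross7 y z = 0" if "y \<in> ?K" "z \<in> ?K" for y z
    using triv[of "h y" "h z"] that Aut7_eq_iff[OF h(1), of "cross7 y z" 0]
    by (simp add: Aut7_cross[OF h(1)] Aut7_zero[OF h(1)])
  have sub: "vec.subspace ?K" using K' by (simp add: null_ideal_def)
  have form: "\<exists>a. \<exists>b :: 3 \<Rightarrow> complex. k = a *s zE 0 + b 1 *s dual_triple zE 1 + b 2 *s dual_triple zE (2 :: 3)"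
    if "k \<in> ?K" for k
  proof -
    obtain a b c where c: "k = zorn_comb zE a b c" by (rule zorn_cases)
    then have "a 1 = 0 \<and> a 2 = 0 \<and> b 0 = 0 \<and> c = 0"
      using triv'[OF x' that] by (simp add: cross7_zE0_comb_eq_0_iff)
    then have "k = a 0 *s zE 0 + b 1 *s dual_triple zE 1 + b 2 *s dual_triple zE 2"
      by (simp add: c zorn_comb_def sum_3')
    then show ?thesis by blast
  qed
  \<comment> \<open>the line spanned by \<open>zE 0\<close> is not an ideal: its orthogonal contains \<open>zE 1\<close>\<close>
  have "\<exists>k \<in> ?K. \<not> (\<exists>a. k = a *s zE 0)"
  proof (rule ccontr)
    assume "\<not> ?thesis"
    then have line: "\<exists>a. k = a *s zE 0" if "k \<in> ?K" for k using that by blast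
    have "zE 1 \<in> imo.perp ?K"
      unfolding imo.perp_def using line by (force simp: dot7_linear triple_ee[OF null_triple_zE])
    then have "cross7 (zE 1) (zE 0) \<in> ?K"
      using K' x' by (simp add: null_ideal_def)
    then obtain a where "cross7 (zE 1) (zE 0) = a *s zE 0" using line by blast
    then have "dot7 (cross7 (zE 0) (zE 1)) (zE 2) = 0"
      by (simp add: cross7_skew[of "zE 0" "zE 1"] dot7_linear triple_ee[OF null_triple_zE])
    then show False
      using null_triple_zE by (simp add: null_triple_def)
  qed
  then obtain k where k: "k \<in> ?K" "\<And>a. k \<noteq> a *s zE 0" by blast
  from form[OF k(1)] obtain a and b :: "3 \<Rightarrow> complex" where ab: "k = a *s zE 0 + b 1 *s dual_triple zE 1 + b 2 *s dual_triple zE (2 :: 3)"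
    by blast
  define k0 where "k0 = b 1 *s dual_triple zE 1 + b 2 *s dual_triple zE (2 :: 3)"
  have "k - a *s zE 0 \<in> ?K"
    using sub k x' by (intro vec.subspace_diff vec.subspace_scale)
  then have k0: "k0 \<in> ?K" by (simp add: ab k0_def)
  have "k0 \<noteq> 0" using k(2)[of a] by (auto simp: ab k0_def)
  \<comment> \<open>a triple with first member \<open>zE 0\<close> and third member \<open>w\<close> has \<open>k0\<close> as the dual of its second member\<close>
  define w where "w = b 1 *s zE 2 - b 2 *s zE 1"
  have cw: "cross7 w (zE 0) = 2 *s k0"
    by (simp add: w_def k0_def dual_triple_def cross7_linear numerals_3 cross7_skew[of "zE 1" "zE 0"] vec_eq_iff)
  have "dot7 w w = 0" "dot7 w (zE 0) = 0" "dot7 (zE 0) (zE 0) = 0"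
    by (simp_all add: w_def dot7_linear triple_ee[OF null_triple_zE])
  then obtain z where z: "dot7 z z = 0" "dot7 w z = 0" "dot7 (zE 0) z = 0" "dot7 (cross7 w (zE 0)) z = 4"
    using null_triple_completion[of w "zE 0"] cw \<open>k0 \<noteq> 0\<close> by auto
  have "dot7 (cross7 (zE 0) z) w = 4"
    using z(4) dot7_cross7_cyclic[of w "zE 0" z] by (simp add: dot7_commute[of w])
  then obtain g where g: "g \<in> Aut7" "g (zE 0) = zE 0" "g (zE 1) = z" "g (zE 2) = w"
    using Aut7_from_null_vectors[of "zE 0" z w] z \<open>dot7 w w = 0\<close> \<open>dot7 w (zE 0) = 0\<close> \<open>dot7 (zE 0) (zE 0) = 0\<close>
    by (metis dot7_commute)
  have gf: "g (dual_triple zE 1) = k0"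
    by (simp add: dual_triple_def Aut7_scale[OF g(1)] Aut7_cross[OF g(1)] g numerals_3 cw)
  have "g -` ?K = null_plane"
  proof (rule null_ideal_eq_null_plane)
    show "null_ideal (g -` ?K)" by (rule null_ideal_vimage[OF K' g(1)])
    show "zE 0 \<in> g -` ?K" using g x' by simp
    show "dual_triple zE 1 \<in> g -` ?K" using gf k0 by simp
    show "cross7 y z = 0" if "y \<in> g -` ?K" "z \<in> g -` ?K" for y z
      using triv'[of "g y" "g z"] that Aut7_eq_iff[OF g(1), of "cross7 y z" 0]
      by (simp add: Aut7_cross[OF g(1)] Aut7_zero[OF g(1)])
  qed
  then have "g ` null_plane = ?K" "h ` ?K = K"
    using image_vimage_Aut7[OF h(1), of K] image_vimage_Aut7[OF g(1), of ?K] by metis+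
  then have "K = (h \<circ> g) ` null_plane"
    by (simp only: image_comp[symmetric])
  then show thesis
    using that[of "h \<circ> g"] Aut7_comp[OF h(1) g(1)] by blast
qed

theorem null_ideal_cases:
  assumes K: "null_ideal K"
  obtains "K = {0}" | h where "h \<in> Aut7" "K = h ` null_plane" | h where "h \<in> Aut7" "K = h ` null_threespace"
proof (cases "\<exists>x\<in>K. \<exists>y\<in>K. cross7 x y \<noteq> 0")
  case True
  then obtain x y where xy: "x \<in> K" "y \<in> K" "cross7 x y \<noteq> 0" by blast
  then have iso: "dot7 x x = 0" "dot7 y y = 0" "dot7 x y = 0"
    using K by (auto simp: null_ideal_def)
  obtain z where "dot7 z z = 0" "dot7 x z = 0" "dot7 y z = 0" "dot7 (cross7 x y) z = 4"
    using null_triple_completion[OF iso xy(3)] by blast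
  then obtain h where h: "h \<in> Aut7" "h (zE 0) = x" "h (zE 1) = y"
    using Aut7_from_null_vectors[of x y z] iso by metis
  then have "h -` K = null_threespace"
    using null_ideal_vimage[OF K h(1)] xy by (intro null_ideal_eq_null_threespace) auto
  then show thesis
    using that(3)[OF h(1)] image_vimage_Aut7[OF h(1), of K] by metis
next
  case False
  then have triv: "cross7 x y = 0" if "x \<in> K" "y \<in> K" for x y using that by blast
  have "0 \<in> K" using K by (simp add: null_ideal_def vec.subspace_0)
  show thesis
  proof (cases "K = {0}")
    case False
    then obtain x where "x \<in> K" "x \<noteq> 0" using \<open>0 \<in> K\<close> by blast
    then show thesis
      using null_ideal_trivial_products[OF K _ _ triv] that(2) by metis
  qed (rule that(1))
qed

section \<open>Lagrangian cross-product relations\<close>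

text \<open>
  A Lagrangian subspace of the sum of two copies of the imaginary octonions, with the difference of
  the two quadratic forms, that is closed under componentwise products.
\<close>

locale lagrangian_relation =
  fixes R :: "imo \<Rightarrow> imo \<Rightarrow> bool"
  assumes zero: "R 0 0"
    and add: "R x y \<Longrightarrow> R x' y' \<Longrightarrow> R (x + x') (y + y')"
    and scale: "R x y \<Longrightarrow> R (c *s x) (c *s y)"
    and isotropic: "R x y \<Longrightarrow> R x' y' \<Longrightarrow> dot7 x x' = dot7 y y'"
    and maximal: "(\<And>x' y'. R x' y' \<Longrightarrow> dot7 x x' = dot7 y y') \<Longrightarrow> R x y"
    and cross: "R x y \<Longrightarrow> R x' y' \<Longrightarrow> R (cross7 x x') (cross7 y y')"
begin

lemma diff: "R x y \<Longrightarrow> R x' y' \<Longrightarrow> R (x - x') (y - y')"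
  using add[OF _ scale[of x' y' "-1"]] by fastforce

lemma converse: "lagrangian_relation (\<lambda>x y. R y x)"
proof unfold_locales
  show "R y x" if "\<And>x' y'. R y' x' \<Longrightarrow> dot7 x x' = dot7 y y'" for x y
    by (rule maximal) (metis that)
qed (use zero add scale cross isotropic[symmetric] in auto)

text \<open>
  By maximality a vector orthogonal to the domain is related to zero; the claim is the orthogonal
  of this inclusion.
\<close>

lemma domain: "a \<in> imo.perp {x. R x 0} \<Longrightarrow> \<exists>b. R a b"
proof -
  let ?D = "{a. \<exists>b. R a b}"
  have D: "vec.subspace ?D"
    unfolding vec.subspace_def using zero add scale by blast
  have "R x 0" if "x \<in> imo.perp ?D" for x
    using that by (intro maximal) (auto simp: imo.perp_def dot7_zero)
  then have "imo.perp ?D \<subseteq> {x. R x 0}" by blast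
  from imo.perp_mono[OF this] show "a \<in> imo.perp {x. R x 0} \<Longrightarrow> \<exists>b. R a b"
    using imo.perp_perp[OF D] by blast
qed

lemma null_ideal_kernel: "null_ideal {x. R x 0}"
  unfolding null_ideal_def
proof (intro conjI ballI)
  show "vec.subspace {x. R x 0}"
    unfolding vec.subspace_def using zero add[of _ 0 _ 0] scale[of _ 0] by auto
  show "dot7 x y = 0" if "x \<in> {x. R x 0}" "y \<in> {x. R x 0}" for x y
    using isotropic[of x 0 y 0] that by (simp add: dot7_zero)
  show "cross7 a x \<in> {x. R x 0}" if a: "a \<in> imo.perp {x. R x 0}" and x: "x \<in> {x. R x 0}" for a x
  proof -
    obtain b where "R a b" using domain[OF a] by blast
    from cross[OF this, of x 0] x show ?thesis by (simp add: cross7_zero)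
  qed
qed

lemma pullback:
  assumes h: "h \<in> Aut7" and k: "k \<in> Aut7"
  shows "lagrangian_relation (\<lambda>x y. R (h x) (k y))"
proof unfold_locales
  show "R (h x) (k y)" if "\<And>x' y'. R (h x') (k y') \<Longrightarrow> dot7 x x' = dot7 y y'" for x y
  proof (rule maximal)
    fix x' y' assume "R x' y'"
    then have "dot7 x (inv h x') = dot7 y (inv k y')"
      by (intro that) (simp add: Aut7_inv_apply h k)
    then show "dot7 (h x) x' = dot7 (k y) y'"
      using Aut7_dot[OF h, of x "inv h x'"] Aut7_dot[OF k, of y "inv k y'"]
      by (simp add: Aut7_inv_apply h k)
  qed
  show "dot7 x x' = dot7 y y'" if "R (h x) (k y)" "R (h x') (k y')" for x y x' y'
    using isotropic[OF that] by (simp add: Aut7_dot h k)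
qed (simp_all add: zero add scale cross Aut7_zero Aut7_add Aut7_scale Aut7_cross h k)

lemma graph_if_kernels_trivial:
  assumes K: "{x. R x 0} = {0}" and K': "{y. R 0 y} = {0}"
  obtains h where "h \<in> Aut7" "\<And>x y. R x y \<longleftrightarrow> y = h x"
proof -
  have "\<exists>b. R a b" for a
    using domain[of a] K by (simp add: imo.perp_def dot7_zero)
  then obtain h where h: "R a (h a)" for a by metis
  have "y = h x" if "R x y" for x y
  proof -
    have "y - h x \<in> {y. R 0 y}"
      using diff[OF that h[of x]] by simp
    then show ?thesis unfolding K' by simp
  qed
  then have R: "R x y \<longleftrightarrow> y = h x" for x y using h by auto
  have lin: "Vector_Spaces.linear (*s) (*s) h"
    by unfold_locales (metis R add, metis R scale)
  have "x = 0" if "h x = 0" for x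
  proof -
    have "x \<in> {x. R x 0}" using that by (simp add: R)
    then show ?thesis unfolding K by simp
  qed
  then have "inj h"
    using vec.linear_inj_iff_eq_0[OF lin] by blast
  then have "bij h"
    using vec.linear_injective_imp_surjective[OF lin] by (simp add: bij_def)
  moreover have "h (cross7 x y) = cross7 (h x) (h y)" "dot7 (h x) (h y) = dot7 x y" for x y
    using cross[of x "h x" y "h y"] isotropic[of x "h x" y "h y"] by (simp_all add: R)
  ultimately show thesis
    using that[of h] lin R by (simp add: Aut7_def)
qed

end

definition zorn_diag :: "(3 \<Rightarrow> complex) \<Rightarrow> (3 \<Rightarrow> complex) \<Rightarrow> complex \<Rightarrow> imo \<Rightarrow> imo" where
  "zorn_diag p q s x = zorn_comb zE (\<lambda>k. p k * zA x k) (\<lambda>k. q k * zB x k) (s * zC x)"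

lemma zorn_diag_comb: "zorn_diag p q s (zorn_comb zE a b c) = zorn_comb zE (\<lambda>k. p k * a k) (\<lambda>k. q k * b k) (s * c)"
  by (simp add: zorn_diag_def)

text \<open>
  An automorphism that is diagonal in the standard Zorn basis scales the \<open>zE k\<close> by three numbers
  with product \<open>1\<close> and their duals by the inverses.  Both families used here are written as
  quotients of a right and a left scaling, \<open>(t, 1/t, 1)\<close> for planes and \<open>(t, t, 1/t\<^sup>2)\<close> for
  three-spaces, so that the graph, given as the set of all \<open>(left z, right z)\<close>, still makes sense at
  \<open>t = 0\<close>.  On the dual vectors the two scalings change places.
\<close>

definition plane_left :: "complex \<Rightarrow> 3 \<Rightarrow> complex" where
  "plane_left t k = (if k = 1 then t else 1)"

definition plane_right :: "complex \<Rightarrow> 3 \<Rightarrow> complex" where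
  "plane_right t k = (if k = 0 then t else 1)"

definition space_left :: "complex \<Rightarrow> 3 \<Rightarrow> complex" where
  "space_left t k = (if k = 2 then t ^ 2 else 1)"

definition space_right :: "complex \<Rightarrow> 3 \<Rightarrow> complex" where
  "space_right t k = (if k = 2 then 1 else t)"

text \<open>
  Exchanges the standard triple with its dual.  The left and the right kernel of a degenerate graph
  are opposite to each other, so this carries the normal form of one to that of the other.
\<close>

definition zorn_swap :: "imo \<Rightarrow> imo" where
  "zorn_swap = zorn_map (dual_triple zE)"

lemma dual_triple_dual_zE: "dual_triple (dual_triple zE) = zE"
proof
  fix k show "dual_triple (dual_triple zE) k = zE k"
    using triple_cross_ff[OF null_triple_zE, of "k + 1"]
    by (simp add: dual_triple_def[of "dual_triple zE"] add.assoc numerals_3)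
qed

lemma null_triple_dual_zE: "null_triple (dual_triple zE)"
  using triple_cross_ff[OF null_triple_zE, of 0] triple_ef[OF null_triple_zE, of 2 2]
  by (simp add: null_triple_def triple_ff[OF null_triple_zE] dot7_linear numerals_3)

lemma zorn_swap_Aut7: "zorn_swap \<in> Aut7"
  unfolding zorn_swap_def by (rule zorn_map_automorphism[OF null_triple_dual_zE])

lemma zorn_swap_comb: "zorn_swap (zorn_comb zE a b c) = zorn_comb zE b a (- c)"
proof -
  have "triple_axis (dual_triple zE) = - triple_axis zE"
    using triple_cross_ef[OF null_triple_zE, of 0] cross7_skew[of "dual_triple zE 0" "zE 0"]
    by (simp add: triple_axis_def[of "dual_triple zE"] dual_triple_dual_zE vec_eq_iff)
  then show ?thesis
    by (simp add: zorn_swap_def zorn_comb_def[of "dual_triple zE"] dual_triple_dual_zE)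
      (simp add: zorn_comb_def)
qed

lemma perp_null_plane: "zorn_comb zE a b c \<in> imo.perp null_plane \<longleftrightarrow> b 0 = 0 \<and> a 1 = 0"
proof
  assume "zorn_comb zE a b c \<in> imo.perp null_plane"
  moreover have "zE 0 \<in> null_plane" "dual_triple zE 1 \<in> null_plane"
    unfolding null_plane_def using zorn_basis_as_comb[OF null_triple_zE] by force+
  ultimately show "b 0 = 0 \<and> a 1 = 0"
    unfolding imo.perp_def using zorn_tables(1)[of a b c 0] zorn_tables(2)[of a b c 1] by auto
qed (auto simp: imo.perp_def null_plane_def zorn_tables sum_3')

lemma perp_null_threespace: "zorn_comb zE a b c \<in> imo.perp null_threespace \<longleftrightarrow> b 0 = 0 \<and> b 1 = 0 \<and> a 2 = 0"
proof
  assume "zorn_comb zE a b c \<in> imo.perp null_threespace"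
  moreover have "zE 0 \<in> null_threespace" "zE 1 \<in> null_threespace" "dual_triple zE 2 \<in> null_threespace"
    unfolding null_threespace_def using zorn_basis_as_comb[OF null_triple_zE] by force+
  ultimately show "b 0 = 0 \<and> b 1 = 0 \<and> a 2 = 0"
    unfolding imo.perp_def using zorn_tables(1)[of a b c] zorn_tables(2)[of a b c 2] by auto
qed (auto simp: imo.perp_def null_threespace_def zorn_tables sum_3')

lemma zorn_swap_image_null_plane:
  "zorn_swap ` null_plane = {zorn_comb zE a b 0 | a b. a 0 = 0 \<and> a 2 = 0 \<and> b 1 = 0 \<and> b 2 = 0}"
  by (force simp: null_plane_def zorn_swap_comb)

lemma zorn_swap_image_null_threespace:
  "zorn_swap ` null_threespace = {zorn_comb zE a b 0 | a b. a 0 = 0 \<and> a 1 = 0 \<and> b 2 = 0}"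
  by (force simp: null_threespace_def zorn_swap_comb)

lemma zorn_comb_mem:
  "zorn_comb zE a b 0 \<in> null_plane \<longleftrightarrow> a 1 = 0 \<and> a 2 = 0 \<and> b 0 = 0 \<and> b 2 = 0"
  "zorn_comb zE a b 0 \<in> null_threespace \<longleftrightarrow> a 2 = 0 \<and> b 0 = 0 \<and> b 1 = 0"
  "zorn_comb zE a b 0 \<in> zorn_swap ` null_plane \<longleftrightarrow> a 0 = 0 \<and> a 2 = 0 \<and> b 1 = 0 \<and> b 2 = 0"
  "zorn_comb zE a b 0 \<in> zorn_swap ` null_threespace \<longleftrightarrow> a 0 = 0 \<and> a 1 = 0 \<and> b 2 = 0"
  unfolding zorn_swap_image_null_plane zorn_swap_image_null_threespace
  by (auto simp: null_plane_def null_threespace_def zorn_tables)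

lemma perp_Aut7_image:
  assumes h: "h \<in> Aut7" shows "h x \<in> imo.perp (h ` S) \<longleftrightarrow> x \<in> imo.perp S"
  by (auto simp: imo.perp_def Aut7_dot[OF h])

lemma perp_swap_null_plane: "zorn_comb zE a b c \<in> imo.perp (zorn_swap ` null_plane) \<longleftrightarrow> a 0 = 0 \<and> b 1 = 0"
  using perp_Aut7_image[OF zorn_swap_Aut7, of "zorn_comb zE b a (- c)" null_plane]
  by (simp add: zorn_swap_comb perp_null_plane)

lemma perp_swap_null_threespace:
  "zorn_comb zE a b c \<in> imo.perp (zorn_swap ` null_threespace) \<longleftrightarrow> a 0 = 0 \<and> a 1 = 0 \<and> b 2 = 0"
  using perp_Aut7_image[OF zorn_swap_Aut7, of "zorn_comb zE b a (- c)" null_threespace]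
  by (simp add: zorn_swap_comb perp_null_threespace)

lemma zorn_comb_cong:
  "(\<And>k. a k = a' k) \<Longrightarrow> (\<And>k. b k = b' k) \<Longrightarrow> c = c' \<Longrightarrow> zorn_comb e a b c = zorn_comb e a' b' c'"
  by (simp add: zorn_comb_def)

context lagrangian_relation
begin

lemma range_perp: "R x y \<Longrightarrow> y \<in> imo.perp {y. R 0 y}"
  using isotropic[of x y 0] by (auto simp: imo.perp_def dot7_zero)

lemma domain_perp: "R x y \<Longrightarrow> x \<in> imo.perp {x. R x 0}"
  using isotropic[of x y _ 0] by (auto simp: imo.perp_def dot7_zero)

text \<open>
  The kernels determine the relation up to the value at the axis, which spans the orthogonal of the
  left kernel modulo that kernel.  Preservation of the form leaves only a sign.
\<close>

lemma normal_form_space: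
  assumes K: "{x. R x 0} = null_threespace" and K': "{y. R 0 y} = zorn_swap ` null_threespace"
  obtains s where "s = 1 \<or> s = -1"
    "\<And>x y. R x y \<longleftrightarrow> (\<exists>z. x = zorn_diag (space_left 0) (space_right 0) 1 z \<and>
                          y = zorn_diag (space_right 0) (space_left 0) s z)"
proof -
  let ?u = "triple_axis zE"
  have u: "?u = zorn_comb zE (\<lambda>_. 0) (\<lambda>_. 0) 1"
    by (rule zorn_basis_as_comb[OF null_triple_zE])
  have "?u \<in> imo.perp {x. R x 0}"
    by (simp add: K u perp_null_threespace)
  then obtain v where v: "R ?u v" using domain by blast
  obtain a b s where abs: "v = zorn_comb zE a b s" by (rule zorn_cases)
  have z: "a 0 = 0" "a 1 = 0" "b 2 = 0"
    using range_perp[OF v] by (simp_all add: K' abs perp_swap_null_threespace)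
  have "zorn_comb zE a b 0 \<in> {y. R 0 y}"
    using z by (simp add: K' zorn_comb_mem)
  then have "R (?u - 0) (v - zorn_comb zE a b 0)"
    using v by (intro diff) auto
  moreover have "v - zorn_comb zE a b 0 = s *s ?u"
    by (simp add: abs zorn_comb_def)
  ultimately have us: "R ?u (s *s ?u)" by simp
  have "1 = s * s"
    using isotropic[OF us us] by (simp add: dot7_linear triple_uu[OF null_triple_zE])
  then have s: "s = 1 \<or> s = -1"
    by (metis square_eq_1_iff)
  have "R x y \<longleftrightarrow> (\<exists>z. x = zorn_diag (space_left 0) (space_right 0) 1 z \<and>
                          y = zorn_diag (space_right 0) (space_left 0) s z)" for x y
  proof
    assume R: "R x y"
    obtain a b c where x: "x = zorn_comb zE a b c" by (rule zorn_cases)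
    have z: "b 0 = 0" "b 1 = 0" "a 2 = 0"
      using domain_perp[OF R] by (simp_all add: K x perp_null_threespace)
    have "zorn_comb zE a b 0 \<in> {x. R x 0}"
      using z by (simp add: K zorn_comb_mem)
    then have "R (x - zorn_comb zE a b 0 - c *s ?u) (y - 0 - c *s (s *s ?u))"
      using R us by (intro diff scale) auto
    moreover have "x - zorn_comb zE a b 0 - c *s ?u = 0"
      by (simp add: x zorn_comb_def)
    ultimately have "y - c *s (s *s ?u) \<in> {y. R 0 y}" by simp
    then obtain a' b' where "y - c *s (s *s ?u) = zorn_comb zE a' b' 0" and z': "a' 0 = 0" "a' 1 = 0" "b' 2 = 0"
      unfolding K' zorn_swap_image_null_threespace by auto
    then have y: "y = zorn_comb zE a' b' (s * c)"
      by (simp add: zorn_comb_def algebra_simps)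
    let ?z = "zorn_comb zE (\<lambda>k. if k = 2 then a' k else a k) (\<lambda>k. if k = 2 then b k else b' k) c"
    have "x = zorn_diag (space_left 0) (space_right 0) 1 ?z"
      "y = zorn_diag (space_right 0) (space_left 0) s ?z"
      unfolding x y zorn_diag_comb using z z' exhaust_3'
      by (intro zorn_comb_cong; force simp: space_left_def space_right_def)+
    then show "\<exists>z. x = zorn_diag (space_left 0) (space_right 0) 1 z \<and>
                          y = zorn_diag (space_right 0) (space_left 0) s z" by blast
  next
    assume "\<exists>z. x = zorn_diag (space_left 0) (space_right 0) 1 z \<and>
                          y = zorn_diag (space_right 0) (space_left 0) s z"
    then obtain a b c where x: "x = zorn_diag (space_left 0) (space_right 0) 1 (zorn_comb zE a b c)"
      and y: "y = zorn_diag (space_right 0) (space_left 0) s (zorn_comb zE a b c)"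
      by (metis zorn_cases)
    let ?x = "zorn_comb zE (\<lambda>k. space_left 0 k * a k) (\<lambda>k. space_right 0 k * b k) 0"
    let ?y = "zorn_comb zE (\<lambda>k. space_right 0 k * a k) (\<lambda>k. space_left 0 k * b k) 0"
    have "?x \<in> {x. R x 0}" "?y \<in> {y. R 0 y}"
      by (simp_all add: K K' zorn_comb_mem space_left_def space_right_def)
    then have "R (?x + 0 + c *s ?u) (0 + ?y + c *s (s *s ?u))"
      using us by (intro add scale) auto
    moreover have "?x + 0 + c *s ?u = x" "0 + ?y + c *s (s *s ?u) = y"
      unfolding x y zorn_diag_comb by (simp_all add: zorn_comb_def mult.commute)
    ultimately show "R x y" by simp
  qed
  with s that show thesis by blast
qed

text \<open>
  Products of \<open>zE 2\<close> with its dual yield the axis, and these three vectors span the orthogonal of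
  the left kernel modulo that kernel.
\<close>

lemma normal_form_plane:
  assumes K: "{x. R x 0} = null_plane" and K': "{y. R 0 y} = zorn_swap ` null_plane"
    and E: "R (zE 2) (zE 2)" and F: "R (dual_triple zE 2) (dual_triple zE 2)"
  shows "R x y \<longleftrightarrow> (\<exists>z. x = zorn_diag (plane_left 0) (plane_right 0) 1 z \<and>
                        y = zorn_diag (plane_right 0) (plane_left 0) 1 z)"
proof -
  let ?u = "triple_axis zE" and ?e = "zE 2" and ?f = "dual_triple zE 2"
  have "R ((- \<i> / 2) *s cross7 ?e ?f) ((- \<i> / 2) *s cross7 ?e ?f)"
    using E F by (intro scale cross)
  then have U: "R ?u ?u"
    by (simp add: triple_axis_via[OF null_triple_zE, of 2])
  have diag: "R (\<alpha> *s ?e + \<beta> *s ?f + \<gamma> *s ?u) (\<alpha> *s ?e + \<beta> *s ?f + \<gamma> *s ?u)" for \<alpha> \<beta> \<gamma>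
    using E F U by (intro add scale)
  show ?thesis
  proof
    assume R: "R x y"
    obtain a b c where x: "x = zorn_comb zE a b c" by (rule zorn_cases)
    have z: "b 0 = 0" "a 1 = 0"
      using domain_perp[OF R] by (simp_all add: K x perp_null_plane)
    let ?d = "a 2 *s ?e + b 2 *s ?f + c *s ?u"
    let ?k = "zorn_comb zE (\<lambda>k. if k = 0 then a k else 0) (\<lambda>k. if k = 1 then b k else 0) 0"
    have "?k \<in> {x. R x 0}"
      by (simp add: K zorn_comb_mem)
    then have "R (x - ?k - ?d) (y - 0 - ?d)"
      using R diag by (intro diff) auto
    moreover have "x - ?k - ?d = 0"
      using z by (simp add: x zorn_comb_def sum_3')
    ultimately have "y - ?d \<in> {y. R 0 y}" by simp
    then obtain a' b' where "y - ?d = zorn_comb zE a' b' 0" and z': "a' 0 = 0" "a' 2 = 0" "b' 1 = 0" "b' 2 = 0"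
      unfolding K' zorn_swap_image_null_plane by auto
    then have y: "y = zorn_comb zE a' b' 0 + ?d"
      by (simp add: algebra_simps)
    let ?z = "zorn_comb zE (\<lambda>k. if k = 1 then a' k else a k) (\<lambda>k. if k = 0 then b' k else b k) c"
    have "x = zorn_diag (plane_left 0) (plane_right 0) 1 ?z"
      "y = zorn_diag (plane_right 0) (plane_left 0) 1 ?z"
      unfolding x y zorn_diag_comb using z z'
      by (simp_all add: plane_left_def plane_right_def zorn_comb_def sum_3')
    then show "\<exists>z. x = zorn_diag (plane_left 0) (plane_right 0) 1 z \<and>
                        y = zorn_diag (plane_right 0) (plane_left 0) 1 z" by blast
  next
    assume "\<exists>z. x = zorn_diag (plane_left 0) (plane_right 0) 1 z \<and>
                        y = zorn_diag (plane_right 0) (plane_left 0) 1 z"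
    then obtain a b c where x: "x = zorn_diag (plane_left 0) (plane_right 0) 1 (zorn_comb zE a b c)"
      and y: "y = zorn_diag (plane_right 0) (plane_left 0) 1 (zorn_comb zE a b c)"
      by (metis zorn_cases)
    let ?x = "zorn_comb zE (\<lambda>k. if k = 0 then a k else 0) (\<lambda>k. if k = 1 then b k else 0) 0"
    let ?y = "zorn_comb zE (\<lambda>k. if k = 1 then a k else 0) (\<lambda>k. if k = 0 then b k else 0) 0"
    let ?d = "a 2 *s ?e + b 2 *s ?f + c *s ?u"
    have "?x \<in> {x. R x 0}" "?y \<in> {y. R 0 y}"
      by (simp_all add: K K' zorn_comb_mem)
    then have "R (?x + 0 + ?d) (0 + ?y + ?d)"
      using add[OF add[of ?x 0 0 ?y] diag] by simp
    moreover have "?x + 0 + ?d = x" "0 + ?y + ?d = y"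
      unfolding x y zorn_diag_comb by (simp_all add: plane_left_def plane_right_def zorn_comb_def sum_3')
    ultimately show "R x y" by simp
  qed
qed

end

lemma not_in_span_if_separated:
  fixes m :: imo
  assumes "\<And>y. y \<in> S \<Longrightarrow> dot7 m y = 0" "dot7 m x \<noteq> 0"
  shows "x \<notin> vec.span S"
  using assms imo.perp_span[of S] by (auto simp: imo.perp_def)

lemma Aut7_eq_0_iff: "h \<in> Aut7 \<Longrightarrow> h x = 0 \<longleftrightarrow> x = 0"
  using Aut7_eq_iff[of h x 0] by (simp add: Aut7_zero)

lemma dim_null_plane: "vec.dim null_plane = 2"
proof (rule vec.dim_unique)
  let ?B = "{zE 0, dual_triple zE 1}"
  note tabs = triple_ee[OF null_triple_zE] triple_ef[OF null_triple_zE] triple_ff[OF null_triple_zE]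
  have n: "zE 0 \<notin> vec.span {dual_triple zE 1}"
    by (rule not_in_span_if_separated[of _ "dual_triple zE 0"])
      (auto simp: tabs dot7_commute[of "dual_triple zE _" "zE _"])
  have "dual_triple zE 1 \<notin> vec.span {}"
    by (rule not_in_span_if_separated[of _ "zE 1"]) (auto simp: tabs)
  with n show "vec.independent ?B"
    by (simp add: vec.independent_insert vec.independent_empty)
  show "card ?B = 2"
    using n vec.span_base[of "zE 0" "{dual_triple zE 1}"] by (auto simp: card_insert_if)
  show "?B \<subseteq> null_plane"
    using zorn_basis_as_comb[OF null_triple_zE] by (simp add: zorn_comb_mem)
  show "null_plane \<subseteq> vec.span ?B"
  proof
    fix k assume "k \<in> null_plane"
    then obtain a b :: "3 \<Rightarrow> complex" where "k = a 0 *s zE 0 + b 1 *s dual_triple zE 1"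
      by (auto simp: null_plane_def zorn_comb_def sum_3')
    then show "k \<in> vec.span ?B"
      by (simp add: vec.span_add vec.span_scale vec.span_base)
  qed
qed

lemma dim_null_threespace: "vec.dim null_threespace = 3"
proof (rule vec.dim_unique)
  let ?B = "{zE 0, zE 1, dual_triple zE 2}"
  note tabs = triple_ee[OF null_triple_zE] triple_ef[OF null_triple_zE] triple_ff[OF null_triple_zE]
  have n: "zE 0 \<notin> vec.span {zE 1, dual_triple zE 2}"
    by (rule not_in_span_if_separated[of _ "dual_triple zE 0"])
      (auto simp: tabs dot7_commute[of "dual_triple zE _" "zE _"])
  have n2: "zE 1 \<notin> vec.span {dual_triple zE 2}"
    by (rule not_in_span_if_separated[of _ "dual_triple zE 1"])
      (auto simp: tabs dot7_commute[of "dual_triple zE _" "zE _"])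
  have "dual_triple zE 2 \<notin> vec.span {}"
    by (rule not_in_span_if_separated[of _ "zE 2"]) (auto simp: tabs)
  with n n2 show "vec.independent ?B"
    by (simp add: vec.independent_insert vec.independent_empty)
  show "card ?B = 3"
    using n n2 vec.span_base[of "zE 0" "{zE 1, dual_triple zE 2}"] vec.span_base[of "zE 1" "{dual_triple zE 2}"]
    by (auto simp: card_insert_if)
  show "?B \<subseteq> null_threespace"
    using zorn_basis_as_comb[OF null_triple_zE] by (simp add: zorn_comb_mem)
  show "null_threespace \<subseteq> vec.span ?B"
  proof
    fix k assume "k \<in> null_threespace"
    then obtain a b :: "3 \<Rightarrow> complex" where "k = a 0 *s zE 0 + a 1 *s zE 1 + b 2 *s dual_triple zE 2"
      by (auto simp: null_threespace_def zorn_comb_def sum_3')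
    then show "k \<in> vec.span ?B"
      by (simp add: vec.span_add vec.span_scale vec.span_base)
  qed
qed

lemma dim_Aut7_image: "h \<in> Aut7 \<Longrightarrow> vec.dim (h ` S) = vec.dim S"
  using Aut7_linear[of h] Aut7_bij[of h]
  by (intro vec.dim_image_eq) (auto intro: inj_on_subset[OF bij_is_inj])

lemma cross7_zE1_comb_eq_0_iff:
  "cross7 (zE 1) (zorn_comb zE a b c) = 0 \<longleftrightarrow> a 0 = 0 \<and> a 2 = 0 \<and> b 1 = 0 \<and> c = 0"
  by (subst zorn_basis_as_comb(1)[OF null_triple_zE])
    (auto simp: zorn_tables zorn_comb_eq_0_iff forall_3' sum_3' numerals_3)

lemma null_plane_products: "x \<in> null_plane \<Longrightarrow> y \<in> null_plane \<Longrightarrow> cross7 x y = 0"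
  by (auto simp: null_plane_def zorn_tables zorn_comb_eq_0_iff forall_3' sum_3' numerals_3)

context lagrangian_relation
begin

text \<open>
  For a relation with standard left kernel, the images of \<open>zE 2\<close> and its dual act on the right
  kernel by two square-zero maps whose anticommutator is a nonzero scalar.  This produces a null
  triple adapted to the right kernel.
\<close>

lemma adapt_right_kernel:
  assumes K: "{x. R x 0} = null_plane" and dim: "vec.dim {y. R 0 y} = 2"
  obtains g where "g \<in> Aut7" "\<And>x y. R x (g y) \<longleftrightarrow> (\<exists>z. x = zorn_diag (plane_left 0) (plane_right 0) 1 z \<and>
                        y = zorn_diag (plane_right 0) (plane_left 0) 1 z)"
proof -
  let ?K' = "{y. R 0 y}"
  have K': "null_ideal ?K'"
    by (rule lagrangian_relation.null_ideal_kernel[OF converse])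
  obtain k where k: "k \<in> Aut7" "?K' = k ` null_plane"
  proof (rule null_ideal_cases[OF K'])
    assume "?K' = {0}"
    then show thesis using dim by simp
  next
    fix h assume "h \<in> Aut7" "?K' = h ` null_threespace"
    then show thesis using dim by (simp add: dim_Aut7_image dim_null_threespace)
  qed
  have triv: "cross7 x y = 0" if "x \<in> ?K'" "y \<in> ?K'" for x y
    using that null_plane_products unfolding k(2) by (auto simp: Aut7_zero[OF k(1)] simp flip: Aut7_cross[OF k(1)])
  have "\<exists>y\<in>?K'. y \<noteq> 0"
  proof (rule ccontr)
    assume "\<not> ?thesis"
    then have "?K' \<subseteq> {0}" by blast
    then show False using dim vec.dim_eq_0[of ?K'] by simp
  qed
  then obtain y0 where y0: "R 0 y0" "y0 \<noteq> 0" by blast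
  have "zE 2 \<in> imo.perp {x. R x 0}" "dual_triple zE 2 \<in> imo.perp {x. R x 0}"
    unfolding K using zorn_basis_as_comb[OF null_triple_zE] by (simp_all add: perp_null_plane)
  then obtain e f where e: "R (zE 2) e" and f: "R (dual_triple zE 2) f"
    using domain by metis
  note tabs = triple_ee[OF null_triple_zE] triple_ef[OF null_triple_zE] triple_ff[OF null_triple_zE]
  have ee: "dot7 e e = 0" and ff: "dot7 f f = 0" and ef: "dot7 e f = 2"
    using isotropic[OF e e] isotropic[OF f f] isotropic[OF e f] by (simp_all add: tabs)
  have orth: "dot7 e y = 0" "dot7 f y = 0" if "R 0 y" for y
    using isotropic[OF e that] isotropic[OF f that] by (simp_all add: dot7_zero)
  have mult: "R 0 (cross7 e y)" "R 0 (cross7 f y)" if "R 0 y" for y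
    using cross[OF e that] cross[OF f that] by (simp_all add: cross7_zero)
  have "\<exists>y. y \<noteq> 0 \<and> R 0 y \<and> cross7 f y = 0"
  proof (cases "cross7 f y0 = 0")
    case False
    have "cross7 f (cross7 f y0) = 0"
      using ff orth(2)[OF y0(1)] by (simp add: cross7_cross7_same)
    then show ?thesis using False mult(2)[OF y0(1)] by blast
  qed (use y0 in blast)
  then obtain y where y: "y \<noteq> 0" "R 0 y" "cross7 f y = 0" by blast
  have "cross7 f (cross7 e y) = - 4 *s y"
    using cross7_cross7_polar[of f e y] y(3) orth[OF y(2)] ef
    by (simp add: dot7_commute[of f e] cross7_zero)
  then have "cross7 y e \<noteq> 0"
    using y(1) by (auto simp: cross7_skew[of e y] cross7_linear)
  moreover have "dot7 y y = 0" "dot7 y e = 0"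
    using isotropic[OF y(2) y(2)] orth(1)[OF y(2)] by (simp_all add: dot7_zero dot7_commute)
  ultimately obtain z where z: "dot7 z z = 0" "dot7 y z = 0" "dot7 e z = 0" "dot7 (cross7 y e) z = 4"
    using null_triple_completion[of y e] ee by metis
  have "dot7 (cross7 z y) e = 4"
    using z(4) dot7_cross7_cyclic[of z y e] by (simp add: dot7_commute)
  then obtain g where g: "g \<in> Aut7" "g (zE 0) = z" "g (zE 1) = y" "g (zE 2) = e"
    using Aut7_from_null_vectors[of z y e] z \<open>dot7 y y = 0\<close> \<open>dot7 y e = 0\<close> ee by (metis dot7_commute)
  have gd: "g (dual_triple zE 0) = (1/2) *s cross7 y e"
    by (simp add: dual_triple_def Aut7_scale[OF g(1)] Aut7_cross[OF g(1)] g)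
  have "R (0 :: imo) ((1/2) *s - cross7 e y)"
    using scale[OF scale[OF mult(1)[OF y(2)], of "-1"], of "1/2"] by simp
  then have gd': "R 0 (g (dual_triple zE 0))"
    by (simp add: gd cross7_skew[of y e])
  interpret S: lagrangian_relation "\<lambda>x y. R x (g y)"
    using pullback[OF Aut7_id g(1)] by simp
  let ?h = "g \<circ> zorn_swap"
  have h: "?h \<in> Aut7" by (rule Aut7_comp[OF g(1) zorn_swap_Aut7])
  have sw: "zorn_swap (zE 0) = dual_triple zE 0" "zorn_swap (dual_triple zE 1) = zE 1"
    using zorn_swap_comb[of "\<lambda>j. if j = 0 then 1 else 0" "\<lambda>_. 0" 0]
      zorn_swap_comb[of "\<lambda>_. 0" "\<lambda>j. if j = 1 then 1 else 0" 0]
    by (simp_all flip: zorn_basis_as_comb[OF null_triple_zE])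
  have "?h -` ?K' = null_plane"
  proof (rule null_ideal_eq_null_plane)
    show "null_ideal (?h -` ?K')" by (rule null_ideal_vimage[OF K' h])
    show "zE 0 \<in> ?h -` ?K'" using gd' by (simp add: sw)
    show "dual_triple zE 1 \<in> ?h -` ?K'" using y g by (simp add: sw)
    show "cross7 x y = 0" if "x \<in> ?h -` ?K'" "y \<in> ?h -` ?K'" for x y
      using triv[OF that[unfolded vimage_eq]] Aut7_eq_0_iff[OF h, of "cross7 x y"]
      unfolding Aut7_cross[OF h] by blast
  qed
  moreover have "?h -` ?K' = zorn_swap -` {y. R 0 (g y)}"
    by auto
  ultimately have SK': "{y. R 0 (g y)} = zorn_swap ` null_plane"
    using image_vimage_Aut7[OF zorn_swap_Aut7, of "{y. R 0 (g y)}"] by metis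
  have SK: "{x. R x (g 0)} = null_plane"
    using K by (simp add: Aut7_zero[OF g(1)])
  have SE: "R (zE 2) (g (zE 2))" using e g by simp
  \<comment> \<open>the image of the dual vector is already correct up to the kernel\<close>
  obtain a b c where abc: "inv g f = zorn_comb zE a b c" by (rule zorn_cases)
  have gf: "g (zorn_comb zE a b c) = f"
    by (simp flip: abc add: Aut7_inv_apply[OF g(1)])
  then have Sf: "R (dual_triple zE 2) (g (zorn_comb zE a b c))" using f by simp
  have "a 0 = 0" "b 1 = 0"
    using S.range_perp[OF Sf] by (simp_all add: SK' perp_swap_null_plane)
  moreover have "g (cross7 (zE 1) (zorn_comb zE a b c)) = 0"
    using y(3) by (simp add: Aut7_cross[OF g(1)] gf g cross7_skew[of y f])
  then have "cross7 (zE 1) (zorn_comb zE a b c) = 0"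
    using Aut7_eq_iff[OF g(1)] Aut7_zero[OF g(1)] by metis
  then have "a 2 = 0" "c = 0"
    by (simp_all add: cross7_zE1_comb_eq_0_iff)
  moreover have "b 2 = 1"
    using S.isotropic[OF Sf SE] by (simp add: zorn_tables tabs dot7_commute[of "dual_triple zE 2"])
  ultimately have split: "zorn_comb zE a b c = zorn_comb zE a (\<lambda>k. if k = 0 then b k else 0) 0 + dual_triple zE 2"
    by (simp add: zorn_comb_def sum_3')
  have "zorn_comb zE a (\<lambda>k. if k = 0 then b k else 0) 0 \<in> {y. R 0 (g y)}"
    unfolding SK' using \<open>a 0 = 0\<close> \<open>a 2 = 0\<close> by (simp add: zorn_comb_mem)
  then have "R (dual_triple zE 2 - 0) (g (zorn_comb zE a b c - zorn_comb zE a (\<lambda>k. if k = 0 then b k else 0) 0))"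
    using Sf by (intro S.diff) auto
  then have SF: "R (dual_triple zE 2) (g (dual_triple zE 2))"
    by (simp add: split)
  show thesis
    using that[OF g(1)] S.normal_form_plane[OF SK SK' SE SF] by blast
qed

text \<open>
  The type of the left kernel decides the case; the right kernel is of the same type because the
  types differ in dimension.  Conjugating both kernels to standard position leaves the freedom that
  the two normal form lemmas describe.
\<close>

theorem classification:
  assumes dim: "vec.dim {x. R x 0} = vec.dim {y. R 0 y}"
  obtains
    (graph) h where "h \<in> Aut7" "\<And>x y. R x y \<longleftrightarrow> y = h x"
  | (plane) h k where "h \<in> Aut7" "k \<in> Aut7"
      "\<And>x y. R (h x) (k y) \<longleftrightarrow> (\<exists>z. x = zorn_diag (plane_left 0) (plane_right 0) 1 z \<and>
                        y = zorn_diag (plane_right 0) (plane_left 0) 1 z)"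
  | (space) h k s where "h \<in> Aut7" "k \<in> Aut7" "s = 1 \<or> s = -1"
      "\<And>x y. R (h x) (k y) \<longleftrightarrow> (\<exists>z. x = zorn_diag (space_left 0) (space_right 0) 1 z \<and>
                        y = zorn_diag (space_right 0) (space_left 0) s z)"
proof -
  have K': "null_ideal {y. R 0 y}"
    by (rule lagrangian_relation.null_ideal_kernel[OF converse])
  consider (zero) "{x. R x 0} = {0}" | (plane) h where "h \<in> Aut7" "{x. R x 0} = h ` null_plane"
    | (space) h where "h \<in> Aut7" "{x. R x 0} = h ` null_threespace"
    using null_ideal_cases[OF null_ideal_kernel] by metis
  then show thesis
  proof cases
    case zero
    then have "vec.dim {y. R 0 y} = 0" using dim by simp
    then have "{y. R 0 y} = {0}" using vec.dim_eq_0[of "{y. R 0 y}"] local.zero by blast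
    from graph_if_kernels_trivial[OF zero this] show thesis using graph by blast
  next
    case (plane h)
    interpret S: lagrangian_relation "\<lambda>x y. R (h x) y"
      using pullback[OF plane(1) Aut7_id] by simp
    have "{x. R (h x) 0} = h -` (h ` null_plane)"
      unfolding plane(2)[symmetric] by auto
    then have "{x. R (h x) 0} = null_plane"
      using Aut7_bij[OF plane(1)] by (simp add: inj_vimage_image_eq bij_is_inj)
    moreover have dr: "vec.dim {y. R (h 0) y} = 2"
      using dim plane by (simp add: Aut7_zero dim_Aut7_image dim_null_plane)
    ultimately obtain g where "g \<in> Aut7" "\<And>x y. R (h x) (g y) \<longleftrightarrow> (\<exists>z. x = zorn_diag (plane_left 0) (plane_right 0) 1 z \<and>
                        y = zorn_diag (plane_right 0) (plane_left 0) 1 z)"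
      using S.adapt_right_kernel by metis
    then show thesis using that(2)[OF plane(1)] by blast
  next
    case (space h)
    have "vec.dim {y. R 0 y} = 3"
      using dim space by (simp add: dim_Aut7_image dim_null_threespace)
    obtain k where k: "k \<in> Aut7" "{y. R 0 y} = k ` null_threespace"
    proof (rule null_ideal_cases[OF K'])
      assume "{y. R 0 y} = {0}"
      then show thesis using \<open>vec.dim {y. R 0 y} = 3\<close> by simp
    next
      fix h assume "h \<in> Aut7" "{y. R 0 y} = h ` null_plane"
      then show thesis using \<open>vec.dim {y. R 0 y} = 3\<close> by (simp add: dim_Aut7_image dim_null_plane)
    qed
    have inj: "{x. R (h x) 0} = null_threespace"
    proof -
      have "{x. R (h x) 0} = h -` (h ` null_threespace)"
        unfolding space(2)[symmetric] by auto
      then show ?thesis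
        using Aut7_bij[OF space(1)] by (simp add: inj_vimage_image_eq bij_is_inj)
    qed
    let ?k = "k \<circ> inv zorn_swap"
    have k': "?k \<in> Aut7" by (intro Aut7_comp k Aut7_inv zorn_swap_Aut7)
    interpret S: lagrangian_relation "\<lambda>x y. R (h x) (?k y)"
      by (rule pullback[OF space(1) k'])
    have "{y. R 0 (?k y)} = ?k -` (?k ` (zorn_swap ` null_threespace))"
    proof -
      have "?k ` (zorn_swap ` null_threespace) = {y. R 0 y}"
        unfolding k(2) by (simp add: image_image Aut7_inv_apply[OF zorn_swap_Aut7])
      then show ?thesis by auto
    qed
    then have SK': "{y. R (h 0) (?k y)} = zorn_swap ` null_threespace"
      using Aut7_bij[OF k'] by (simp add: inj_vimage_image_eq bij_is_inj Aut7_zero[OF space(1)] del: o_apply)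
    have SK: "{x. R (h x) (?k 0)} = null_threespace"
      using inj by (simp only: Aut7_zero[OF k'])
    obtain s where "s = 1 \<or> s = -1"
      "\<And>x y. R (h x) (?k y) \<longleftrightarrow> (\<exists>z. x = zorn_diag (space_left 0) (space_right 0) 1 z \<and>
                          y = zorn_diag (space_right 0) (space_left 0) s z)"
      using S.normal_form_space[OF SK SK'] by blast
    then show thesis using that(3)[OF space(1) k'] by blast
  qed
qed

end

section \<open>Families of isotropic subspaces of the imaginary part\<close>

definition bioct_polar :: "bioctonion \<Rightarrow> bioctonion \<Rightarrow> complex" where
  "bioct_polar z w = fst (fst z) * fst (fst w) + dot7 (snd (fst z)) (snd (fst w))
                   - (fst (snd z) * fst (snd w) + dot7 (snd (snd z)) (snd (snd w)))"

global_interpretation bio: nondegenerate_form bioct_scale bioct_basis bioct_polar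
proof (unfold_locales, goal_cases)
  case (4 z)
  have "fst (fst z) = 0" "fst (snd z) = 0"
    using 4[of "((1, 0), 0)"] 4[of "(0, (1, 0))"] by (simp_all add: bioct_polar_def dot7_zero)
  moreover have "snd (fst z) = 0" "snd (snd z) = 0"
    using 4[of "((0, _), 0)"] 4[of "(0, (0, _))"]
    by (auto intro!: imo.form_nondegenerate simp: bioct_polar_def dot7_zero)
  ultimately show ?case by (simp add: prod_eq_iff)
qed (simp_all add: bioct_polar_def bioct_scale_def oct_scale_def dot7_linear algebra_simps dot7_commute)

lemma bioct_polar_self: "bioct_polar z z = bioct_form z"
  by (simp add: bioct_polar_def bioct_form_def oct_norm_def)

lemma isotropic_polar:
  assumes "isotropic A" "x \<in> A" "y \<in> A"
  shows "bioct_polar x y = 0"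
proof -
  have "x + y \<in> A"
    using assms by (auto simp: isotropic_def bioct.subspace_add)
  then have "bioct_polar (x + y) (x + y) = 0" "bioct_polar x x = 0" "bioct_polar y y = 0"
    using assms by (simp_all add: isotropic_def bioct_polar_self)
  then show ?thesis
    by (simp add: bio.form_add bio.form_add_right bio.form_sym[of y x])
qed

lemma dim_bioct: "bioct.dimension = 16"
proof -
  have fin: "finite (cart_basis :: imo set)" by (rule finite_cart_basis)
  have "card oct_basis = 8"
    unfolding oct_basis_def using fin
    by (subst card_Un_disjoint) (auto simp: card_cartesian_product card_cart_basis)
  moreover have "(0 :: complex octonion) \<notin> oct_basis"
    using oct.independent_Basis oct.dependent_zero by blast
  moreover have "finite oct_basis"
    unfolding oct_basis_def using fin by simp
  ultimately have "card bioct_basis = 16"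
    unfolding bioct_basis_def by (subst card_Un_disjoint) (auto simp: card_cartesian_product)
  then show ?thesis
    by (simp add: bioct.dimension_def)
qed

definition emb :: "imo \<Rightarrow> imo \<Rightarrow> bioctonion" where
  "emb x y = ((0, x), (0, y))"

lemma emb_inject [simp]: "emb x y = emb x' y' \<longleftrightarrow> x = x' \<and> y = y'"
  by (simp add: emb_def)

lemma emb_add: "emb x y + emb x' y' = emb (x + x') (y + y')"
  and emb_scale: "bioct_scale c (emb x y) = emb (c *s x) (c *s y)"
  and emb_zero: "emb 0 0 = 0"
  and polar_emb: "bioct_polar (emb x y) (emb x' y') = dot7 x x' - dot7 y y'"
  by (simp_all add: emb_def bioct_scale_def oct_scale_def bioct_polar_def zero_prod_def)

lemma Im_Im_emb: "z \<in> Im_Im \<longleftrightarrow> (\<exists>x y. z = emb x y)"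
  by (cases z) (auto simp: Im_Im_def emb_def prod_eq_iff)

lemma subspace_Im_Im: "bioct.subspace Im_Im"
  by (auto simp: bioct.subspace_def Im_Im_def bioct_scale_def oct_scale_def)

lemma bioct_one_polar: "z \<in> Im_Im \<Longrightarrow> bioct_polar z bioct_one = 0" "bioct_polar bioct_one bioct_one = 0"
  by (auto simp: bioct_polar_def Im_Im_def bioct_one_def oct_one_def dot7_zero)

lemma bioct_one_scale_in_Im_Im: "bioct_scale c bioct_one \<in> Im_Im \<longleftrightarrow> c = 0"
  by (auto simp: Im_Im_def bioct_one_def oct_one_def bioct_scale_def oct_scale_def)

text \<open>
  Passing from \<open>L\<close> to this span adds one to all dimensions and intersection dimensions, and turns
  the seven-dimensional isotropic subspaces of the imaginary part into Lagrangian subspaces.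
\<close>

definition unit_hull :: "bioctonion set \<Rightarrow> bioctonion set" where
  "unit_hull L = bioct.span (insert bioct_one L)"

lemma mem_unit_hull:
  "bioct.subspace L \<Longrightarrow> z \<in> unit_hull L \<longleftrightarrow> (\<exists>c. z - bioct_scale c bioct_one \<in> L)"
  by (simp add: unit_hull_def bioct.span_insert bioct.span_eq_iff[THEN iffD2])

lemma dim_unit_hull:
  assumes "bioct.subspace L" "L \<subseteq> Im_Im"
  shows "bioct.dim (unit_hull L) = bioct.dim L + 1"
proof -
  have "bioct_one \<notin> L"
    using assms(2) bioct_one_scale_in_Im_Im[of 1] by auto
  then show ?thesis
    using assms(1) by (simp add: unit_hull_def bioct.dim_insert bioct.span_eq_iff[THEN iffD2])
qed

lemma unit_hull_Int:
  assumes "bioct.subspace L" "L \<subseteq> Im_Im" "bioct.subspace M" "M \<subseteq> Im_Im"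
  shows "unit_hull L \<inter> unit_hull M = unit_hull (L \<inter> M)"
proof -
  have "c = d" if "z - bioct_scale c bioct_one \<in> L" "z - bioct_scale d bioct_one \<in> M" for z c d
  proof -
    have "(z - bioct_scale c bioct_one) - (z - bioct_scale d bioct_one) \<in> Im_Im"
      using that assms by (blast intro: bioct.subspace_diff[OF subspace_Im_Im])
    then have "bioct_scale (d - c) bioct_one \<in> Im_Im"
      by (simp add: bioct.scale_left_diff_distrib)
    then show ?thesis by (simp add: bioct_one_scale_in_Im_Im)
  qed
  then show ?thesis
    using assms by (auto simp: mem_unit_hull bioct.subspace_inter) blast
qed

lemma unit_hull_Int_Im_Im:
  assumes "bioct.subspace L" "L \<subseteq> Im_Im"
  shows "unit_hull L \<inter> Im_Im = L"
proof
  show "L \<subseteq> unit_hull L \<inter> Im_Im"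
    using assms by (auto simp: unit_hull_def bioct.span_base)
  show "unit_hull L \<inter> Im_Im \<subseteq> L"
  proof
    fix z assume z: "z \<in> unit_hull L \<inter> Im_Im"
    then obtain c where c: "z - bioct_scale c bioct_one \<in> L"
      using assms by (auto simp: mem_unit_hull)
    then have "z - (z - bioct_scale c bioct_one) \<in> Im_Im"
      using z assms by (blast intro: bioct.subspace_diff[OF subspace_Im_Im])
    then have "c = 0" by (simp add: bioct_one_scale_in_Im_Im)
    then show "z \<in> L" using c by simp
  qed
qed

lemma Gr7D: "L \<in> Gr7 \<Longrightarrow> bioct.subspace L" "L \<in> Gr7 \<Longrightarrow> L \<subseteq> Im_Im" "L \<in> Gr7 \<Longrightarrow> bioct.dim L = 7"
  by (simp_all add: Gr7_def)

lemma bioct_polar_unit_hull: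
  assumes L: "bioct.subspace L" "L \<subseteq> Im_Im" "isotropic L"
    and x: "x \<in> unit_hull L" and y: "y \<in> unit_hull L"
  shows "bioct_polar x y = 0"
proof -
  obtain c d where c: "x - bioct_scale c bioct_one \<in> L" and d: "y - bioct_scale d bioct_one \<in> L"
    using x y L(1) by (auto simp: mem_unit_hull)
  define l m where lm: "l = x - bioct_scale c bioct_one" "m = y - bioct_scale d bioct_one"
  have "l \<in> L" "m \<in> L" "l \<in> Im_Im" "m \<in> Im_Im" using c d L lm by auto
  moreover have "x = l + bioct_scale c bioct_one" "y = m + bioct_scale d bioct_one"
    by (simp_all add: lm)
  ultimately show ?thesis
    using isotropic_polar[OF L(3), of l m] bioct_one_polar bio.form_sym[of bioct_one m]
    by (simp add: bio.form_add bio.form_add_right bio.form_scale bio.form_scale_right)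
qed

lemma lagrangian_unit_hull:
  assumes "L \<in> Gr7" "isotropic L"
  shows "bio.lagrangian (unit_hull L)"
proof (rule bio.lagrangian_if_half_dimension)
  show "bioct.subspace (unit_hull L)" by (simp add: unit_hull_def)
  show "2 * bioct.dim (unit_hull L) = bioct.dimension"
    using assms Gr7D[OF assms(1)] by (simp add: dim_bioct dim_unit_hull)
qed (use bioct_polar_unit_hull assms Gr7D in blast)

lemma family_parity:
  assumes L: "L \<in> Gr7" "isotropic L" and M: "M \<in> Gr7" "isotropic M" and N: "N \<in> Gr7" "isotropic N"
    and "odd (bioct.dim (L \<inter> M))"
  shows "odd (bioct.dim (L \<inter> N)) \<longleftrightarrow> odd (bioct.dim (M \<inter> N))"
proof -
  have Int: "bioct.dim (unit_hull X \<inter> unit_hull Y) = bioct.dim (X \<inter> Y) + 1" if "X \<in> Gr7" "Y \<in> Gr7" for X Y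
  proof -
    have "X \<inter> Y \<subseteq> Im_Im" using that Gr7D by blast
    then show ?thesis
      using that by (simp add: unit_hull_Int dim_unit_hull Gr7D bioct.subspace_inter)
  qed
  have "even (bioct.dim (unit_hull L \<inter> unit_hull M) + bioct.dim (unit_hull L \<inter> unit_hull N)
      + bioct.dim (unit_hull M \<inter> unit_hull N) + bioct.dim (unit_hull L))"
    using assms by (intro bio.lagrangian_parity lagrangian_unit_hull)
  then show ?thesis
    using assms by (simp add: Int dim_unit_hull Gr7D)
qed

lemma same_family_iff_odd:
  assumes "L \<in> Gr7"
  shows "same_family L M \<longleftrightarrow> odd (bioct.dim (L \<inter> M))"
proof -
  have "bioct.dim (L \<inter> M) \<le> 7"
    using bioct.dim_subset[of "L \<inter> M" L] Gr7D[OF assms] by auto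
  then show ?thesis
    by (simp add: same_family_def Gr7D[OF assms] even_diff_nat)
qed

section \<open>Imaginary subalgebras as cross-product relations\<close>

lemma isotropic_maximal:
  assumes L: "L \<in> Gr7" "isotropic L" and z: "z \<in> Im_Im" "\<And>w. w \<in> L \<Longrightarrow> bioct_polar z w = 0"
  shows "z \<in> L"
proof -
  have "z \<in> bio.perp (insert bioct_one L)"
    using z bioct_one_polar(1) by (auto simp: bio.perp_def)
  then have "z \<in> unit_hull L"
    using lagrangian_unit_hull[OF L] unfolding bio.lagrangian_def unit_hull_def bio.perp_span by simp
  then show ?thesis
    using unit_hull_Int_Im_Im Gr7D[OF L(1)] z(1) by blast
qed

text \<open>
  For isotropic \<open>L\<close> the scalar parts of the two components of a product agree, so this is what
  closure under the bioctonion product means after subtraction of a multiple of the unit.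
\<close>

definition cross_closed :: "bioctonion set \<Rightarrow> bool" where
  "cross_closed L \<longleftrightarrow> (\<forall>x y x' y'. emb x y \<in> L \<longrightarrow> emb x' y' \<in> L \<longrightarrow> emb (cross7 x x') (cross7 y y') \<in> L)"

lemma lagrangian_relation_emb:
  assumes L: "L \<in> Gr7" "isotropic L" and cc: "cross_closed L"
  shows "lagrangian_relation (\<lambda>x y. emb x y \<in> L)"
proof unfold_locales
  note sub = Gr7D(1)[OF L(1)]
  show "emb 0 0 \<in> L" using sub by (simp add: emb_zero bioct.subspace_0)
  show "emb (x + x') (y + y') \<in> L" if "emb x y \<in> L" "emb x' y' \<in> L" for x y x' y'
    using bioct.subspace_add[OF sub that] by (simp add: emb_add)
  show "emb (c *s x) (c *s y) \<in> L" if "emb x y \<in> L" for c x y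
    using bioct.subspace_scale[OF sub that] by (simp add: emb_scale)
  show "dot7 x x' = dot7 y y'" if "emb x y \<in> L" "emb x' y' \<in> L" for x y x' y'
    using isotropic_polar[OF L(2) that] by (simp add: polar_emb)
  show "emb x y \<in> L" if orth: "\<And>x' y'. emb x' y' \<in> L \<Longrightarrow> dot7 x x' = dot7 y y'" for x y
  proof (rule isotropic_maximal[OF L])
    show "bioct_polar (emb x y) w = 0" if "w \<in> L" for w
      using Gr7D(2)[OF L(1)] that orth Im_Im_emb[of w] by (force simp: polar_emb)
  qed (auto simp: Im_Im_emb)
  show "emb (cross7 x x') (cross7 y y') \<in> L" if "emb x y \<in> L" "emb x' y' \<in> L" for x y x' y'
    using cc that by (simp add: cross_closed_def)
qed

interpretation imo_bioct: finite_dimensional_vector_space_pair_1 "(*s) :: complex \<Rightarrow> imo \<Rightarrow> imo" cart_basis bioct_scale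
  by unfold_locales

interpretation bioct_endo: finite_dimensional_vector_space_pair_1 bioct_scale bioct_basis bioct_scale
  by unfold_locales

text \<open>
  The two copies of the octonions are the orthogonal complements of each other, and a Lagrangian
  subspace meets a subspace of half the dimension and its orthogonal in equal dimensions.
\<close>

lemma dim_left_kernel_eq_dim_right_kernel:
  assumes L: "L \<in> Gr7" "isotropic L"
  shows "vec.dim {x. emb x 0 \<in> L} = vec.dim {y. emb 0 y \<in> L}"
proof -
  let ?X = "{z :: bioctonion. snd z = 0}" and ?Y = "{z :: bioctonion. fst z = 0}"
  have sX: "bioct.subspace ?X" and sY: "bioct.subspace ?Y"
    by (auto simp: bioct.subspace_def bioct_scale_def oct_scale_def zero_prod_def)
  have perp: "bio.perp ?X = ?Y"
  proof
    show "?Y \<subseteq> bio.perp ?X" by (auto simp: bio.perp_def bioct_polar_def dot7_zero)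
    show "bio.perp ?X \<subseteq> ?Y"
    proof
      fix z assume z: "z \<in> bio.perp ?X"
      then have "bioct_polar z ((1, 0), 0) = 0" "\<And>y. bioct_polar z ((0, y), 0) = 0"
        by (auto simp: bio.perp_def)
      then have "fst (fst z) = 0" "snd (fst z) = 0"
        by (auto simp: bioct_polar_def dot7_zero intro!: imo.form_nondegenerate)
      then show "z \<in> ?Y" by (simp add: prod_eq_iff)
    qed
  qed
  \<comment> \<open>exchanging the two copies of the octonions identifies the two halves\<close>
  have lin: "Vector_Spaces.linear bioct_scale bioct_scale prod.swap"
    by unfold_locales (auto simp: bioct_scale_def)
  have "bioct.dim (prod.swap ` ?X) = bioct.dim ?X"
    using lin by (rule bioct_endo.dim_image_eq) (auto simp: inj_on_def)
  moreover have "prod.swap ` ?X = ?Y" by force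
  ultimately have "bioct.dim ?X = 8"
    using bio.dim_perp[OF sX] perp dim_bioct by simp
  then have *: "bioct.dim (unit_hull L \<inter> ?X) = bioct.dim (unit_hull L \<inter> ?Y)"
    using bio.dim_lagrangian_Int[OF lagrangian_unit_hull[OF L] sX] perp dim_bioct by simp
  have im: "z \<in> L \<longleftrightarrow> z \<in> unit_hull L" if "z \<in> Im_Im" for z
    using unit_hull_Int_Im_Im Gr7D[OF L(1)] that by blast
  have form0: "bioct_polar z bioct_one = 0" if "z \<in> unit_hull L" for z
    using bioct_polar_unit_hull[OF Gr7D(1,2)[OF L(1)] L(2) that] by (simp add: unit_hull_def bioct.span_base)
  have X: "unit_hull L \<inter> ?X = (\<lambda>x. emb x 0) ` {x. emb x 0 \<in> L}"
  proof (intro equalityI subsetI)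
    fix z assume z: "z \<in> unit_hull L \<inter> ?X"
    have "fst (fst z) = 0"
      using form0[of z] z by (simp add: bioct_polar_def bioct_one_def oct_one_def dot7_zero)
    then have e: "z = emb (snd (fst z)) 0" using z by (simp add: emb_def prod_eq_iff)
    then have "emb (snd (fst z)) 0 \<in> L"
      using im[of z] z Im_Im_emb by auto
    then show "z \<in> (\<lambda>x. emb x 0) ` {x. emb x 0 \<in> L}" using e by blast
  next
    fix z assume "z \<in> (\<lambda>x. emb x 0) ` {x. emb x 0 \<in> L}"
    then show "z \<in> unit_hull L \<inter> ?X"
      using im by (auto simp: Im_Im_emb) (simp add: emb_def zero_prod_def)
  qed
  have Y: "unit_hull L \<inter> ?Y = emb 0 ` {y. emb 0 y \<in> L}"
  proof (intro equalityI subsetI)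
    fix z assume z: "z \<in> unit_hull L \<inter> ?Y"
    have "fst (snd z) = 0"
      using form0[of z] z by (simp add: bioct_polar_def bioct_one_def oct_one_def dot7_zero)
    then have e: "z = emb 0 (snd (snd z))" using z by (simp add: emb_def prod_eq_iff)
    then have "emb 0 (snd (snd z)) \<in> L"
      using im[of z] z Im_Im_emb by auto
    then show "z \<in> emb 0 ` {y. emb 0 y \<in> L}" using e by blast
  next
    fix z assume "z \<in> emb 0 ` {y. emb 0 y \<in> L}"
    then show "z \<in> unit_hull L \<inter> ?Y"
      using im by (auto simp: Im_Im_emb) (simp add: emb_def zero_prod_def)
  qed
  have l1: "Vector_Spaces.linear (*s) bioct_scale (\<lambda>x. emb x 0)"
    and l2: "Vector_Spaces.linear (*s) bioct_scale (emb 0)"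
    by unfold_locales (simp_all add: emb_add emb_scale)
  have "bioct.dim ((\<lambda>x. emb x 0) ` {x. emb x 0 \<in> L}) = vec.dim {x. emb x 0 \<in> L}"
    using l1 by (rule imo_bioct.dim_image_eq) (simp add: inj_on_def)
  moreover have "bioct.dim (emb 0 ` {y. emb 0 y \<in> L}) = vec.dim {y. emb 0 y \<in> L}"
    using l2 by (rule imo_bioct.dim_image_eq) (simp add: inj_on_def)
  ultimately show ?thesis
    using * unfolding X Y by simp
qed

section \<open>Graphs of automorphisms and their degenerations\<close>

definition graph7 :: "(imo \<Rightarrow> imo) \<Rightarrow> bioctonion set" where
  "graph7 h = {emb x (h x) | x. True}"

lemma im_graph_eq_graph7: "(\<And>a x. g (a, x) = (a, h x)) \<Longrightarrow> im_graph g = graph7 h"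
  by (auto simp: im_graph_def oct_graph_def graph7_def emb_def Im_Im_def)

lemma oct_mult_one: "oct_mult oct_one x = (x :: complex octonion)" "oct_mult x oct_one = x"
  by (simp_all add: oct_mult_def oct_one_def dot7_zero cross7_zero)

lemma G2_restricts:
  assumes "g \<in> G2"
  obtains h where "h \<in> Aut7" "\<And>a x. g (a, x) = (a, h x)"
proof -
  have lin: "Vector_Spaces.linear oct_scale oct_scale g" and bij: "bij g"
    and mult: "\<And>x y. g (oct_mult x y) = oct_mult (g x) (g y)"
    using assms by (auto simp: G2_def)
  interpret g: Vector_Spaces.linear oct_scale oct_scale g by (rule lin)
  note add = g.add and scale = g.scale
  obtain w where "g w = oct_one" using bij by (metis bij_pointE)
  then have one: "g oct_one = oct_one"
    using mult[of oct_one w] by (simp add: oct_mult_one)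
  have scalar: "g (a, 0) = (a, 0)" for a
    using scale[of a oct_one] by (simp add: one oct_scale_def) (simp add: oct_one_def)
  \<comment> \<open>imaginary elements are the non-scalar elements whose square is a scalar\<close>
  have im: "fst (g (0, x)) = 0" for x
  proof (rule ccontr)
    obtain a y where g: "g (0, x) = (a, y)" by (cases "g (0, x)")
    assume "fst (g (0, x)) \<noteq> 0"
    then have "a \<noteq> 0" by (simp add: g)
    have "oct_mult (0, x) (0, x) = (- dot7 x x, 0)"
      by (simp add: oct_mult_def)
    then have "oct_mult (a, y) (a, y) = (- dot7 x x, 0)"
      using mult[of "(0, x)" "(0, x)"] by (simp add: g scalar)
    then have "(2 * a) *s y = 0"
      by (simp add: oct_mult_def vec_eq_iff)
    then have "y = 0" using \<open>a \<noteq> 0\<close> by simp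
    then have "g (0, x) = g (a, 0)" by (simp add: g scalar)
    then show False using \<open>a \<noteq> 0\<close> bij by (auto simp: bij_def inj_eq)
  qed
  define h where "h x = snd (g (0, x))" for x
  have gim: "g (0, x) = (0, h x)" for x
    using im[of x] by (simp add: h_def prod_eq_iff)
  have g: "g (a, x) = (a, h x)" for a x
    using add[of "(a, 0)" "(0, x)"] by (simp add: scalar gim)
  have "oct_mult (0, h x) (0, h y) = g (oct_mult (0, x) (0, y))" for x y
    by (simp add: mult gim)
  then have cross: "h (cross7 x y) = cross7 (h x) (h y)" and dot: "dot7 (h x) (h y) = dot7 x y" for x y
    by (simp_all add: oct_mult_def g)
  have "Vector_Spaces.linear (*s) (*s) h"
    using add[of "(0, _)" "(0, _)"] scale[of _ "(0, _)"]
    by unfold_locales (simp_all add: gim oct_scale_def)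
  moreover have "inj h"
  proof (rule injI)
    fix x y assume "h x = h y"
    then have "g (0, x) = g (0, y)" by (simp add: gim)
    then show "x = y" using bij by (simp add: bij_def inj_eq)
  qed
  ultimately have "h \<in> Aut7"
    using vec.linear_injective_imp_surjective[of h] cross dot by (simp add: Aut7_def bij_def)
  then show thesis using g by (rule that)
qed

lemma Aut7_extends:
  assumes h: "h \<in> Aut7"
  shows "(\<lambda>(a, x). (a, h x)) \<in> G2"
proof -
  let ?g = "\<lambda>(a, x). (a :: complex, h x)"
  have "Vector_Spaces.linear oct_scale oct_scale ?g"
    by unfold_locales (auto simp: oct_scale_def Aut7_add[OF h] Aut7_scale[OF h])
  moreover have "bij ?g"
    by (rule o_bij[where g = "\<lambda>(a, x). (a, inv h x)"]) (auto simp: fun_eq_iff Aut7_inv_apply[OF h])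
  moreover have "?g (oct_mult x y) = oct_mult (?g x) (?g y)" for x y
    by (auto simp: oct_mult_def Aut7_add[OF h] Aut7_scale[OF h] Aut7_cross[OF h] Aut7_dot[OF h] split: prod.split)
  ultimately show ?thesis by (simp add: G2_def)
qed

lemma im_graph_G2: "im_graph ` G2 = graph7 ` Aut7"
proof (intro equalityI subsetI)
  fix L assume "L \<in> im_graph ` G2"
  then obtain g where g: "g \<in> G2" "L = im_graph g" by blast
  obtain h where "h \<in> Aut7" "\<And>a x. g (a, x) = (a, h x)"
    using G2_restricts[OF g(1)] by blast
  then show "L \<in> graph7 ` Aut7"
    using im_graph_eq_graph7[of g h] g(2) by blast
next
  fix L assume "L \<in> graph7 ` Aut7"
  then obtain h where "h \<in> Aut7" "L = graph7 h" by blast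
  moreover have "im_graph (\<lambda>(a, x). (a, h x)) = graph7 h"
    by (rule im_graph_eq_graph7) simp
  ultimately show "L \<in> im_graph ` G2"
    using Aut7_extends by (metis imageI)
qed

lemma im_graph_id: "im_graph id = graph7 id"
  by (rule im_graph_eq_graph7) simp

text \<open>
  For nowhere vanishing scalings with equal products the range is the graph of an automorphism; the
  degenerations arise when some of them are zero.  The sign \<open>s\<close> distinguishes the two families.
\<close>

definition degen_map :: "(imo \<Rightarrow> imo) \<Rightarrow> (imo \<Rightarrow> imo) \<Rightarrow> (3 \<Rightarrow> complex) \<Rightarrow> (3 \<Rightarrow> complex) \<Rightarrow> complex \<Rightarrow> imo \<Rightarrow> bioctonion"
  where "degen_map h k l r s z = emb (h (zorn_diag l r 1 z)) (k (zorn_diag r l s z))"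

lemma zorn_diag_linear: "zorn_diag p q s (x + y) = zorn_diag p q s x + zorn_diag p q s y"
  "zorn_diag p q s (c *s x) = c *s zorn_diag p q s x"
  unfolding zorn_diag_def linear_zorn_coords
  by (simp_all add: zorn_comb_def sum_3' vec_eq_iff algebra_simps)

context
  fixes h k :: "imo \<Rightarrow> imo" and l r :: "3 \<Rightarrow> complex" and s :: complex
  assumes h: "h \<in> Aut7" and k: "k \<in> Aut7" and lr: "\<And>i. l i \<noteq> 0 \<or> r i \<noteq> 0"
begin

lemma linear_degen_map: "Vector_Spaces.linear (*s) bioct_scale (degen_map h k l r s)"
  by unfold_locales (simp_all add: degen_map_def zorn_diag_linear Aut7_add[OF h] Aut7_add[OF k]
      Aut7_scale[OF h] Aut7_scale[OF k] emb_add emb_scale)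

lemma inj_degen_map: "inj (degen_map h k l r s)"
proof (rule injI)
  fix x y assume eq: "degen_map h k l r s x = degen_map h k l r s y"
  obtain a b c where x: "x = zorn_comb zE a b c" by (rule zorn_cases)
  obtain a' b' c' where y: "y = zorn_comb zE a' b' c'" by (rule zorn_cases)
  from eq have "l i * a i = l i * a' i" "r i * a i = r i * a' i" "r i * b i = r i * b' i" "l i * b i = l i * b' i"
    "c = c'" for i
    by (auto simp: degen_map_def x y Aut7_eq_iff[OF h] Aut7_eq_iff[OF k] zorn_diag_comb zorn_tables fun_eq_iff)
  then have "a i = a' i" "b i = b' i" "c = c'" for i using lr[of i] by auto
  then show "x = y" unfolding x y by (intro zorn_comb_cong)
qed

lemma range_degen_map_Gr7: "range (degen_map h k l r s) \<in> Gr7"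
proof -
  have "bioct.dim (range (degen_map h k l r s)) = vec.dim (UNIV :: imo set)"
    using linear_degen_map by (rule imo_bioct.dim_image_eq) (simp add: inj_degen_map)
  moreover have "bioct.subspace (range (degen_map h k l r s))"
    using imo_bioct.linear_subspace_image[OF linear_degen_map] by (simp add: vec.subspace_UNIV)
  ultimately show ?thesis
    by (auto simp: Gr7_def card_cart_basis Im_Im_emb degen_map_def)
qed

lemma isotropic_degen_map:
  assumes "s * s = 1"
  shows "isotropic (range (degen_map h k l r s))"
proof -
  have "bioct_polar (degen_map h k l r s z) (degen_map h k l r s z) = 0" for z
    by (cases z rule: zorn_cases)
      (use assms in \<open>simp add: degen_map_def polar_emb Aut7_dot[OF h] Aut7_dot[OF k] zorn_diag_comb zorn_tables algebra_simps\<close>)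
  then show ?thesis
    using Gr7D(1)[OF range_degen_map_Gr7] by (auto simp: isotropic_def bioct_polar_self)
qed

end

lemma graph7_as_degen_map: "graph7 h = range (degen_map id h (\<lambda>_. 1) (\<lambda>_. 1) 1)"
  by (auto simp: graph7_def degen_map_def zorn_diag_def zorn_expansion)

lemma graph7_Gr7: "h \<in> Aut7 \<Longrightarrow> graph7 h \<in> Gr7"
  unfolding graph7_as_degen_map by (rule range_degen_map_Gr7[OF Aut7_id]) simp_all

lemma isotropic_graph7: "h \<in> Aut7 \<Longrightarrow> isotropic (graph7 h)"
  unfolding graph7_as_degen_map by (rule isotropic_degen_map[OF Aut7_id]) simp_all

abbreviation "space_degen h k s \<equiv> range (degen_map h k (space_left 0) (space_right 0) s)"
abbreviation "plane_degen h k \<equiv> range (degen_map h k (plane_left 0) (plane_right 0) 1)"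

lemma space_degen_isotropic:
  assumes "h \<in> Aut7" "k \<in> Aut7" "s = 1 \<or> s = -1"
  shows "space_degen h k s \<in> Gr7" "isotropic (space_degen h k s)"
  using assms by (auto intro!: range_degen_map_Gr7 isotropic_degen_map simp: space_left_def space_right_def split: if_splits)

text \<open>
  Together with the next lemma this describes the degeneration by the two null vectors
  \<open>x = h (dual_triple zE 2)\<close> and \<open>y = k (zE 2)\<close>: it consists of all pairs that have \<open>x\<close> and \<open>y\<close> as
  eigenvectors of multiplication, with opposite eigenvalues.
\<close>

lemma mem_space_degen:
  assumes h: "h \<in> Aut7" and k: "k \<in> Aut7"
    and eq: "cross7 a (h (dual_triple zE 2)) = m *s h (dual_triple zE 2)" "cross7 b (k (zE 2)) = - m *s k (zE 2)"
  shows "emb a b \<in> space_degen h k 1"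
proof -
  obtain a1 b1 c1 where a: "inv h a = zorn_comb zE a1 b1 c1" by (rule zorn_cases)
  obtain a2 b2 c2 where b: "inv k b = zorn_comb zE a2 b2 c2" by (rule zorn_cases)
  have a': "a = h (zorn_comb zE a1 b1 c1)" and b': "b = k (zorn_comb zE a2 b2 c2)"
    by (simp_all add: Aut7_inv_apply h k flip: a b)
  have "h (cross7 (zorn_comb zE a1 b1 c1) (dual_triple zE 2)) = h (m *s dual_triple zE 2)"
    "k (cross7 (zorn_comb zE a2 b2 c2) (zE 2)) = k (- m *s zE 2)"
    using eq by (simp_all only: a' b' Aut7_cross h k Aut7_scale)
  then have "cross7 (zorn_comb zE a1 b1 c1) (dual_triple zE 2) = m *s dual_triple zE 2"
    "cross7 (zorn_comb zE a2 b2 c2) (zE 2) = - m *s zE 2"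
    by (simp_all only: Aut7_eq_iff h k)
  then have "dot7 (cross7 (zorn_comb zE a1 b1 c1) (dual_triple zE 2)) w = m * dot7 (dual_triple zE 2) w"
    "dot7 (cross7 (zorn_comb zE a2 b2 c2) (zE 2)) w = - m * dot7 (zE 2) w" for w
    by (simp_all only: dot7_scale)
  note this[unfolded zorn_basis_as_comb(1,2)[OF null_triple_zE, of 2] zorn_tables(6)]
  note * = this[of "zE 0"] this[of "zE 1"] this[of "zE 2"]
    this[of "dual_triple zE 0"] this[of "dual_triple zE 1"] this[of "dual_triple zE 2"] this[of "triple_axis zE"]
  have "b1 0 = 0" "b1 1 = 0" "a1 2 = 0" "a2 0 = 0" "a2 1 = 0" "b2 2 = 0"
    and cc: "- (\<i> * c1) = m" "\<i> * c2 = - m"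
    using * by (simp_all add: zorn_tables numerals_3 sum_3')
  moreover have "c1 = \<i> * (- (\<i> * c1))" "c2 = - (\<i> * (\<i> * c2))" by simp_all
  then have "c1 = \<i> * m" "c2 = \<i> * m" unfolding cc by simp_all
  ultimately have coords: "b1 0 = 0" "b1 1 = 0" "a1 2 = 0" "a2 0 = 0" "a2 1 = 0" "b2 2 = 0" "c1 = \<i> * m" "c2 = \<i> * m"
    by blast+
  let ?z = "zorn_comb zE (\<lambda>i. if i = 2 then a2 i else a1 i) (\<lambda>i. if i = 2 then b1 i else b2 i) (\<i> * m)"
  have "zorn_comb zE a1 b1 c1 = zorn_diag (space_left 0) (space_right 0) 1 ?z"
    "zorn_comb zE a2 b2 c2 = zorn_diag (space_right 0) (space_left 0) 1 ?z"
    unfolding zorn_diag_comb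
    by (simp_all add: coords zorn_comb_def sum_3' space_left_def space_right_def)
  then have "emb a b = degen_map h k (space_left 0) (space_right 0) 1 ?z"
    by (simp add: degen_map_def a' b')
  then show ?thesis by blast
qed


lemma space_degen_eigen:
  assumes h: "h \<in> Aut7" and k: "k \<in> Aut7" and mem: "emb a b \<in> space_degen h k 1"
  obtains m where "cross7 a (h (dual_triple zE 2)) = m *s h (dual_triple zE 2)"
    "cross7 b (k (zE 2)) = - m *s k (zE 2)"
proof -
  obtain z where "emb a b = degen_map h k (space_left 0) (space_right 0) 1 z"
    using mem by blast
  moreover obtain a' b' c where "z = zorn_comb zE a' b' c" by (rule zorn_cases)
  ultimately have a: "a = h (zorn_comb zE (\<lambda>i. space_left 0 i * a' i) (\<lambda>i. space_right 0 i * b' i) c)"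
    and b: "b = k (zorn_comb zE (\<lambda>i. space_right 0 i * a' i) (\<lambda>i. space_left 0 i * b' i) c)"
    by (simp_all add: degen_map_def zorn_diag_comb)
  have "cross7 (zorn_comb zE (\<lambda>i. space_left 0 i * a' i) (\<lambda>i. space_right 0 i * b' i) c) (dual_triple zE 2)
      = zorn_comb zE (\<lambda>_. 0) (\<lambda>i. if i = 2 then - \<i> * c else 0) 0"
    "cross7 (zorn_comb zE (\<lambda>i. space_right 0 i * a' i) (\<lambda>i. space_left 0 i * b' i) c) (zE 2)
      = zorn_comb zE (\<lambda>i. if i = 2 then \<i> * c else 0) (\<lambda>_. 0) 0"
    unfolding zorn_basis_as_comb(1,2)[OF null_triple_zE, of 2] zorn_tables fun_eq_iff forall_3'
    by (simp_all add: numerals_3 sum_3' space_left_def space_right_def)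
  moreover have "zorn_comb zE (\<lambda>_. 0) (\<lambda>i. if i = 2 then - \<i> * c else 0) 0 = (- \<i> * c) *s dual_triple zE 2"
    "zorn_comb zE (\<lambda>i. if i = 2 then \<i> * c else 0) (\<lambda>_. 0) 0 = (\<i> * c) *s zE 2"
    by (simp_all add: zorn_comb_def sum_3')
  ultimately have "cross7 a (h (dual_triple zE 2)) = (- \<i> * c) *s h (dual_triple zE 2)"
    "cross7 b (k (zE 2)) = - (- \<i> * c) *s k (zE 2)"
    unfolding a b by (simp_all only: Aut7_scale[OF h] Aut7_scale[OF k] minus_mult_left minus_minus
        flip: Aut7_cross[OF h] Aut7_cross[OF k])
  then show thesis by (rule that)
qed

lemma dim_bioct_line: "z \<noteq> 0 \<Longrightarrow> bioct.dim (range (\<lambda>c. bioct_scale c z)) = 1"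
  using bioct.dim_span[of "{z}"] by (simp add: bioct.span_singleton)

text \<open>
  With \<open>z\<close> the preimage of \<open>y\<close> under \<open>g\<close>, the intersection consists of the \<open>a\<close> that have \<open>x\<close> and \<open>z\<close>
  as eigenvectors with opposite eigenvalues.  The product \<open>x \<times> z\<close> is one of these, and its
  eigenvalues are nonzero when \<open>x\<close> and \<open>z\<close> are not orthogonal.
\<close>

lemma graph7_meets_space_degen:
  assumes g: "g \<in> Aut7" and h: "h \<in> Aut7" and k: "k \<in> Aut7"
    and nz: "dot7 (g (h (dual_triple zE 2))) (k (zE 2)) \<noteq> 0"
  shows "bioct.dim (graph7 g \<inter> space_degen h k 1) = 1"
proof -
  let ?x = "h (dual_triple zE 2)" and ?z = "inv g (k (zE 2))"
  have gz: "g ?z = k (zE 2)" by (simp add: Aut7_inv_apply g)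
  have xz: "dot7 ?x ?z \<noteq> 0" using nz Aut7_dot[OF g, of ?x ?z] by (simp add: gz)
  have xx: "dot7 ?x ?x = 0" and zz: "dot7 ?z ?z = 0"
    using Aut7_dot[OF g, of ?z ?z]
    by (simp_all add: gz Aut7_dot h k triple_ff[OF null_triple_zE] triple_ee[OF null_triple_zE])
  let ?w = "cross7 ?x ?z"
  have wx: "cross7 ?w ?x = - dot7 ?x ?z *s ?x"
    using cross7_cross7_same[of ?x ?z] xx by (simp add: cross7_skew[of ?w ?x])
  have wz: "cross7 ?w ?z = dot7 ?x ?z *s ?z"
    using cross7_cross7_same[of ?z ?x] zz cross7_skew[of ?x ?z] cross7_skew[of ?w ?z]
    by (simp add: cross7_linear dot7_commute[of ?z ?x])
  have wz': "cross7 (g ?w) (k (zE 2)) = - (- dot7 ?x ?z) *s k (zE 2)"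
    using arg_cong[OF wz, of g] by (simp add: Aut7_cross[OF g] Aut7_scale[OF g] gz)
  have "?w \<noteq> 0"
  proof
    assume "?w = 0"
    then have "- dot7 ?x ?z *s ?x = 0" using wx by (simp add: cross7_zero)
    then have "?x = 0" using xz by simp
    then show False using xz by (simp add: dot7_zero)
  qed
  \<comment> \<open>modulo \<open>x \<times> z\<close>, an element of the intersection annihilates \<open>x\<close> and \<open>z\<close>\<close>
  have zero: "a = 0" if ax: "cross7 a ?x = 0" and az: "cross7 a ?z = 0" for a
  proof -
    have o: "dot7 a y = 0" if "cross7 a y = 0" "dot7 a a = 0 \<or> y \<noteq> 0" "dot7 y y = 0" for y
    proof -
      have "cross7 y a = 0" using that(1) cross7_skew[of y a] by simp
      then have "dot7 y a *s y = 0" "dot7 y a *s y = dot7 y y *s a"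
        using cross7_cross7_same[of y a] that(3) by (simp_all add: cross7_zero)
      moreover have "y \<noteq> 0 \<or> dot7 a y = 0" by (auto simp: dot7_zero)
      ultimately show ?thesis by (auto simp: dot7_commute)
    qed
    have "?x \<noteq> 0" "?z \<noteq> 0" using xz by (auto simp: dot7_zero)
    then have "dot7 a ?x = 0" "dot7 a ?z = 0" using o[OF ax] o[OF az] xx zz by blast+
    moreover have "cross7 ?x a = 0" "cross7 ?z a = 0"
      using ax az cross7_skew[of _ a] by simp_all
    ultimately have "(2 * dot7 ?x ?z) *s a = 0"
      using cross7_cross7_polar[of ?x ?z a] by (simp add: cross7_zero dot7_commute[of _ a])
    then show ?thesis using xz by simp
  qed
  have "graph7 g \<inter> space_degen h k 1 = range (\<lambda>c. bioct_scale c (emb ?w (g ?w)))"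
  proof
    have "emb ?w (g ?w) \<in> space_degen h k 1"
      by (rule mem_space_degen[OF h k wx wz'])
    moreover have "emb ?w (g ?w) \<in> graph7 g" by (auto simp: graph7_def)
    moreover have "bioct.subspace (graph7 g)" "bioct.subspace (space_degen h k 1)"
      using Gr7D(1) graph7_Gr7[OF g] space_degen_isotropic(1)[OF h k, of 1] by blast+
    ultimately have "bioct_scale c (emb ?w (g ?w)) \<in> graph7 g \<inter> space_degen h k 1" for c
      by (meson IntI bioct.subspace_scale)
    then show "range (\<lambda>c. bioct_scale c (emb ?w (g ?w))) \<subseteq> graph7 g \<inter> space_degen h k 1"
      by blast
    show "graph7 g \<inter> space_degen h k 1 \<subseteq> range (\<lambda>c. bioct_scale c (emb ?w (g ?w)))"
    proof
      fix p assume p: "p \<in> graph7 g \<inter> space_degen h k 1"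
      then obtain a where a: "p = emb a (g a)" by (auto simp: graph7_def)
      obtain m where m: "cross7 a ?x = m *s ?x" "cross7 (g a) (k (zE 2)) = - m *s k (zE 2)"
        using space_degen_eigen[OF h k, of a "g a"] p a by auto
      have "g (cross7 a ?z) = g (- m *s ?z)"
        using m(2) by (simp only: Aut7_cross[OF g] Aut7_scale[OF g] gz)
      then have m2: "cross7 a ?z = - m *s ?z" by (simp only: Aut7_eq_iff[OF g])
      define c where "c = - m / dot7 ?x ?z"
      have c: "c * dot7 ?x ?z = - m" using xz by (simp add: c_def)
      have "cross7 (a - c *s ?w) ?x = 0"
        unfolding cross7_linear m(1) wx vector_smult_assoc using c by (simp add: vec_eq_iff)
      moreover have "cross7 (a - c *s ?w) ?z = 0"
        unfolding cross7_linear m2 wz vector_smult_assoc using c by (simp add: vec_eq_iff)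
      ultimately have "a - c *s ?w = 0" by (rule zero)
      then have "a = c *s ?w" by simp
      then show "p \<in> range (\<lambda>c. bioct_scale c (emb ?w (g ?w)))"
        by (auto simp: a emb_scale Aut7_scale[OF g])
    qed
  qed
  moreover have "emb ?w (g ?w) \<noteq> 0" using \<open>?w \<noteq> 0\<close> by (simp flip: emb_zero)
  ultimately show ?thesis by (simp add: dim_bioct_line)
qed

lemma null_vector_not_orthogonal:
  assumes z: "z \<noteq> 0"
  obtains x where "dot7 x x = 0" "dot7 x (zE 2) \<noteq> 0" "dot7 x z \<noteq> 0"
proof -
  obtain a b c where c: "z = zorn_comb zE a b c" by (rule zorn_cases)
  let ?f = "\<lambda>i :: 3. if i = 2 then 1 else 0 :: complex"
  \<comment> \<open>null vectors that pair with \<open>zE 2\<close> to \<open>2\<close> and whose span is everything\<close>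
  define X where "X = (\<lambda>p q t. zorn_comb zE (\<lambda>i. if i = 0 then p else if i = 1 then q else - (t ^ 2) / 4) ?f t)"
  define Y where "Y = (\<lambda>p q. zorn_comb zE (\<lambda>_. 0) (\<lambda>i. if i = 0 then p else if i = 1 then q else 1) 0)"
  have null: "dot7 (X p q t) (X p q t) = 0" "dot7 (Y p q) (Y p q) = 0"
    "dot7 (X p q t) (zE 2) \<noteq> 0" "dot7 (Y p q) (zE 2) \<noteq> 0" for p q t
    by (simp_all add: X_def Y_def zorn_tables sum_3' power2_eq_square)
  have "\<exists>x. dot7 x x = 0 \<and> dot7 x (zE 2) \<noteq> 0 \<and> dot7 x z \<noteq> 0"
  proof (rule ccontr)
    assume "\<not> ?thesis"
    then have "dot7 (X p q t) z = 0" "dot7 (Y p q) z = 0" for p q t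
      using null by blast+
    note this(1)[of 0 0 0] this(1)[of 1 0 0] this(1)[of 0 1 0] this(1)[of 0 0 1] this(1)[of 0 0 "-1"]
      this(2)[of 1 0] this(2)[of 0 1]
    then have e: "a 2 = 0" "b 0 = 0" "b 1 = 0" "c * 2 = b 2" "- (b 2 / 2) = c" "a 0 = 0" "a 1 = 0"
      by (simp_all add: X_def Y_def c zorn_tables sum_3')
    have "c = - (c * 2 / 2)" unfolding e(4) e(5) ..
    then have "c = 0" by simp
    moreover from this have "b 2 = 0" using e(4) by simp
    ultimately have "z = 0"
      using e by (simp add: c zorn_comb_eq_0_iff forall_3')
    then show False using z by simp
  qed
  then show thesis using that by blast
qed

text \<open>
  One degeneration with three-dimensional kernels meets both graphs in a line: it is attached to
  \<open>zE 2\<close> and a null vector \<open>x\<close>, and the condition is that \<open>x\<close> is orthogonal neither to \<open>zE 2\<close> nor to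
  its preimage under \<open>g\<close>.
\<close>

theorem graph7_same_family:
  assumes g: "g \<in> Aut7"
  shows "odd (bioct.dim (graph7 g \<inter> graph7 id))"
proof -
  have "inv g (zE 2) \<noteq> 0"
    using Aut7_eq_0_iff[OF Aut7_inv[OF g], of "zE 2"] triple_ef[OF null_triple_zE, of 2 2]
    by (auto simp: dot7_zero)
  then obtain x where x: "dot7 x x = 0" "dot7 x (zE 2) \<noteq> 0" "dot7 x (inv g (zE 2)) \<noteq> 0"
    by (rule null_vector_not_orthogonal)
  then have "x \<noteq> 0" by (auto simp: dot7_zero)
  then obtain h0 where h0: "h0 \<in> Aut7" "h0 (zE 0) = x"
    using Aut7_transitive_on_null_vectors x(1) by metis
  obtain r where r: "r \<in> Aut7" "r (zE 0) = zE 1" "r (zE 1) = zE 2" "r (zE 2) = zE 0"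
    using Aut7_from_null_vectors[of "zE 1" "zE 2" "zE 0"] triple_ee[OF null_triple_zE]
      triple_volume[OF null_triple_zE, of 0] by (auto simp: dot7_commute)
  \<comment> \<open>the swap and the rotation \<open>r\<close> take the dual of \<open>zE 2\<close> to \<open>zE 0\<close>\<close>
  let ?h = "h0 \<circ> (r \<circ> zorn_swap)"
  have h: "?h \<in> Aut7" by (intro Aut7_comp h0 r zorn_swap_Aut7)
  have "zorn_swap (dual_triple zE 2) = zE 2"
    using zorn_swap_comb[of "\<lambda>_. 0" "\<lambda>j. if j = 2 then 1 else 0" 0]
    by (simp flip: zorn_basis_as_comb[OF null_triple_zE])
  then have hx: "?h (dual_triple zE 2) = x" by (simp add: r h0)
  have "dot7 (g x) (zE 2) \<noteq> 0"
    using x(3) Aut7_dot[OF g, of x "inv g (zE 2)"] by (simp add: Aut7_inv_apply g)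
  then have "bioct.dim (graph7 g \<inter> space_degen ?h id 1) = 1"
    by (intro graph7_meets_space_degen g h Aut7_id) (simp only: hx id_apply not_False_eq_True)
  moreover have "bioct.dim (graph7 id \<inter> space_degen ?h id 1) = 1"
    using x(2) by (intro graph7_meets_space_degen h Aut7_id) (simp only: hx id_apply not_False_eq_True)
  moreover have "space_degen ?h id 1 \<in> Gr7" "isotropic (space_degen ?h id 1)"
    using h Aut7_id by (simp_all only: space_degen_isotropic simp_thms)
  ultimately show ?thesis
    using family_parity[of "space_degen ?h id 1", OF _ _ graph7_Gr7[OF g] isotropic_graph7[OF g]
        graph7_Gr7[OF Aut7_id] isotropic_graph7[OF Aut7_id]]
    by (simp add: Int_commute)
qed

lemma graph7_Int_odd:
  assumes "g \<in> Aut7" "h \<in> Aut7"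
  shows "odd (bioct.dim (graph7 g \<inter> graph7 h))"
  using family_parity[OF graph7_Gr7 isotropic_graph7 graph7_Gr7 isotropic_graph7 graph7_Gr7 isotropic_graph7,
      of id g h]
    graph7_same_family[OF assms(1)] graph7_same_family[OF assms(2)] assms Aut7_id by (simp add: Int_commute)

section \<open>Degenerations are limits of graphs\<close>

lemma zorn_comb_continuous:
  assumes "\<And>k. continuous_on UNIV (a k)" "\<And>k. continuous_on UNIV (b k)"
  shows "continuous_on UNIV (\<lambda>t :: complex. zorn_comb zE (\<lambda>k. a k t) (\<lambda>k. b k t) c)"
  unfolding zorn_comb_def vector_scalar_mult_def
  by (intro continuous_intros assms)

lemma scaleR_imo: "r *\<^sub>R x = complex_of_real r *s (x :: imo)"
  by (simp add: vec_eq_iff vector_scaleR_component) (simp add: scaleR_conv_of_real)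

lemma scaleR_bioct: "r *\<^sub>R z = bioct_scale (complex_of_real r) z"
  by (simp add: prod_eq_iff bioct_scale_def oct_scale_def scaleR_imo scaleR_conv_of_real)

lemma Aut7_continuous: "h \<in> Aut7 \<Longrightarrow> continuous_on S h"
  by (intro linear_continuous_on) 
    (auto intro!: linearI simp: linear_conv_bounded_linear[symmetric] Aut7_add Aut7_scale scaleR_imo)

lemma functional_continuous:
  assumes "Vector_Spaces.linear bioct_scale (*) \<phi>"
  shows "continuous_on S (\<phi> :: bioctonion \<Rightarrow> complex)"
proof -
  interpret Vector_Spaces.linear bioct_scale "(*)" \<phi> by fact
  have "linear \<phi>"
    by (rule linearI) (simp_all only: add scale scaleR_bioct scaleR_conv_of_real)
  then show ?thesis
    by (simp add: linear_continuous_on linear_conv_bounded_linear)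
qed

definition degen_frame :: "(imo \<Rightarrow> imo) \<Rightarrow> (imo \<Rightarrow> imo) \<Rightarrow> (3 \<Rightarrow> complex) \<Rightarrow> (3 \<Rightarrow> complex) \<Rightarrow> 7 \<Rightarrow> bioctonion" where
  "degen_frame h k l r i = degen_map h k l r 1 (axis i 1)"

lemma degen_frame_continuous:
  assumes h: "h \<in> Aut7" and k: "k \<in> Aut7"
    and l: "\<And>j. continuous_on UNIV (\<lambda>t. l t j)" and r: "\<And>j. continuous_on UNIV (\<lambda>t. r t j)"
  shows "continuous_on UNIV (\<lambda>t :: complex. degen_frame h k (l t) (r t) i)"
proof -
  have "continuous_on UNIV (\<lambda>t. zorn_diag (l t) (r t) 1 x)" "continuous_on UNIV (\<lambda>t. zorn_diag (r t) (l t) 1 x)" for x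
    unfolding zorn_diag_def by (intro zorn_comb_continuous continuous_intros l r)+
  then have "continuous_on UNIV (\<lambda>t. h (zorn_diag (l t) (r t) 1 x))" "continuous_on UNIV (\<lambda>t. k (zorn_diag (r t) (l t) 1 x))" for x
    using continuous_on_compose2[OF Aut7_continuous[OF h]] continuous_on_compose2[OF Aut7_continuous[OF k]] by blast+
  then show ?thesis
    unfolding degen_frame_def degen_map_def emb_def by (intro continuous_intros)
qed

lemma poly_fun_continuous:
  assumes "poly_fun p" "\<And>i. continuous_on UNIV (\<lambda>t :: complex. v t i)"
  shows "continuous_on UNIV (\<lambda>t. p (v t))"
  using assms
proof (induction rule: poly_fun.induct)
  case (poly_fun_coord \<phi> i)
  then show ?case
    using continuous_on_compose2[OF functional_continuous[OF poly_fun_coord(1), of UNIV] poly_fun_coord(2)] by blast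
qed (auto intro: continuous_intros)

lemma degen_frame_frames:
  assumes h: "h \<in> Aut7" and k: "k \<in> Aut7" and lr: "\<And>i. l i \<noteq> 0 \<or> r i \<noteq> 0"
  shows "degen_frame h k l r \<in> frames" "bioct.span (range (degen_frame h k l r)) = range (degen_map h k l r 1)"
proof -
  have lin: "Vector_Spaces.linear (*s) bioct_scale (degen_map h k l r 1)"
    by (rule linear_degen_map[OF h k lr])
  have inj: "inj (degen_map h k l r 1)"
    by (rule inj_degen_map[OF h k lr])
  have rng: "range (degen_frame h k l r) = degen_map h k l r 1 ` cart_basis"
    by (auto simp: degen_frame_def cart_basis_def)
  have "bioct.independent (range (degen_frame h k l r))"
    unfolding rng using lin independent_cart_basis
    by (rule imo_bioct.linear_independent_injective_image) (use inj in \<open>simp add: inj_on_def\<close>)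
  moreover have "inj (degen_frame h k l r)"
    unfolding degen_frame_def using injD[OF inj] by (auto intro!: injI simp: axis_eq_axis dest!: injD[OF inj])
  ultimately show "degen_frame h k l r \<in> frames"
    by (auto simp: frames_def degen_frame_def degen_map_def Im_Im_emb)
  show "bioct.span (range (degen_frame h k l r)) = range (degen_map h k l r 1)"
    unfolding rng using imo_bioct.linear_span_image[OF lin, of cart_basis] by simp
qed

text \<open>
  The quotient of the two scalings is the diagonal automorphism that sends each \<open>zE i\<close> to
  \<open>(r i / l i) zE i\<close>; equality of the two products says that the scaled triple is again a null
  triple.
\<close>

lemma degen_map_generic:
  assumes h: "h \<in> Aut7" and k: "k \<in> Aut7" and nz: "\<And>i. l i \<noteq> 0" "\<And>i. r i \<noteq> 0"
    and bal: "l 0 * l 1 * l 2 = r 0 * r 1 * r 2"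
  obtains g where "g \<in> Aut7" "range (degen_map h k l r 1) = graph7 g"
proof -
  define e where "e i = (r i / l i) *s zE i" for i
  have vol: "(r 0 / l 0) * (r 1 / l 1) * (r 2 / l 2) = 1"
    using bal nz by (simp add: field_simps)
  have "dot7 (cross7 (e 0) (e 1)) (e 2)
      = ((r 0 / l 0) * (r 1 / l 1) * (r 2 / l 2)) * dot7 (cross7 (zE 0) (zE 1)) (zE 2)"
    by (simp add: e_def dot7_linear cross7_linear mult_ac)
  then have "dot7 (cross7 (e 0) (e 1)) (e 2) = 4"
    unfolding vol using null_triple_zE by (simp add: null_triple_def)
  then have "null_triple e"
    using null_triple_zE by (simp add: null_triple_def e_def dot7_linear)
  then obtain g where g: "g \<in> Aut7" "\<And>i. g (zE i) = e i" "\<And>a b c. g (zorn_comb zE a b c) = zorn_comb e a b c"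
    using Aut7_from_null_triple by metis
  have dual: "dual_triple e i = (l i / r i) *s dual_triple zE i" for i
    using exhaust_3'[of i] bal nz
    by (auto simp: dual_triple_def e_def cross7_linear numerals_3 field_simps)
  have ax: "triple_axis e = triple_axis zE"
    using nz by (simp add: triple_axis_def dual e_def cross7_linear)
  have diag: "g (zorn_diag l r 1 z) = zorn_diag r l 1 z" for z
    by (cases z rule: zorn_cases)
      (use nz in \<open>simp add: zorn_diag_comb g(3), simp add: zorn_comb_def dual ax e_def mult.commute\<close>)
  let ?g = "k \<circ> g \<circ> inv h"
  have g': "?g \<in> Aut7" by (intro Aut7_comp Aut7_inv g h k)
  have "degen_map h k l r 1 z = emb (h (zorn_diag l r 1 z)) (?g (h (zorn_diag l r 1 z)))" for z
    by (simp add: degen_map_def diag Aut7_inv_apply[OF h])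
  then have sub: "range (degen_map h k l r 1) \<subseteq> graph7 ?g"
    by (auto simp: graph7_def)
  have G: "range (degen_map h k l r 1) \<in> Gr7" "graph7 ?g \<in> Gr7"
    using range_degen_map_Gr7[OF h k, of l r 1] nz graph7_Gr7[OF g'] by blast+
  then have "range (degen_map h k l r 1) = graph7 ?g"
    using sub bioct.subspace_dim_equal[of "range (degen_map h k l r 1)" "graph7 ?g"] Gr7D by simp
  with g' show thesis by (rule that)
qed

text \<open>
  A polynomial that vanishes on the bases of graphs vanishes along the punctured curve, hence by
  continuity at its centre.
\<close>

lemma degeneration_in_closure:
  fixes l r :: "complex \<Rightarrow> 3 \<Rightarrow> complex"
  assumes h: "h \<in> Aut7" and k: "k \<in> Aut7"
    and l: "\<And>j. continuous_on UNIV (\<lambda>t. l t j)" and r: "\<And>j. continuous_on UNIV (\<lambda>t. r t j)"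
    and nz: "\<And>t i. t \<noteq> 0 \<Longrightarrow> l t i \<noteq> 0" "\<And>t i. t \<noteq> 0 \<Longrightarrow> r t i \<noteq> 0"
    and bal: "\<And>t. l t 0 * l t 1 * l t 2 = r t 0 * r t 1 * r t 2"
    and lr: "\<And>i. l 0 i \<noteq> 0 \<or> r 0 i \<noteq> 0"
  shows "range (degen_map h k (l 0) (r 0) 1) \<in> double_Cayley_Grassmannian"
  unfolding double_Cayley_Grassmannian_def zariski_closure_def
proof safe
  fix Z assume Z: "zariski_closed Z" "im_graph ` G2 \<subseteq> Z"
  then obtain P where "\<forall>p\<in>P. poly_fun p"
    "\<forall>v\<in>frames. bioct.span (range v) \<in> Z \<longleftrightarrow> (\<forall>p\<in>P. p v = 0)"
    unfolding zariski_closed_def by blast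
  then have P: "\<And>p. p \<in> P \<Longrightarrow> poly_fun p"
    "\<And>v. v \<in> frames \<Longrightarrow> bioct.span (range v) \<in> Z \<longleftrightarrow> (\<forall>p\<in>P. p v = 0)"
    by blast+
  let ?v = "\<lambda>t. degen_frame h k (l t) (r t)"
  have lr': "l t i \<noteq> 0 \<or> r t i \<noteq> 0" for t i
    using nz lr by (cases "t = 0") auto
  have fr: "?v t \<in> frames" "bioct.span (range (?v t)) = range (degen_map h k (l t) (r t) 1)" for t
    by (rule degen_frame_frames[OF h k lr'])+
  have "p (?v 0) = 0" if p: "p \<in> P" for p
  proof -
    have gen: "p (?v t) = 0" if "t \<noteq> 0" for t
    proof -
      obtain g where "g \<in> Aut7" "range (degen_map h k (l t) (r t) 1) = graph7 g"
        using degen_map_generic[OF h k nz(1)[OF \<open>t \<noteq> 0\<close>] nz(2)[OF \<open>t \<noteq> 0\<close>] bal] by blast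
      then have "bioct.span (range (?v t)) \<in> Z"
        using Z(2) fr(2)[of t] by (auto simp: im_graph_G2)
      then show ?thesis using P(2)[OF fr(1)] p by blast
    qed
    have "continuous_on UNIV (\<lambda>t. p (?v t))"
      by (intro poly_fun_continuous P(1)[OF p] degen_frame_continuous h k l r)
    then have "((\<lambda>t. p (?v t)) \<longlongrightarrow> p (?v 0)) (at 0)"
      by (simp add: continuous_on_def)
    moreover have "((\<lambda>t. p (?v t)) \<longlongrightarrow> 0) (at 0)"
      by (rule tendsto_eventually) (auto simp: eventually_at_filter gen)
    ultimately show ?thesis
      using tendsto_unique[of "at (0 :: complex)"] by (simp add: trivial_limit_at)
  qed
  then have "bioct.span (range (?v 0)) \<in> Z"
    using P(2)[OF fr(1)] by blast
  then show "range (degen_map h k (l 0) (r 0) 1) \<in> Z"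
    by (simp add: fr(2))
qed

lemma plane_degen_in_closure:
  assumes "h \<in> Aut7" "k \<in> Aut7"
  shows "plane_degen h k \<in> double_Cayley_Grassmannian"
proof (rule degeneration_in_closure[OF assms])
  show "continuous_on UNIV (\<lambda>t. plane_left t j)" "continuous_on UNIV (\<lambda>t. plane_right t j)" for j
    by (cases "j = 1"; cases "j = 0"; simp add: plane_left_def plane_right_def)+
qed (auto simp: plane_left_def plane_right_def split: if_splits)

lemma space_degen_in_closure:
  assumes "h \<in> Aut7" "k \<in> Aut7"
  shows "space_degen h k 1 \<in> double_Cayley_Grassmannian"
proof (rule degeneration_in_closure[OF assms])
  show "continuous_on UNIV (\<lambda>t. space_left t j)" "continuous_on UNIV (\<lambda>t. space_right t j)" for j
    by (cases "j = 2"; simp add: space_left_def space_right_def continuous_intros)+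
qed (auto simp: space_left_def space_right_def power2_eq_square split: if_splits)

section \<open>Polynomial equations for the double Cayley Grassmannian\<close>

lemma poly_fun_uminus: "poly_fun p \<Longrightarrow> poly_fun (\<lambda>v. - p v)"
  using poly_fun_mult[OF poly_fun_const[of "-1"]] by simp

lemma poly_fun_diff: "poly_fun p \<Longrightarrow> poly_fun q \<Longrightarrow> poly_fun (\<lambda>v. p v - q v)"
  using poly_fun_add[OF _ poly_fun_uminus] by simp

lemma poly_fun_sum: "(\<And>i. i \<in> I \<Longrightarrow> poly_fun (p i)) \<Longrightarrow> poly_fun (\<lambda>v. \<Sum>i\<in>I. p i v)"
  by (induction I rule: infinite_finite_induct) (auto intro: poly_fun_const poly_fun_add)

lemma poly_fun_prod: "(\<And>i. i \<in> I \<Longrightarrow> poly_fun (p i)) \<Longrightarrow> poly_fun (\<lambda>v. \<Prod>i\<in>I. p i v)"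
  by (induction I rule: infinite_finite_induct) (auto intro: poly_fun_const poly_fun_mult)

lemma poly_fun_det:
  assumes "\<And>i j. poly_fun (\<lambda>v. A v $ i $ j)"
  shows "poly_fun (\<lambda>v. det (A v :: complex ^ 7 ^ 7))"
  unfolding det_def
  by (intro poly_fun_sum poly_fun_mult poly_fun_const poly_fun_prod assms)

definition left_im :: "bioctonion \<Rightarrow> imo" where "left_im z = snd (fst z)"
definition right_im :: "bioctonion \<Rightarrow> imo" where "right_im z = snd (snd z)"

lemma left_im_linear: "left_im (z + w) = left_im z + left_im w" "left_im (bioct_scale c z) = c *s left_im z"
  and right_im_linear: "right_im (z + w) = right_im z + right_im w" "right_im (bioct_scale c z) = c *s right_im z"
  by (simp_all add: left_im_def right_im_def bioct_scale_def oct_scale_def)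

lemma emb_im [simp]: "left_im (emb x y) = x" "right_im (emb x y) = y"
  by (simp_all add: left_im_def right_im_def emb_def)

lemma poly_fun_Aut7_left: "h \<in> Aut7 \<Longrightarrow> poly_fun (\<lambda>v. h (left_im (v i)) $ j)"
  by (rule poly_fun_coord) (unfold_locales; simp add: left_im_linear Aut7_add Aut7_scale distrib_left)

lemma poly_fun_left: "poly_fun (\<lambda>v. left_im (v i) $ j)"
  using poly_fun_Aut7_left[OF Aut7_id] by simp

lemma poly_fun_right: "poly_fun (\<lambda>v. right_im (v i) $ j)"
  by (rule poly_fun_coord) (unfold_locales; simp add: right_im_linear distrib_left)

lemma poly_fun_dot7:
  "(\<And>j. poly_fun (\<lambda>v. f v $ j)) \<Longrightarrow> (\<And>j. poly_fun (\<lambda>v. g v $ j)) \<Longrightarrow> poly_fun (\<lambda>v. dot7 (f v) (g v))"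
  unfolding dot7_def by (intro poly_fun_sum poly_fun_mult)

lemma poly_fun_cross7:
  "(\<And>j. poly_fun (\<lambda>v. f v $ j)) \<Longrightarrow> (\<And>j. poly_fun (\<lambda>v. g v $ j)) \<Longrightarrow> poly_fun (\<lambda>v. cross7 (f v) (g v) $ j)"
  unfolding cross7_def vec_lambda_beta by (intro poly_fun_add poly_fun_diff poly_fun_mult)

definition im_polar :: "bioctonion \<Rightarrow> bioctonion \<Rightarrow> complex" where
  "im_polar z w = dot7 (left_im z) (left_im w) - dot7 (right_im z) (right_im w)"

text \<open>
  The difference of the two associative three-forms \<open>(x \<times> y) \<cdot> z\<close>.
\<close>

definition im_triple :: "bioctonion \<Rightarrow> bioctonion \<Rightarrow> bioctonion \<Rightarrow> complex" where
  "im_triple z w y = dot7 (cross7 (left_im z) (left_im w)) (left_im y)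
    - dot7 (cross7 (right_im z) (right_im w)) (right_im y)"

lemma vanishes_on_span:
  assumes "\<And>z w. f (z + w) = f z + f w" "\<And>c z. f (bioct_scale c z) = c * (f z :: complex)"
    and "\<And>z. z \<in> S \<Longrightarrow> f z = 0" "z \<in> bioct.span S"
  shows "f z = 0"
  using assms(4)
proof (induction rule: bioct.span_induct_alt)
  case base
  then show ?case using assms(2)[of 0 0] by simp
next
  case (step c x y)
  then show ?case using assms by simp
qed

lemma im_polar_vanishes_on_span:
  assumes "\<And>z w. z \<in> S \<Longrightarrow> w \<in> S \<Longrightarrow> im_polar z w = 0" "z \<in> bioct.span S" "w \<in> bioct.span S"
  shows "im_polar z w = 0"
proof -
  note lin = im_polar_def left_im_linear right_im_linear dot7_linear algebra_simps
  have *: "im_polar z w = 0" if "w \<in> S" for w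
    by (rule vanishes_on_span[of "\<lambda>z. im_polar z w" S]) (use assms that in \<open>simp_all add: lin\<close>)
  show ?thesis
    by (rule vanishes_on_span[of "im_polar z" S]) (use assms * in \<open>simp_all add: lin\<close>)
qed

lemma im_triple_vanishes_on_span:
  assumes "\<And>z w y. z \<in> S \<Longrightarrow> w \<in> S \<Longrightarrow> y \<in> S \<Longrightarrow> im_triple z w y = 0"
    "z \<in> bioct.span S" "w \<in> bioct.span S" "y \<in> bioct.span S"
  shows "im_triple z w y = 0"
proof -
  note lin = im_triple_def left_im_linear right_im_linear dot7_linear cross7_linear algebra_simps
  have *: "im_triple z w y = 0" if "w \<in> S" "y \<in> S" for w y
    by (rule vanishes_on_span[of "\<lambda>z. im_triple z w y" S]) (use assms that in \<open>simp_all add: lin\<close>)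
  have **: "im_triple z w y = 0" if "y \<in> S" for y
    by (rule vanishes_on_span[of "\<lambda>w. im_triple z w y" S]) (use assms * that in \<open>simp_all add: lin\<close>)
  show ?thesis
    by (rule vanishes_on_span[of "im_triple z w" S]) (use assms ** in \<open>simp_all add: lin\<close>)
qed

lemma span_frame:
  assumes "v \<in> frames"
  shows "bioct.span (range v) = range (\<lambda>c. \<Sum>i\<in>UNIV. bioct_scale (c i) (v i))"
    "(\<Sum>i\<in>UNIV. bioct_scale (c i) (v i)) = 0 \<Longrightarrow> c i = 0"
    "bioct.span (range v) \<in> Gr7"
proof -
  have v: "inj v" "bioct.independent (range v)" "range v \<subseteq> Im_Im"
    using assms by (auto simp: frames_def)
  have reindex: "(\<Sum>z\<in>range v. bioct_scale (c z) z) = (\<Sum>i\<in>UNIV. bioct_scale (c (v i)) (v i))" for c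
    using v(1) by (simp add: sum.reindex)
  show "bioct.span (range v) = range (\<lambda>c. \<Sum>i\<in>UNIV. bioct_scale (c i) (v i))"
  proof
    show "bioct.span (range v) \<subseteq> range (\<lambda>c. \<Sum>i\<in>UNIV. bioct_scale (c i) (v i))"
      by (auto simp: bioct.span_finite reindex)
    have "(\<Sum>i\<in>UNIV. bioct_scale (c i) (v i)) \<in> bioct.span (range v)" for c
      by (intro bioct.span_sum bioct.span_scale bioct.span_base) simp
    then show "range (\<lambda>c. \<Sum>i\<in>UNIV. bioct_scale (c i) (v i)) \<subseteq> bioct.span (range v)"
      by blast
  qed
  show "c i = 0" if "(\<Sum>i\<in>UNIV. bioct_scale (c i) (v i)) = 0"
  proof -
    have "(\<Sum>z\<in>range v. bioct_scale (c (inv v z)) z) = 0"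
      using that v(1) by (simp add: reindex)
    then have "c (inv v (v i)) = 0"
      using v(2) bioct.dependent_finite[of "range v"] by auto
    then show ?thesis using v(1) by simp
  qed
  have "card (range v) = 7"
    using v(1) by (simp add: card_image)
  then show "bioct.span (range v) \<in> Gr7"
    using v bioct.span_minimal[OF v(3) subspace_Im_Im] bioct.dim_span_eq_card_independent[OF v(2)]
    by (simp add: Gr7_def)
qed

definition graph_matrix :: "(imo \<Rightarrow> imo) \<Rightarrow> (7 \<Rightarrow> bioctonion) \<Rightarrow> complex ^ 7 ^ 7" where
  "graph_matrix h v = (\<chi> i. h (left_im (v i)) - right_im (v i))"

text \<open>
  A combination of the frame lies in the graph iff the same combination of the rows is zero.
\<close>

lemma graph_meets_iff_det:
  assumes h: "h \<in> Aut7" and v: "v \<in> frames"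
  shows "bioct.span (range v) \<inter> graph7 h \<noteq> {0} \<longleftrightarrow> det (graph_matrix h v) = 0"
proof -
  have vIm: "v i \<in> Im_Im" for i using v by (auto simp: frames_def)
  have graph: "z \<in> graph7 h \<longleftrightarrow> h (left_im z) = right_im z" if "z \<in> Im_Im" for z
    using that by (auto simp: Im_Im_emb graph7_def)
  define s where "s c = (\<Sum>i\<in>UNIV. bioct_scale (c i) (v i))" for c
  have sIm: "s c \<in> Im_Im" for c
    unfolding s_def using vIm by (intro bioct.subspace_sum[OF subspace_Im_Im] bioct.subspace_scale[OF subspace_Im_Im])
  have lin: "(\<Sum>i\<in>UNIV. c i *s row i (graph_matrix h v)) = h (left_im (s c)) - right_im (s c)" for c
  proof -
    have "left_im (sum f I) = (\<Sum>i\<in>I. left_im (f i))" "right_im (sum f I) = (\<Sum>i\<in>I. right_im (f i))"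
      for f :: "7 \<Rightarrow> bioctonion" and I
      by (induction I rule: infinite_finite_induct) (auto simp: left_im_linear right_im_linear left_im_def right_im_def)
    then have "h (left_im (s c)) - right_im (s c) = (\<Sum>i\<in>UNIV. c i *s (h (left_im (v i)) - right_im (v i)))"
      by (simp add: s_def left_im_linear right_im_linear Aut7_sum[OF h] Aut7_scale[OF h]
          vec.scale_right_diff_distrib sum_subtractf)
    moreover have "row i (graph_matrix h v) = h (left_im (v i)) - right_im (v i)" for i
      by (simp add: row_def graph_matrix_def vec_eq_iff)
    ultimately show ?thesis by (simp only:)
  qed
  have "det (graph_matrix h v) \<noteq> 0 \<longleftrightarrow> (\<forall>c. s c \<in> graph7 h \<longrightarrow> (\<forall>i. c i = 0))"
    by (simp add: invertible_right_inverse matrix_right_invertible_independent_rows lin graph[OF sIm]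
        flip: invertible_det_nz)
  also have "\<dots> \<longleftrightarrow> bioct.span (range v) \<inter> graph7 h \<subseteq> {0}"
  proof
    assume "\<forall>c. s c \<in> graph7 h \<longrightarrow> (\<forall>i. c i = 0)"
    then show "bioct.span (range v) \<inter> graph7 h \<subseteq> {0}"
      unfolding span_frame(1)[OF v] s_def by auto
  next
    assume "bioct.span (range v) \<inter> graph7 h \<subseteq> {0}"
    then show "\<forall>c. s c \<in> graph7 h \<longrightarrow> (\<forall>i. c i = 0)"
      unfolding span_frame(1)[OF v] s_def using span_frame(2)[OF v] by blast
  qed
  also have "\<dots> \<longleftrightarrow> bioct.span (range v) \<inter> graph7 h = {0}"
    using bioct.span_zero[of "range v"] bioct.subspace_0[OF Gr7D(1)[OF graph7_Gr7[OF h]]] by auto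
  finally show ?thesis by blast
qed

text \<open>
  The three conditions are polynomial and hold for graphs.  The first two characterise the
  imaginary parts of isotropic subalgebras, and the third one separates the two families.
\<close>

definition graph_limits :: "bioctonion set set" where
  "graph_limits = {L \<in> Gr7. (\<forall>z\<in>L. \<forall>w\<in>L. im_polar z w = 0) \<and> (\<forall>z\<in>L. \<forall>w\<in>L. \<forall>y\<in>L. im_triple z w y = 0)
     \<and> (\<forall>h\<in>Aut7. L \<inter> graph7 h \<noteq> {0})}"

lemma zariski_closed_graph_limits: "zariski_closed graph_limits"
proof -
  let ?P = "(\<Union>i j. {\<lambda>v. im_polar (v i) (v j)}) \<union> (\<Union>i j k. {\<lambda>v. im_triple (v i) (v j) (v k)})
    \<union> (\<Union>h\<in>Aut7. {\<lambda>v. det (graph_matrix h v)})"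
  have poly: "poly_fun p" if "p \<in> ?P" for p
  proof -
    have "poly_fun (\<lambda>v. im_polar (v i) (v j))" for i j
      unfolding im_polar_def by (intro poly_fun_diff poly_fun_dot7 poly_fun_left poly_fun_right)
    moreover have "poly_fun (\<lambda>v. im_triple (v i) (v j) (v k))" for i j k
      unfolding im_triple_def by (intro poly_fun_diff poly_fun_dot7 poly_fun_cross7 poly_fun_left poly_fun_right)
    moreover have "poly_fun (\<lambda>v. det (graph_matrix h v))" if "h \<in> Aut7" for h
      using that unfolding graph_matrix_def
      by (intro poly_fun_det) (simp, intro poly_fun_diff poly_fun_Aut7_left poly_fun_right)
    ultimately show ?thesis using that by blast
  qed
  have "bioct.span (range v) \<in> graph_limits \<longleftrightarrow> (\<forall>p\<in>?P. p v = 0)" if v: "v \<in> frames" for v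
  proof -
    let ?L = "bioct.span (range v)"
    have base: "v i \<in> ?L" for i by (simp add: bioct.span_base)
    have "(\<forall>z\<in>?L. \<forall>w\<in>?L. im_polar z w = 0) \<longleftrightarrow> (\<forall>i j. im_polar (v i) (v j) = 0)"
    proof
      assume *: "\<forall>i j. im_polar (v i) (v j) = 0"
      then have "im_polar z w = 0" if "z \<in> range v" "w \<in> range v" for z w using that by blast
      then show "\<forall>z\<in>?L. \<forall>w\<in>?L. im_polar z w = 0"
        using im_polar_vanishes_on_span by blast
    qed (use base in blast)
    moreover have "(\<forall>z\<in>?L. \<forall>w\<in>?L. \<forall>y\<in>?L. im_triple z w y = 0) \<longleftrightarrow> (\<forall>i j k. im_triple (v i) (v j) (v k) = 0)"
    proof
      assume *: "\<forall>i j k. im_triple (v i) (v j) (v k) = 0"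
      then have "im_triple z w y = 0" if "z \<in> range v" "w \<in> range v" "y \<in> range v" for z w y using that by blast
      then show "\<forall>z\<in>?L. \<forall>w\<in>?L. \<forall>y\<in>?L. im_triple z w y = 0"
        using im_triple_vanishes_on_span by blast
    qed (use base in blast)
    moreover have "(\<forall>h\<in>Aut7. ?L \<inter> graph7 h \<noteq> {0}) \<longleftrightarrow> (\<forall>h\<in>Aut7. det (graph_matrix h v) = 0)"
      using graph_meets_iff_det[OF _ v] by blast
    ultimately show ?thesis
      unfolding graph_limits_def using span_frame(3)[OF v] by (simp add: ball_Un)
  qed
  then show ?thesis
    unfolding zariski_closed_def using poly by (intro conjI exI[of _ ?P]) (auto simp: graph_limits_def)
qed

lemma graph7_in_graph_limits:
  assumes g: "g \<in> Aut7"
  shows "graph7 g \<in> graph_limits"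
proof -
  have "im_polar z w = 0" "im_triple z w y = 0" if "z \<in> graph7 g" "w \<in> graph7 g" "y \<in> graph7 g" for z w y
    using that by (auto simp: graph7_def im_polar_def im_triple_def Aut7_dot[OF g] simp flip: Aut7_cross[OF g])
  moreover have "graph7 g \<inter> graph7 h \<noteq> {0}" if "h \<in> Aut7" for h
    using graph7_Int_odd[OF g that] by (auto dest!: arg_cong[where f = bioct.dim])
  ultimately show ?thesis
    using graph7_Gr7[OF g] by (simp add: graph_limits_def)
qed

lemma double_Cayley_Grassmannian_subset_graph_limits: "double_Cayley_Grassmannian \<subseteq> graph_limits"
  unfolding double_Cayley_Grassmannian_def zariski_closure_def
  using zariski_closed_graph_limits graph7_in_graph_limits by (auto simp: im_graph_G2)

section \<open>The double Cayley Grassmannian\<close>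

lemma polar_eq_im_polar: "z \<in> Im_Im \<Longrightarrow> w \<in> Im_Im \<Longrightarrow> bioct_polar z w = im_polar z w"
  by (auto simp: Im_Im_emb polar_emb im_polar_def)

text \<open>
  Vanishing of the three-form on \<open>L\<close> says that products of members of \<open>L\<close> are orthogonal to \<open>L\<close>,
  and \<open>L\<close> is its own orthogonal in the imaginary part.
\<close>

lemma graph_limits_isotropic_cross_closed:
  assumes "L \<in> graph_limits"
  shows "isotropic L" "cross_closed L"
proof -
  have L: "L \<in> Gr7" and p: "\<And>z w. z \<in> L \<Longrightarrow> w \<in> L \<Longrightarrow> im_polar z w = 0"
    and t: "\<And>z w y. z \<in> L \<Longrightarrow> w \<in> L \<Longrightarrow> y \<in> L \<Longrightarrow> im_triple z w y = 0"
    using assms by (auto simp: graph_limits_def)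
  have LIm: "z \<in> Im_Im" if "z \<in> L" for z using Gr7D(2)[OF L] that by blast
  show iso: "isotropic L"
    using Gr7D(1)[OF L] p LIm by (simp add: isotropic_def polar_eq_im_polar flip: bioct_polar_self)
  show "cross_closed L"
    unfolding cross_closed_def
  proof (intro allI impI)
    fix x y x' y' assume m: "emb x y \<in> L" "emb x' y' \<in> L"
    show "emb (cross7 x x') (cross7 y y') \<in> L"
    proof (rule isotropic_maximal[OF L iso])
      show "emb (cross7 x x') (cross7 y y') \<in> Im_Im" by (auto simp: Im_Im_emb)
      show "bioct_polar (emb (cross7 x x') (cross7 y y')) w = 0" if "w \<in> L" for w
        using t[OF m that] LIm[OF that] by (auto simp: Im_Im_emb polar_emb im_triple_def)
    qed
  qed
qed

text \<open>
  The first three cases are the members of the double Cayley Grassmannian; the twisted ones belong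
  to the other family.
\<close>

lemma imaginary_subalgebra_cases:
  assumes L: "L \<in> Gr7" "isotropic L" "cross_closed L"
  obtains (graph) h where "h \<in> Aut7" "L = graph7 h"
  | (plane) h k where "h \<in> Aut7" "k \<in> Aut7" "L = plane_degen h k"
  | (space) h k where "h \<in> Aut7" "k \<in> Aut7" "L = space_degen h k 1"
  | (twisted) h k where "h \<in> Aut7" "k \<in> Aut7" "L = space_degen h k (- 1)"
proof -
  interpret lagrangian_relation "\<lambda>x y. emb x y \<in> L"
    by (rule lagrangian_relation_emb[OF L])
  have eqI: "L = range (degen_map h k l r s)"
    if h: "h \<in> Aut7" and k: "k \<in> Aut7"
      and R: "\<And>x y. emb (h x) (k y) \<in> L \<longleftrightarrow> (\<exists>z. x = zorn_diag l r 1 z \<and> y = zorn_diag r l s z)"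
    for h k l r s
  proof (intro equalityI subsetI)
    fix p assume "p \<in> L"
    moreover from this obtain x y where p: "p = emb x y"
      using Gr7D(2)[OF L(1)] Im_Im_emb by blast
    ultimately have "emb (h (inv h x)) (k (inv k y)) \<in> L"
      by (simp add: Aut7_inv_apply h k)
    then obtain z where "inv h x = zorn_diag l r 1 z" "inv k y = zorn_diag r l s z"
      unfolding R by blast
    then have "p = degen_map h k l r s z"
      unfolding p degen_map_def by (metis Aut7_inv_apply(1) h k)
    then show "p \<in> range (degen_map h k l r s)" by blast
  next
    fix p assume "p \<in> range (degen_map h k l r s)"
    then show "p \<in> L" using R by (auto simp: degen_map_def)
  qed
  show thesis
  proof (rule classification[OF dim_left_kernel_eq_dim_right_kernel[OF L(1,2)]])
    fix h assume h: "h \<in> Aut7" "\<And>x y. emb x y \<in> L \<longleftrightarrow> y = h x"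
    have "L = graph7 h"
    proof (intro equalityI subsetI)
      fix p assume p: "p \<in> L"
      then obtain x y where "p = emb x y"
        using Gr7D(2)[OF L(1)] Im_Im_emb by blast
      with p h(2) show "p \<in> graph7 h" by (auto simp: graph7_def)
    qed (use h(2) in \<open>auto simp: graph7_def\<close>)
    then show thesis using graph h(1) by blast
  next
    fix h k assume h: "h \<in> Aut7" and k: "k \<in> Aut7" and R: "\<And>x y. emb (h x) (k y) \<in> L \<longleftrightarrow>
      (\<exists>z. x = zorn_diag (plane_left 0) (plane_right 0) 1 z \<and> y = zorn_diag (plane_right 0) (plane_left 0) 1 z)"
    show thesis by (rule plane[OF h k eqI[OF h k R]])
  next
    fix h k s assume h: "h \<in> Aut7" and k: "k \<in> Aut7" and s: "s = 1 \<or> s = -1"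
      and R: "\<And>x y. emb (h x) (k y) \<in> L \<longleftrightarrow>
      (\<exists>z. x = zorn_diag (space_left 0) (space_right 0) 1 z \<and> y = zorn_diag (space_right 0) (space_left 0) s z)"
    show thesis using space[OF h k] twisted[OF h k] eqI[OF h k R] s by blast
  qed
qed

lemma degen_Int_graph:
  assumes h: "h \<in> Aut7" and k: "k \<in> Aut7"
  shows "range (degen_map h k l r s) \<inter> graph7 (k \<circ> inv h)
    = degen_map h k l r s ` {z. zorn_diag l r 1 z = zorn_diag r l s z}"
proof -
  have "degen_map h k l r s z \<in> graph7 (k \<circ> inv h) \<longleftrightarrow> zorn_diag l r 1 z = zorn_diag r l s z" for z
    by (auto simp: degen_map_def graph7_def Aut7_inv_apply[OF h] Aut7_eq_iff[OF k])
  then show ?thesis by auto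
qed

text \<open>
  A pair in the intersection has equal coordinates on both sides.  At each vector of the Zorn basis
  other than the axis one of the two scalings is zero, and at the axis the signs differ.
\<close>

lemma twisted_degen_Int_graph:
  assumes h: "h \<in> Aut7" and k: "k \<in> Aut7"
  shows "space_degen h k (- 1) \<inter> graph7 (k \<circ> inv h) = {0}"
proof -
  have "z = 0" if "zorn_diag (space_left 0) (space_right 0) 1 z = zorn_diag (space_right 0) (space_left 0) (- 1) z" for z
  proof -
    obtain a b c where z: "z = zorn_comb zE a b c" by (rule zorn_cases)
    have "space_left 0 i * a i = space_right 0 i * a i" "space_right 0 i * b i = space_left 0 i * b i" "c = - c" for i
      using that by (auto simp: z zorn_diag_comb zorn_tables fun_eq_iff)
    moreover have "space_left 0 i \<noteq> space_right 0 i" for i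
      by (simp add: space_left_def space_right_def)
    ultimately have "a i = 0" "b i = 0" "c = 0" for i
      by (metis mult_right_cancel, metis mult_right_cancel, simp)
    then show ?thesis by (simp add: z zorn_comb_eq_0_iff)
  qed
  moreover have "zorn_diag p q s 0 = 0" for p q s
    using zorn_diag_linear(2)[of p q s 0 0] by simp
  ultimately have "{z. zorn_diag (space_left 0) (space_right 0) 1 z = zorn_diag (space_right 0) (space_left 0) (- 1) z} = {0}"
    by auto
  then show ?thesis
    unfolding degen_Int_graph[OF h k]
    by (simp add: degen_map_def \<open>\<And>p q s. zorn_diag p q s 0 = 0\<close> Aut7_zero h k emb_zero)
qed


text \<open>
  The coordinates on which both scalings agree are those of \<open>zE 2\<close>, its dual and the axis.
\<close>

lemma dim_plane_degen_Int_graph: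
  assumes h: "h \<in> Aut7" and k: "k \<in> Aut7"
  shows "bioct.dim (plane_degen h k \<inter> graph7 (k \<circ> inv h)) = 3"
proof -
  let ?W = "{z. zorn_diag (plane_left 0) (plane_right 0) 1 z = zorn_diag (plane_right 0) (plane_left 0) 1 z}"
  let ?B = "{zE 2, dual_triple zE 2, triple_axis zE}"
  note z = null_triple_zE
  note tabs = triple_ee[OF z] triple_ef[OF z] triple_ff[OF z] triple_eu[OF z] triple_fu[OF z] triple_uu[OF z]
  have n: "zE 2 \<notin> vec.span {dual_triple zE 2, triple_axis zE}"
    by (rule not_in_span_if_separated[of _ "dual_triple zE 2"]) (auto simp: tabs dot7_commute[of "dual_triple zE 2" "zE 2"])
  have n2: "dual_triple zE 2 \<notin> vec.span {triple_axis zE}"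
    by (rule not_in_span_if_separated[of _ "zE 2"]) (auto simp: tabs)
  have "triple_axis zE \<notin> vec.span {}"
    by (rule not_in_span_if_separated[of _ "triple_axis zE"]) (auto simp: tabs)
  with n n2 have ind: "vec.independent ?B"
    by (simp add: vec.independent_insert vec.independent_empty)
  have card: "card ?B = 3"
    using n n2 vec.span_base[of "zE 2" "{dual_triple zE 2, triple_axis zE}"]
      vec.span_base[of "dual_triple zE 2" "{triple_axis zE}"] by (auto simp: card_insert_if)
  have W: "zorn_comb zE a b c \<in> ?W \<longleftrightarrow> a 0 = 0 \<and> a 1 = 0 \<and> b 0 = 0 \<and> b 1 = 0" for a b c
    by (auto simp: zorn_diag_comb zorn_tables fun_eq_iff forall_3' plane_left_def plane_right_def)
  have "vec.dim ?W = 3"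
  proof (rule vec.dim_unique[OF _ _ ind card])
    show "?B \<subseteq> ?W"
      using W zorn_basis_as_comb[OF z] by (simp del: mem_Collect_eq)
    show "?W \<subseteq> vec.span ?B"
    proof
      fix x assume x: "x \<in> ?W"
      obtain a b c where "x = zorn_comb zE a b c" by (rule zorn_cases)
      with x W have "x = a 2 *s zE 2 + b 2 *s dual_triple zE 2 + c *s triple_axis zE"
        by (simp add: zorn_comb_def sum_3' del: mem_Collect_eq)
      then show "x \<in> vec.span ?B"
        by (simp add: vec.span_add vec.span_scale vec.span_base)
    qed
  qed
  moreover have lr: "plane_left 0 i \<noteq> 0 \<or> plane_right 0 i \<noteq> 0" for i
    by (simp add: plane_left_def plane_right_def)
  have "Vector_Spaces.linear (*s) bioct_scale (degen_map h k (plane_left 0) (plane_right 0) 1)"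
    by (rule linear_degen_map[OF h k lr])
  moreover have "inj (degen_map h k (plane_left 0) (plane_right 0) 1)"
    by (rule inj_degen_map[OF h k lr])
  ultimately show ?thesis
    unfolding degen_Int_graph[OF h k] by (subst imo_bioct.dim_image_eq) (auto intro: inj_on_subset)
qed

lemma dim_space_degen_Int_graph:
  assumes h: "h \<in> Aut7" and k: "k \<in> Aut7"
  shows "bioct.dim (space_degen h k 1 \<inter> graph7 (k \<circ> inv h)) = 1"
proof -
  have "dot7 (inv h (h (dual_triple zE 2))) (inv k (k (zE 2))) = 2"
    using triple_ef[OF null_triple_zE, of 2 2] by (simp add: Aut7_inv_apply h k dot7_commute)
  then have "dot7 ((k \<circ> inv h) (h (dual_triple zE 2))) (k (zE 2)) \<noteq> 0"
    by (simp add: Aut7_inv_apply h k Aut7_dot)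
  from graph7_meets_space_degen[OF Aut7_comp[OF k Aut7_inv[OF h]] h k this]
  show ?thesis by (simp only: Int_commute)
qed

lemma same_family_via_graph:
  assumes L: "L \<in> Gr7" "isotropic L" and g: "g \<in> Aut7"
  shows "same_family L (im_graph id) \<longleftrightarrow> odd (bioct.dim (L \<inter> graph7 g))"
  using family_parity[OF graph7_Gr7[OF g] isotropic_graph7[OF g] graph7_Gr7[OF Aut7_id] isotropic_graph7[OF Aut7_id] L
      graph7_same_family[OF g]]
  by (simp add: same_family_iff_odd[OF L(1)] im_graph_id Int_commute)

text \<open>
  In each case of the classification the intersection with one suitable automorphism graph decides
  the family, by parity: it is the graph itself, or of dimension \<open>3\<close>, \<open>1\<close> or \<open>0\<close>.  The last
  value also shows that the twisted forms are not limits of graphs.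
\<close>

theorem double_Cayley_Grassmannian_eq:
  "double_Cayley_Grassmannian = {L \<in> spinor_variety. cross_closed L}"
proof -
  have key: "L \<in> double_Cayley_Grassmannian \<longleftrightarrow> same_family L (im_graph id)"
    if L: "L \<in> Gr7" "isotropic L" "cross_closed L" for L
    using L
  proof (cases rule: imaginary_subalgebra_cases)
    case (graph h)
    have "L \<in> double_Cayley_Grassmannian"
      using graph im_graph_G2 by (auto simp: double_Cayley_Grassmannian_def zariski_closure_def)
    then show ?thesis
      using graph same_family_via_graph[OF L(1,2) Aut7_id] graph7_same_family by simp
  next
    case (plane h k)
    then show ?thesis
      using plane_degen_in_closure same_family_via_graph[OF L(1,2) Aut7_comp[OF plane(2) Aut7_inv[OF plane(1)]]]
        dim_plane_degen_Int_graph[OF plane(1,2)] by simp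
  next
    case (space h k)
    then show ?thesis
      using space_degen_in_closure same_family_via_graph[OF L(1,2) Aut7_comp[OF space(2) Aut7_inv[OF space(1)]]]
        dim_space_degen_Int_graph[OF space(1,2)] by simp
  next
    case (twisted h k)
    note g = Aut7_comp[OF twisted(2) Aut7_inv[OF twisted(1)]]
    have 0: "L \<inter> graph7 (k \<circ> inv h) = {0}"
      using twisted_degen_Int_graph[OF twisted(1,2)] twisted(3) by simp
    then have "L \<notin> graph_limits"
      using g by (auto simp: graph_limits_def)
    then have "L \<notin> double_Cayley_Grassmannian"
      using double_Cayley_Grassmannian_subset_graph_limits by blast
    then show ?thesis
      using same_family_via_graph[OF L(1,2) g] by (simp add: 0)
  qed
  show ?thesis
  proof (intro equalityI subsetI)
    fix L assume DG: "L \<in> double_Cayley_Grassmannian"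
    then have "L \<in> graph_limits"
      using double_Cayley_Grassmannian_subset_graph_limits by blast
    then have "L \<in> Gr7" "isotropic L" "cross_closed L"
      using graph_limits_isotropic_cross_closed by (auto simp: graph_limits_def)
    then show "L \<in> {L \<in> spinor_variety. cross_closed L}"
      using key DG by (simp add: spinor_variety_def)
  next
    fix L assume "L \<in> {L \<in> spinor_variety. cross_closed L}"
    then show "L \<in> double_Cayley_Grassmannian"
      using key by (simp add: spinor_variety_def)
  qed
qed

lemma bioct_mult_decompose:
  "bioct_mult (emb x y + bioct_scale c bioct_one) (emb x' y' + bioct_scale c' bioct_one)
   = emb (cross7 x x' + c *s x' + c' *s x) (cross7 y y' + c *s y' + c' *s y)
     + ((c * c' - dot7 x x', 0), (c * c' - dot7 y y', 0))"
  by (simp add: bioct_mult_def oct_mult_def emb_def bioct_one_def oct_one_def bioct_scale_def oct_scale_def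
      algebra_simps)

lemma subalgebra_unit_hull:
  assumes L: "L \<in> Gr7" "isotropic L" and cc: "cross_closed L"
  shows "subalgebra (unit_hull L)"
  unfolding subalgebra_def
proof (intro conjI ballI)
  note sub = Gr7D(1)[OF L(1)]
  show "bioct.subspace (unit_hull L)" by (simp add: unit_hull_def)
  show "bioct_one \<in> unit_hull L" by (simp add: unit_hull_def bioct.span_base)
  fix z w assume z: "z \<in> unit_hull L" and w: "w \<in> unit_hull L"
  have dec: "\<exists>c x y. z = emb x y + bioct_scale c bioct_one \<and> emb x y \<in> L" if "z \<in> unit_hull L" for z
  proof -
    obtain c where c: "z - bioct_scale c bioct_one \<in> L"
      using \<open>z \<in> unit_hull L\<close> sub by (auto simp: mem_unit_hull)
    then obtain x y where "z - bioct_scale c bioct_one = emb x y"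
      using Gr7D(2)[OF L(1)] Im_Im_emb by blast
    then have "z = emb x y + bioct_scale c bioct_one" by (simp add: algebra_simps)
    then show ?thesis using c \<open>z - bioct_scale c bioct_one = emb x y\<close> by auto
  qed
  obtain c x y where 1: "z = emb x y + bioct_scale c bioct_one" "emb x y \<in> L" using dec[OF z] by blast
  obtain c' x' y' where 2: "w = emb x' y' + bioct_scale c' bioct_one" "emb x' y' \<in> L" using dec[OF w] by blast
  have dot: "dot7 x x' = dot7 y y'"
    using isotropic_polar[OF L(2) 1(2) 2(2)] by (simp add: polar_emb)
  have "emb (cross7 x x') (cross7 y y') + bioct_scale c (emb x' y') + bioct_scale c' (emb x y) \<in> L"
    using cc 1 2 by (intro bioct.subspace_add[OF sub] bioct.subspace_scale[OF sub]) (auto simp: cross_closed_def)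
  moreover have "bioct_mult z w - bioct_scale (c * c' - dot7 x x') bioct_one
      = emb (cross7 x x') (cross7 y y') + bioct_scale c (emb x' y') + bioct_scale c' (emb x y)"
    unfolding 1(1) 2(1) bioct_mult_decompose
    by (simp add: dot emb_def bioct_one_def oct_one_def bioct_scale_def oct_scale_def)
  ultimately show "bioct_mult z w \<in> unit_hull L"
    unfolding mem_unit_hull[OF sub] by metis
qed

lemma isotropic_subspace_unit_hull: 
  assumes "L \<in> Gr7" "isotropic L"
  shows "isotropic (unit_hull L)"
  using bioct_polar_unit_hull[OF Gr7D(1,2)[OF assms(1)] assms(2)]
  by (simp add: isotropic_def unit_hull_def flip: bioct_polar_self)

text \<open>
  Orthogonality to the unit makes the scalar parts of the two components of a member equal, so a
  multiple of the unit can be split off.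
\<close>

lemma isotropic_subalgebra_decompose:
  assumes A: "subalgebra A" "isotropic A"
  shows "unit_hull (A \<inter> Im_Im) = A" and "cross_closed (A \<inter> Im_Im)"
proof -
  have sub: "bioct.subspace A" and one: "bioct_one \<in> A"
    using A(1) by (auto simp: subalgebra_def)
  have sI: "bioct.subspace (A \<inter> Im_Im)"
    using sub subspace_Im_Im by (rule bioct.subspace_inter)
  show hull: "unit_hull (A \<inter> Im_Im) = A"
  proof
    show "unit_hull (A \<inter> Im_Im) \<subseteq> A"
      unfolding unit_hull_def using one sub by (intro bioct.span_minimal) auto
    show "A \<subseteq> unit_hull (A \<inter> Im_Im)"
    proof
      fix z assume z: "z \<in> A"
      have "bioct_polar z bioct_one = 0" by (rule isotropic_polar[OF A(2) z one])
      then have "fst (fst z) = fst (snd z)"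
        by (simp add: bioct_polar_def bioct_one_def oct_one_def dot7_zero)
      then have "z - bioct_scale (fst (fst z)) bioct_one \<in> Im_Im"
        by (simp add: Im_Im_def bioct_scale_def oct_scale_def bioct_one_def oct_one_def)
      moreover have "z - bioct_scale (fst (fst z)) bioct_one \<in> A"
        by (intro bioct.subspace_diff[OF sub z] bioct.subspace_scale[OF sub one])
      ultimately show "z \<in> unit_hull (A \<inter> Im_Im)"
        using sI by (auto simp: mem_unit_hull)
    qed
  qed
  show "cross_closed (A \<inter> Im_Im)"
    unfolding cross_closed_def
  proof (intro allI impI)
    fix x y x' y' assume m: "emb x y \<in> A \<inter> Im_Im" "emb x' y' \<in> A \<inter> Im_Im"
    then have dot: "dot7 x x' = dot7 y y'"
      using isotropic_polar[OF A(2), of "emb x y" "emb x' y'"] by (simp add: polar_emb)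
    have "bioct_mult (emb x y) (emb x' y') \<in> A"
      using A(1) m by (simp add: subalgebra_def)
    then have "bioct_mult (emb x y) (emb x' y') + bioct_scale (dot7 x x') bioct_one \<in> A"
      by (intro bioct.subspace_add[OF sub] bioct.subspace_scale[OF sub one])
    moreover have "bioct_mult (emb x y) (emb x' y') + bioct_scale (dot7 x x') bioct_one = emb (cross7 x x') (cross7 y y')"
      using bioct_mult_decompose[of x y 0 x' y' 0]
      by (simp add: dot) (simp add: emb_def bioct_one_def oct_one_def bioct_scale_def oct_scale_def zero_prod_def)
    ultimately show "emb (cross7 x x') (cross7 y y') \<in> A \<inter> Im_Im"
      by (auto simp: Im_Im_emb)
  qed
qed

theorem proposition6:
  shows "bij_betw (\<lambda>L. bioct.span (insert bioct_one L))
           double_Cayley_Grassmannian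
           {A. subalgebra A \<and> isotropic A \<and> bioct.dim A = 8 \<and> A \<inter> Im_Im \<in> spinor_variety}"
proof -
  have DG: "L \<in> Gr7" "isotropic L" "cross_closed L" "L \<in> spinor_variety"
    if "L \<in> double_Cayley_Grassmannian" for L
    using that unfolding double_Cayley_Grassmannian_eq by (auto simp: spinor_variety_def)
  have im_part: "unit_hull L \<inter> Im_Im = L" if "L \<in> double_Cayley_Grassmannian" for L
    using unit_hull_Int_Im_Im Gr7D DG(1)[OF that] by blast
  have "bij_betw unit_hull double_Cayley_Grassmannian
     {A. subalgebra A \<and> isotropic A \<and> bioct.dim A = 8 \<and> A \<inter> Im_Im \<in> spinor_variety}"
  proof (rule bij_betwI[where g = "\<lambda>A. A \<inter> Im_Im"])
    show "unit_hull \<in> double_Cayley_Grassmannian \<rightarrow>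
       {A. subalgebra A \<and> isotropic A \<and> bioct.dim A = 8 \<and> A \<inter> Im_Im \<in> spinor_variety}"
      using DG im_part by (auto simp: subalgebra_unit_hull isotropic_subspace_unit_hull dim_unit_hull Gr7D)
    show "(\<lambda>A. A \<inter> Im_Im) \<in> {A. subalgebra A \<and> isotropic A \<and> bioct.dim A = 8 \<and> A \<inter> Im_Im \<in> spinor_variety}
       \<rightarrow> double_Cayley_Grassmannian"
      unfolding double_Cayley_Grassmannian_eq using isotropic_subalgebra_decompose(2) by auto
  qed (use im_part isotropic_subalgebra_decompose(1) in auto)
  then show ?thesis unfolding unit_hull_def .
qed

end
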